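(* Let $X_0,X_1,\dots,X_n$ be smooth vector fields on a bounded domain $\Omega\subset\mathbb{R}^p$, free up to weight $r$ and satisfying Hörmander's condition of step $r$ in $\Omega$, and let $B$, $Box(\overline x,R)$ and the metric balls $B(\overline x,R)$ be as in the context. For every $\Omega'\Subset\Omega$ there exist positive constants $C,R_0,c_1,c_2,c_3$ depending on $\Omega,\Omega'$ and the system $\{X_{[I]}\}_{I\in B}$ such that, for any $\overline x\in\Omega'$ and $R\le R_0$: (i) $Box(\overline x,R)\subseteq B(\overline x,R)\subseteq Box(\overline x,CR)$; (ii) $c_1R^Q\le|B(\overline x,R)|\le c_2R^Q$, where $Q=\sum_{I\in B}|I|$; (iii) $|B(\overline x,2R)|\le c_3|B(\overline x,R)|$.
   Context: Weights and commutators: $X_0$ has weight $p_0=2$, $X_i$ has weight $p_i=1$ for $i\ge1$. For $I=(i_1,\dots,i_k)$, $i_j\in\{0,\dots,n\}$, $|I|=\sum_j p_{i_j}$ and $X_{[I]}=[X_{i_1},[X_{i_2},\dots[X_{i_{k-1}},X_{i_k}]\dots]]$, $X_{[(i)]}=X_i$. Hörmander's condition of step $r$ in $\Omega$: $\{(X_{[I]})_x\}_{|I|\le r}$ spans $\mathbb{R}^p$ for every $x\in\Omega$. In noncommuting indeterminates $\xi_0,\dots,\xi_n$ write $\xi_{[I]}=[\xi_{i_1},[\dots,\xi_{i_k}]\dots]=\sum_JA_{IJ}\xi_J$. The fields are free up to weight $r$ in $\Omega$ if at each $x\in\Omega$: $\sum_{|I|\le r}a_I(X_{[I]})_x=0$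 (real constants $a_I$) implies $\sum_{|I|\le r} a_IA_{IJ}=0$ for all $J$. A set $B$ of $p$ multiindices of weight $\le r$ is fixed so that $\{(X_{[I]})_x\}_{I\in B}$ is a basis of $\mathbb{R}^p$ at every $x\in\Omega$. Distance induced by $\{X_{[I]}\}_{I\in B}$: for $\delta>0$ let $C(\delta)$ be the class of absolutely continuous $\varphi:[0,1]\to\Omega$ with $\varphi'(t)=\sum_{I\in B}a_I(t)(X_{[I]})_{\varphi(t)}$ for a.e. $t$, $|a_I(t)|\le\delta^{|I|}$; $d(x,y)=\inf\{\delta>0:\exists\varphi\in C(\delta),\ \varphi(0)=x,\ \varphi(1)=y\}$. $B(x,R)$ is the ball of center $x$ and radius $R$ for $d$, and $|\cdot|$ of a set is its Lebesgue measure. Boxes: $\exp(Z)(\overline x)$ is the time-1 value of the solution of $\phi'=Z_\phi$, $\phi(0)=\overline x$; $Box(\overline x,R)=\{x: x=\exp(\sum_{I\in B}u_IX_{[I]})(\overline x),\ |u_I|<R^{|I|}\text{ for any }I\in B\}$ (for $R$ small). *)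

theory Defs
  imports "HOL-Analysis.Analysis" "HOL-Library.Poly_Mapping"
begin

text \<open>
  \<open>Ck_on k f S\<close> is used for open \<open>S\<close> only, where it says that all iterated directional
  derivatives of \<open>f\<close> of order at most \<open>k\<close> exist and are continuous on \<open>S\<close>.
\<close>

fun Ck_on :: "nat \<Rightarrow> ('a::real_normed_vector \<Rightarrow> 'b::real_normed_vector) \<Rightarrow> 'a set \<Rightarrow> bool" where
  "Ck_on 0 f S \<longleftrightarrow> continuous_on S f"
| "Ck_on (Suc k) f S \<longleftrightarrow>
     (\<forall>x\<in>S. f differentiable (at x)) \<and> (\<forall>v. Ck_on k (\<lambda>x. frechet_derivative f (at x) v) S)"

definition smooth_on :: "('a::real_normed_vector \<Rightarrow> 'b::real_normed_vector) \<Rightarrow> 'a set \<Rightarrow> bool" where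
  "smooth_on f S \<longleftrightarrow> (\<forall>k. Ck_on k f S)"

text \<open>
  A vector field is identified with its coefficient vector; the bracket is the one of
  first-order operators, \<open>[X,Y] f = X (Y f) - Y (X f)\<close>.
\<close>

definition lie_bracket ::
    "('a::real_normed_vector \<Rightarrow> 'a) \<Rightarrow> ('a \<Rightarrow> 'a) \<Rightarrow> 'a \<Rightarrow> 'a" where
  "lie_bracket X Y x = frechet_derivative Y (at x) (X x) - frechet_derivative X (at x) (Y x)"

definition field_weight :: "nat \<Rightarrow> nat" where
  "field_weight i = (if i = 0 then 2 else 1)"

definition weight :: "nat list \<Rightarrow> nat" where
  "weight I = (\<Sum>i\<leftarrow>I. field_weight i)"

definition multiindices :: "nat \<Rightarrow> nat \<Rightarrow> nat list set" where
  "multiindices n r = {I. I \<noteq> [] \<and> set I \<subseteq> {0..n} \<and> weight I \<le> r}"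

lemma length_le_weight: "length I \<le> weight I"
  by (induction I) (auto simp: weight_def field_weight_def)

lemma finite_multiindices: "finite (multiindices n r)"
proof (rule finite_subset)
  show "multiindices n r \<subseteq> {I. set I \<subseteq> {0..n} \<and> length I \<le> r}"
    by (auto simp: multiindices_def intro: order_trans[OF length_le_weight])
  show "finite {I. set I \<subseteq> {0..n} \<and> length I \<le> r}"
    by (rule finite_lists_length_le) simp
qed

text \<open>Right-nested bracket \<open>[g i\<^sub>1, [g i\<^sub>2, \<dots> [g i\<^sub>k\<^sub>-\<^sub>1, g i\<^sub>k] \<dots>]]\<close>; the empty list is never used.\<close>

fun nested_bracket :: "('b \<Rightarrow> 'b \<Rightarrow> 'b) \<Rightarrow> (nat \<Rightarrow> 'b) \<Rightarrow> nat list \<Rightarrow> 'b" where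
  "nested_bracket br g [] = undefined"
| "nested_bracket br g [i] = g i"
| "nested_bracket br g (i # j # I) = br (g i) (nested_bracket br g (j # I))"

definition comm_field ::
    "(nat \<Rightarrow> 'a::real_normed_vector \<Rightarrow> 'a) \<Rightarrow> nat list \<Rightarrow> 'a \<Rightarrow> 'a" where
  "comm_field X I = nested_bracket lie_bracket X I"

text \<open>
  Lists form the free monoid (written additively, as \<^theory>\<open>HOL-Library.Poly_Mapping\<close> requires),
  so \<^typ>\<open>nat list \<Rightarrow>\<^sub>0 real\<close> with its convolution product is the free associative real algebra
  on indeterminates \<open>\<xi>\<^sub>0, \<xi>\<^sub>1, \<dots>\<close>, and \<open>lookup f J\<close> is the coefficient of \<open>\<xi>\<^sub>J\<close> in \<open>f\<close>.
\<close>

instantiation list :: (type) monoid_add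
begin

definition zero_list :: "'a list" where "zero_list = []"

definition plus_list :: "'a list \<Rightarrow> 'a list \<Rightarrow> 'a list" where "plus_list xs ys = xs @ ys"

instance
  by standard (simp_all add: zero_list_def plus_list_def)

end

definition xi :: "nat \<Rightarrow> (nat list \<Rightarrow>\<^sub>0 real)" where
  "xi i = Poly_Mapping.single [i] 1"

definition comm_xi :: "nat list \<Rightarrow> (nat list \<Rightarrow>\<^sub>0 real)" where
  "comm_xi I = nested_bracket (\<lambda>f g. f * g - g * f) xi I"

definition comm_coeff :: "nat list \<Rightarrow> nat list \<Rightarrow> real" where
  "comm_coeff I J = Poly_Mapping.lookup (comm_xi I) J"

definition hoermander_condition ::
    "nat \<Rightarrow> nat \<Rightarrow> (real^'p) set \<Rightarrow> (nat \<Rightarrow> real^'p \<Rightarrow> real^'p) \<Rightarrow> bool" where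
  "hoermander_condition n r \<Omega> X \<longleftrightarrow>
     (\<forall>x\<in>\<Omega>. span ((\<lambda>I. comm_field X I x) ` multiindices n r) = UNIV)"

definition free_up_to_weight ::
    "nat \<Rightarrow> nat \<Rightarrow> (real^'p) set \<Rightarrow> (nat \<Rightarrow> real^'p \<Rightarrow> real^'p) \<Rightarrow> bool" where
  "free_up_to_weight n r \<Omega> X \<longleftrightarrow>
     (\<forall>x\<in>\<Omega>. \<forall>a :: nat list \<Rightarrow> real.
        (\<Sum>I\<in>multiindices n r. a I *\<^sub>R comm_field X I x) = 0 \<longrightarrow>
        (\<forall>J. (\<Sum>I\<in>multiindices n r. a I * comm_coeff I J) = 0))"

definition commutator_basis ::
    "nat \<Rightarrow> nat \<Rightarrow> (real^'p) set \<Rightarrow> (nat \<Rightarrow> real^'p \<Rightarrow> real^'p) \<Rightarrow> nat list set \<Rightarrow> bool" where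
  "commutator_basis n r \<Omega> X B \<longleftrightarrow>
     B \<subseteq> multiindices n r \<and> card B = CARD('p) \<and>
     (\<forall>x\<in>\<Omega>. inj_on (\<lambda>I. comm_field X I x) B \<and>
            independent ((\<lambda>I. comm_field X I x) ` B) \<and>
            span ((\<lambda>I. comm_field X I x) ` B) = UNIV)"

definition absolutely_continuous_on_interval ::
    "real \<Rightarrow> real \<Rightarrow> (real \<Rightarrow> 'a::metric_space) \<Rightarrow> bool" where
  "absolutely_continuous_on_interval a b f \<longleftrightarrow>
     (\<forall>\<epsilon>>0. \<exists>\<delta>>0. \<forall>D :: (real \<times> real) set.
        finite D \<longrightarrow> (\<forall>(s,t)\<in>D. a \<le> s \<and> s \<le> t \<and> t \<le> b) \<longrightarrow>
        pairwise (\<lambda>(s,t) (s',t'). {s<..<t} \<inter> {s'<..<t'} = {}) D \<longrightarrow>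
        (\<Sum>(s,t)\<in>D. t - s) < \<delta> \<longrightarrow> (\<Sum>(s,t)\<in>D. dist (f s) (f t)) < \<epsilon>)"

text \<open>
  From here on \<open>Y I\<close> stands for the field \<open>X\<^sub>[\<^sub>I\<^sub>]\<close>.  No measurability of the coefficients
  \<open>a\<close> is asked for.
\<close>

definition admissible_curves ::
    "(real^'p) set \<Rightarrow> nat list set \<Rightarrow> (nat list \<Rightarrow> real^'p \<Rightarrow> real^'p) \<Rightarrow> real \<Rightarrow>
     (real \<Rightarrow> real^'p) set" where
  "admissible_curves \<Omega> B Y \<delta> =
     {\<phi>. absolutely_continuous_on_interval 0 1 \<phi> \<and> \<phi> ` {0..1} \<subseteq> \<Omega> \<and>
         (\<exists>a :: nat list \<Rightarrow> real \<Rightarrow> real. AE t in lebesgue. t \<in> {0..1} \<longrightarrow>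
            (\<phi> has_vector_derivative (\<Sum>I\<in>B. a I t *\<^sub>R Y I (\<phi> t))) (at t within {0..1}) \<and>
            (\<forall>I\<in>B. \<bar>a I t\<bar> \<le> \<delta> ^ weight I))}"

text \<open>Extended real values, so that the infimum over the empty set is \<open>\<infinity>\<close>.\<close>

definition cc_dist ::
    "(real^'p) set \<Rightarrow> nat list set \<Rightarrow> (nat list \<Rightarrow> real^'p \<Rightarrow> real^'p) \<Rightarrow>
     real^'p \<Rightarrow> real^'p \<Rightarrow> ereal" where
  "cc_dist \<Omega> B Y x y =
     Inf (ereal ` {\<delta>. \<delta> > 0 \<and> (\<exists>\<phi>\<in>admissible_curves \<Omega> B Y \<delta>. \<phi> 0 = x \<and> \<phi> 1 = y)})"

definition cc_ball ::
    "(real^'p) set \<Rightarrow> nat list set \<Rightarrow> (nat list \<Rightarrow> real^'p \<Rightarrow> real^'p) \<Rightarrow>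
     real^'p \<Rightarrow> real \<Rightarrow> (real^'p) set" where
  "cc_ball \<Omega> B Y x R = {y \<in> \<Omega>. cc_dist \<Omega> B Y x y < ereal R}"

definition integral_curve ::
    "(real^'p) set \<Rightarrow> (real^'p \<Rightarrow> real^'p) \<Rightarrow> real^'p \<Rightarrow> (real \<Rightarrow> real^'p) \<Rightarrow> bool" where
  "integral_curve \<Omega> Z x \<phi> \<longleftrightarrow>
     \<phi> 0 = x \<and> (\<forall>t\<in>{0..1}. \<phi> t \<in> \<Omega> \<and> (\<phi> has_vector_derivative Z (\<phi> t)) (at t within {0..1}))"

text \<open>
  Meaningful only if a solution stays in \<open>\<Omega>\<close> up to time 1 (it is then unique for smooth \<open>Z\<close>);
  otherwise the value is unspecified.  This is why boxes are considered for small radii.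
\<close>

definition field_exp ::
    "(real^'p) set \<Rightarrow> (real^'p \<Rightarrow> real^'p) \<Rightarrow> real^'p \<Rightarrow> real^'p" where
  "field_exp \<Omega> Z x = (THE y. \<exists>\<phi>. integral_curve \<Omega> Z x \<phi> \<and> y = \<phi> 1)"

definition cc_box ::
    "(real^'p) set \<Rightarrow> nat list set \<Rightarrow> (nat list \<Rightarrow> real^'p \<Rightarrow> real^'p) \<Rightarrow>
     real^'p \<Rightarrow> real \<Rightarrow> (real^'p) set" where
  "cc_box \<Omega> B Y x R =
     {field_exp \<Omega> (\<lambda>y. \<Sum>I\<in>B. u I *\<^sub>R Y I y) x | u. \<forall>I\<in>B. \<bar>u I\<bar> < R ^ weight I}"

end

theory Submission
  imports Defs
begin

text \<open>
  Write \<open>E u\<close> for the time-one value of the flow of \<open>\<Sum>\<^sub>I u\<^sub>I X\<^sub>[\<^sub>I\<^sub>]\<close> started at the centre \<open>x\<close>. Gronwall's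
  inequality shows that \<open>E\<close> is bi-Lipschitz near \<open>0\<close> and that its image contains a ball, with
  constants uniform in \<open>x\<close>; this gives the volume of boxes.

  Freeness enters only through a filtration: substituting the fields for the indeterminates turns
  identities in the free algebra into identities between vector fields, so \<open>[X\<^sub>[\<^sub>I\<^sub>], X\<^sub>[\<^sub>J\<^sub>]]\<close> is a
  combination of those \<open>X\<^sub>[\<^sub>L\<^sub>]\<close>, \<open>L \<in> B\<close>, with \<open>|L| \<le> |I| + |J|\<close>. Let \<open>V\<close> be the coordinates, in the
  moving frame, of the difference of the flows for \<open>u\<close> and \<open>v\<close>. Up to an error quadratic in \<open>v - u\<close>,
  \<open>V\<close> solves a linear equation whose matrix is built from \<open>u\<close> and the structure functions of the
  frame. After dividing \<open>V\<^sub>I\<close> by \<open>\<delta>\<^bsup>|I|\<^esup>\<close>, the filtration makes this matrix small, uniformly in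
  \<open>\<delta> \<le> 1\<close>, when \<open>|u\<^sub>I| \<le> \<eta> \<delta>\<^bsup>|I|\<^esup>\<close>. Hence the lift through \<open>E\<close> of a curve with controls
  \<open>|a\<^sub>I| \<le> \<kappa> \<delta>\<^bsup>|I|\<^esup>\<close> moves so slowly in the scaled norm that it cannot leave the box of radius \<open>\<delta>\<close>.
  Only difference quotients of \<open>E\<close> are used, so differentiable dependence of the flow on \<open>u\<close> is
  never needed.
\<close>

subsection \<open>Smooth maps and the action of vector fields\<close>

text \<open>Without the filtration, scaling would turn a structure coefficient from weights
  \<open>i\<close>, \<open>j\<close> into weight \<open>l\<close> into a factor \<delta>^(i+j-l)
  with a possibly negative exponent. Two choices keep such factors away. Coordinates of the
  difference of two flows are taken in the frame that moves along the flow of \<open>u\<close>, so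
  that the Jacobians of the fields enter the first-order part only antisymmetrised, as brackets, and
  brackets have \<open>l \<le> i + j\<close>. The remaining quadratic error does have a constant
  that grows as \<delta> shrinks; it is harmless because it is used at fixed \<delta> and only for
  \<open>v\<close> tending to \<open>u\<close>. Controls come without measurability, so they are
  never integrated: increments of a curve and of its lift are bounded through gauge-fine divisions
  and absolute continuity. The smallness thresholds are nested: \<epsilon> makes \<open>E\<close>
  invertible with uniform constants, \<eta> makes the scaled matrix small, \<kappa> makes the lift
  too slow to reach scaled norm \<eta> in unit time. Curves with controls of size \<kappa> times
  those of a box stay in that box, whence C = 1/\<kappa>.\<close>

abbreviation fderiv :: "('a::real_normed_vector \<Rightarrow> 'b::real_normed_vector) \<Rightarrow> 'a \<Rightarrow> 'a \<Rightarrow> 'b" where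
  "fderiv f x \<equiv> frechet_derivative f (at x)"

lemma has_derivative_cong_open:
  assumes "open S" "x \<in> S" "\<And>y. y \<in> S \<Longrightarrow> f y = g y"
  shows "(f has_derivative f') (at x) \<longleftrightarrow> (g has_derivative f') (at x)"
  using has_derivative_transform_within_open[OF _ assms(1,2), of f f' UNIV g]
    has_derivative_transform_within_open[OF _ assms(1,2), of g f' UNIV f] assms(3) by auto

lemma frechet_derivative_cong_open:
  assumes "open S" "x \<in> S" "\<And>y. y \<in> S \<Longrightarrow> f y = g y"
  shows "fderiv f x = fderiv g x"
proof -
  have "(f has_derivative f') (at x) \<longleftrightarrow> (g has_derivative f') (at x)" for f'
    by (rule has_derivative_cong_open[OF assms(1,2)]) (rule assms(3))
  then show ?thesis unfolding frechet_derivative_def by simp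
qed

lemma differentiable_cong_open:
  assumes "open S" "x \<in> S" "\<And>y. y \<in> S \<Longrightarrow> f y = g y"
  shows "f differentiable (at x) \<longleftrightarrow> g differentiable (at x)"
proof -
  have "(f has_derivative f') (at x) \<longleftrightarrow> (g has_derivative f') (at x)" for f'
    by (rule has_derivative_cong_open[OF assms(1,2)]) (rule assms(3))
  then show ?thesis unfolding differentiable_def by simp
qed

text \<open>Derivatives at points of an open set depend only on values there, so formulas for
  derivatives that hold on \<open>S\<close> may be rewritten inside inductions on the order.\<close>

lemma Ck_on_cong:
  assumes "open S" "\<And>y. y \<in> S \<Longrightarrow> f y = g y"
  shows "Ck_on k f S \<longleftrightarrow> Ck_on k g S"
  using assms(2)
proof (induction k arbitrary: f g)
  case 0
  then show ?case using continuous_on_cong[of S S f g] by simp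
next
  case (Suc k)
  have "Ck_on k (\<lambda>x. fderiv f x v) S \<longleftrightarrow> Ck_on k (\<lambda>x. fderiv g x v) S" for v
    using frechet_derivative_cong_open[OF \<open>open S\<close> _ Suc.prems] by (intro Suc.IH) simp
  moreover have "(\<forall>x\<in>S. f differentiable (at x)) \<longleftrightarrow> (\<forall>x\<in>S. g differentiable (at x))"
    using differentiable_cong_open[OF \<open>open S\<close>, of _ f g] Suc.prems by blast
  ultimately show ?case by simp
qed

lemma Ck_on_Suc_imp: "Ck_on (Suc k) f S \<Longrightarrow> Ck_on k f S"
proof (induction k arbitrary: f)
  case 0
  then show ?case by (simp add: continuous_at_imp_continuous_on differentiable_imp_continuous_within)
next
  case (Suc k)
  have "f differentiable (at x)" if "x \<in> S" for x using Suc.prems that by simp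
  moreover have "Ck_on k (\<lambda>x. fderiv f x v) S" for v
    using Suc.prems by (intro Suc.IH) simp
  ultimately show ?case by simp
qed

lemma Ck_on_const: "Ck_on k (\<lambda>x. c) S"
  by (induction k arbitrary: c) auto

lemma Ck_on_bounded_linear:
  assumes "bounded_linear h"
  shows "Ck_on k h S"
proof (cases k)
  case 0
  then show ?thesis using assms by (simp add: linear_continuous_on)
next
  case (Suc m)
  have "(h has_derivative h) (at x)" for x by (rule bounded_linear_imp_has_derivative[OF assms])
  then have "h differentiable (at x)" "fderiv h x = h" for x
    by (auto simp: differentiable_def frechet_derivative_at[symmetric])
  then show ?thesis using Suc by (auto intro: Ck_on_const)
qed

lemma Ck_on_add:
  assumes "open S" "Ck_on k f S" "Ck_on k g S"
  shows "Ck_on k (\<lambda>x. f x + g x) S"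
  using assms(2,3)
proof (induction k arbitrary: f g)
  case 0
  then show ?case by (simp add: continuous_on_add)
next
  case (Suc k)
  have d: "f differentiable (at x)" "g differentiable (at x)" if "x \<in> S" for x
    using Suc.prems that by auto
  have D: "fderiv (\<lambda>x. f x + g x) x v = fderiv f x v + fderiv g x v"
    if "x \<in> S" for x v
  proof -
    have "((\<lambda>x. f x + g x) has_derivative (\<lambda>v. fderiv f x v + fderiv g x v)) (at x)"
      using d[OF that] frechet_derivative_works by (intro has_derivative_add) blast+
    from frechet_derivative_at[OF this] show ?thesis by metis
  qed
  have "Ck_on k (\<lambda>x. fderiv (\<lambda>x. f x + g x) x v) S" for v
  proof -
    have "Ck_on k (\<lambda>x. fderiv f x v + fderiv g x v) S"
      using Suc.prems by (intro Suc.IH) auto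
    then show ?thesis by (rule iffD2[OF Ck_on_cong[OF \<open>open S\<close>], rotated]) (rule D)
  qed
  then show ?case using d by (auto intro: differentiable_add)
qed

text \<open>The product rule leaves one factor undifferentiated, so the induction also uses that
  factor at the lower order. Scalar multiples and inner products are the instances used.\<close>

lemma Ck_on_bilinear:
  assumes "bounded_bilinear bil" "open S" "Ck_on k f S" "Ck_on k g S"
  shows "Ck_on k (\<lambda>x. bil (f x) (g x)) S"
  using assms(3,4)
proof (induction k arbitrary: f g)
  case 0
  then show ?case using bounded_bilinear.continuous_on[OF assms(1)] by simp
next
  case (Suc k)
  have d: "f differentiable (at x)" "g differentiable (at x)" if "x \<in> S" for x
    using Suc.prems that by auto
  have D: "((\<lambda>x. bil (f x) (g x)) has_derivative
      (\<lambda>v. bil (f x) (fderiv g x v) + bil (fderiv f x v) (g x))) (at x)"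
    if "x \<in> S" for x
    by (intro bounded_bilinear.FDERIV[OF assms(1)] d[OF that, THEN frechet_derivative_works[THEN iffD1]])
  then have D': "fderiv (\<lambda>x. bil (f x) (g x)) x v =
      bil (f x) (fderiv g x v) + bil (fderiv f x v) (g x)" if "x \<in> S" for x v
    using frechet_derivative_at[OF D[OF that]] by metis
  have "Ck_on k (\<lambda>x. fderiv (\<lambda>x. bil (f x) (g x)) x v) S" for v
  proof -
    have "Ck_on k f S" "Ck_on k g S" using Suc.prems Ck_on_Suc_imp by blast+
    then have "Ck_on k (\<lambda>x. bil (f x) (fderiv g x v) + bil (fderiv f x v) (g x)) S"
      using Suc.prems by (intro Ck_on_add[OF assms(2)] Suc.IH) auto
    then show ?thesis by (rule iffD2[OF Ck_on_cong[OF \<open>open S\<close>], rotated]) (rule D')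
  qed
  moreover have "(\<lambda>x. bil (f x) (g x)) differentiable (at x)" if "x \<in> S" for x
    using D[OF that] by (auto simp: differentiable_def)
  ultimately show ?case by auto
qed

lemma Ck_on_sum:
  assumes "open S" "finite A" "\<And>i. i \<in> A \<Longrightarrow> Ck_on k (f i) S"
  shows "Ck_on k (\<lambda>x. \<Sum>i\<in>A. f i x) S"
  using assms(2,3)
proof (induction A rule: finite_induct)
  case empty
  then show ?case using Ck_on_const[of k 0] by simp
next
  case (insert a A)
  then show ?case using Ck_on_add[OF assms(1), of k "f a"] by simp
qed

lemma smooth_on_differentiable: "smooth_on f S \<Longrightarrow> x \<in> S \<Longrightarrow> f differentiable (at x)"
  using Ck_on.simps(2)[of 0 f S] by (simp add: smooth_on_def del: Ck_on.simps)

lemma smooth_on_derivative: "smooth_on f S \<Longrightarrow> smooth_on (\<lambda>x. fderiv f x v) S"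
  unfolding smooth_on_def using Ck_on.simps(2) by blast

lemma smooth_on_has_derivative:
  "smooth_on f S \<Longrightarrow> x \<in> S \<Longrightarrow> (f has_derivative fderiv f x) (at x)"
  using smooth_on_differentiable frechet_derivative_works by blast

lemma smooth_on_linear_derivative: "smooth_on f S \<Longrightarrow> x \<in> S \<Longrightarrow> linear (fderiv f x)"
  using smooth_on_has_derivative has_derivative_linear by blast

text \<open>The derivation attached to \<open>Z\<close>. Values in an arbitrary normed space let it
  act on vector-valued maps, in particular on the identity.\<close>

definition act :: "('a::real_normed_vector \<Rightarrow> 'a) \<Rightarrow> ('a \<Rightarrow> 'b::real_normed_vector) \<Rightarrow> 'a \<Rightarrow> 'b" where
  "act Z f = (\<lambda>x. fderiv f x (Z x))"

lemma act_cong: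
  assumes "open S" "x \<in> S" "\<And>y. y \<in> S \<Longrightarrow> f y = g y"
  shows "act Z f x = act Z g x"
  unfolding act_def using frechet_derivative_cong_open[OF assms] by simp

text \<open>\<open>Ck_on\<close> speaks of derivatives in fixed directions only. This reduces a
  direction that varies with the point to finitely many fixed ones.\<close>

lemma derivative_basis_expansion:
  fixes f :: "'a::euclidean_space \<Rightarrow> 'b::real_normed_vector"
  assumes "smooth_on f S" "x \<in> S"
  shows "fderiv f x v = (\<Sum>b\<in>Basis. (v \<bullet> b) *\<^sub>R fderiv f x b)"
proof -
  note lin = smooth_on_linear_derivative[OF assms]
  have "fderiv f x v = fderiv f x (\<Sum>b\<in>Basis. (v \<bullet> b) *\<^sub>R b)"
    by (simp only: euclidean_representation)
  then show ?thesis by (simp only: linear_sum[OF lin] linear_cmul[OF lin])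
qed

lemma smooth_on_act:
  fixes f :: "'a::euclidean_space \<Rightarrow> 'b::real_normed_vector"
  assumes "open S" "smooth_on f S" "smooth_on Z S"
  shows "smooth_on (act Z f) S"
  unfolding smooth_on_def
proof
  fix k
  have "Ck_on k (\<lambda>x. \<Sum>b\<in>Basis. (Z x \<bullet> b) *\<^sub>R fderiv f x b) S"
  proof (intro Ck_on_sum Ck_on_bilinear[OF bounded_bilinear_scaleR] Ck_on_bilinear[OF bounded_bilinear_inner] Ck_on_const assms(1))
    show "Ck_on k Z S" using assms(3) by (simp add: smooth_on_def)
    show "Ck_on k (\<lambda>x. fderiv f x b) S" for b
      using smooth_on_derivative[OF assms(2)] by (simp add: smooth_on_def)
  qed auto
  then show "Ck_on k (act Z f) S"
    unfolding act_def by (rule iffD2[OF Ck_on_cong[OF assms(1)], rotated]) (rule derivative_basis_expansion[OF assms(2)])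
qed

lemma smooth_on_id: "smooth_on (\<lambda>x. x) S"
  unfolding smooth_on_def using Ck_on_bounded_linear[OF bounded_linear_ident] by blast

lemma smooth_on_sum_scaleR:
  assumes "open S" "finite A" "\<And>i. i \<in> A \<Longrightarrow> smooth_on (f i) S"
  shows "smooth_on (\<lambda>x. \<Sum>i\<in>A. c i *\<^sub>R f i x) S"
  unfolding smooth_on_def
  using assms by (intro allI Ck_on_sum Ck_on_bilinear[OF bounded_bilinear_scaleR] Ck_on_const) (auto simp: smooth_on_def)

lemma smooth_on_diff:
  assumes "open S" "smooth_on f S" "smooth_on g S"
  shows "smooth_on (\<lambda>x. f x - g x) S"
proof -
  have "Ck_on k (\<lambda>x. f x + (- 1) *\<^sub>R g x) S" for k
    using assms by (intro Ck_on_add Ck_on_bilinear[OF bounded_bilinear_scaleR] Ck_on_const) (auto simp: smooth_on_def)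
  then show ?thesis by (simp add: smooth_on_def)
qed

lemma smooth_on_lie_bracket:
  fixes X Y :: "'a::euclidean_space \<Rightarrow> 'a"
  assumes "open S" "smooth_on X S" "smooth_on Y S"
  shows "smooth_on (lie_bracket X Y) S"
proof -
  have "lie_bracket X Y = (\<lambda>x. act X Y x - act Y X x)" by (simp add: fun_eq_iff lie_bracket_def act_def)
  then show ?thesis using smooth_on_diff smooth_on_act assms by metis
qed

text \<open>The second difference quotient of \<open>f\<close> is, by the mean value theorem, a value of either mixed
  second derivative near \<open>x\<close>.\<close>

lemma second_difference_mvt:
  fixes f :: "'a::real_normed_vector \<Rightarrow> real"
  assumes "open S" and f: "smooth_on f S" and s: "s > 0"
    and in_S: "\<And>\<sigma> \<tau>. 0 \<le> \<sigma> \<Longrightarrow> \<sigma> \<le> s \<Longrightarrow> 0 \<le> \<tau> \<Longrightarrow> \<tau> \<le> s \<Longrightarrow> x + \<sigma> *\<^sub>R v + \<tau> *\<^sub>R w \<in> S"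
  shows "\<exists>\<sigma> \<tau>. 0 \<le> \<sigma> \<and> \<sigma> \<le> s \<and> 0 \<le> \<tau> \<and> \<tau> \<le> s \<and>
    f (x + s *\<^sub>R v + s *\<^sub>R w) - f (x + s *\<^sub>R v) - f (x + s *\<^sub>R w) + f x =
    s * s * fderiv (\<lambda>y. fderiv f y v) (x + \<sigma> *\<^sub>R v + \<tau> *\<^sub>R w) w"
proof -
  have line: "((\<lambda>\<sigma>. g (c + \<sigma> *\<^sub>R d)) has_real_derivative fderiv g (c + \<sigma> *\<^sub>R d) d) (at \<sigma>)"
    if g: "smooth_on g S" and "c + \<sigma> *\<^sub>R d \<in> S" for g :: "'a \<Rightarrow> real" and c d \<sigma>
  proof -
    note D = smooth_on_has_derivative[OF that]
    have "((\<lambda>\<sigma>. c + \<sigma> *\<^sub>R d) has_derivative (\<lambda>h. h *\<^sub>R d)) (at \<sigma>)"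
      by (auto intro!: derivative_eq_intros)
    from diff_chain_at[OF this D]
    have "((\<lambda>\<sigma>. g (c + \<sigma> *\<^sub>R d)) has_derivative (\<lambda>h. fderiv g (c + \<sigma> *\<^sub>R d) (h *\<^sub>R d))) (at \<sigma>)"
      by (simp add: o_def)
    then show ?thesis
      using linear_cmul[OF smooth_on_linear_derivative[OF that]]
      by (simp add: has_field_derivative_def mult.commute[of _ "fderiv g (c + \<sigma> *\<^sub>R d) d"])
  qed
  define \<phi> where "\<phi> = (\<lambda>\<sigma>. f ((x + s *\<^sub>R w) + \<sigma> *\<^sub>R v) - f (x + \<sigma> *\<^sub>R v))"
  have "(\<phi> has_real_derivative fderiv f ((x + s *\<^sub>R w) + \<sigma> *\<^sub>R v) v - fderiv f (x + \<sigma> *\<^sub>R v) v) (at \<sigma>)"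
    if "0 \<le> \<sigma>" "\<sigma> \<le> s" for \<sigma>
    unfolding \<phi>_def using in_S[OF that, of s] in_S[OF that, of 0] s
    by (intro DERIV_diff line f) (simp_all add: add_ac)
  from MVT2[OF s this] obtain \<sigma> where \<sigma>: "0 < \<sigma>" "\<sigma> < s"
    "\<phi> s - \<phi> 0 = s * (fderiv f ((x + s *\<^sub>R w) + \<sigma> *\<^sub>R v) v - fderiv f (x + \<sigma> *\<^sub>R v) v)"
    by auto
  have "((\<lambda>\<tau>. fderiv f ((x + \<sigma> *\<^sub>R v) + \<tau> *\<^sub>R w) v) has_real_derivative
      fderiv (\<lambda>y. fderiv f y v) ((x + \<sigma> *\<^sub>R v) + \<tau> *\<^sub>R w) w) (at \<tau>)"
    if "0 \<le> \<tau>" "\<tau> \<le> s" for \<tau>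
    using in_S[of \<sigma> \<tau>] that \<sigma> by (intro line[of "\<lambda>y. fderiv f y v"] smooth_on_derivative f) simp
  from MVT2[OF s this] obtain \<tau> where \<tau>: "0 < \<tau>" "\<tau> < s"
    "fderiv f ((x + \<sigma> *\<^sub>R v) + s *\<^sub>R w) v - fderiv f (x + \<sigma> *\<^sub>R v) v =
      s * fderiv (\<lambda>y. fderiv f y v) ((x + \<sigma> *\<^sub>R v) + \<tau> *\<^sub>R w) w"
    by auto
  have eq: "(x + s *\<^sub>R w) + \<sigma> *\<^sub>R v = (x + \<sigma> *\<^sub>R v) + s *\<^sub>R w" by (simp add: add_ac)
  have "f (x + s *\<^sub>R v + s *\<^sub>R w) - f (x + s *\<^sub>R v) - f (x + s *\<^sub>R w) + f x = \<phi> s - \<phi> 0"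
    by (simp add: \<phi>_def add_ac)
  also have "\<dots> = s * s * fderiv (\<lambda>y. fderiv f y v) ((x + \<sigma> *\<^sub>R v) + \<tau> *\<^sub>R w) w"
    unfolding \<sigma>(3) eq \<tau>(3) by simp
  finally show ?thesis using \<sigma> \<tau> by (intro exI[of _ \<sigma>] exI[of _ \<tau>]) auto
qed

text \<open>The second difference over a parallelogram is symmetric in its two sides. It equals
  either mixed derivative at some nearby point, and continuity of both at \<open>x\<close> closes
  the gap as the parallelogram shrinks.\<close>

lemma second_derivative_symmetric_real:
  fixes f :: "'a::real_normed_vector \<Rightarrow> real"
  assumes S: "open S" "x \<in> S" and f: "smooth_on f S"
  shows "fderiv (\<lambda>y. fderiv f y v) x w =
    fderiv (\<lambda>y. fderiv f y w) x v"
proof -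
  define H where "H = (\<lambda>v w y. fderiv (\<lambda>y. fderiv f y v) y w)"
  have cont: "isCont (H v w) x" for v w
  proof -
    have "continuous_on S (H v w)"
      using smooth_on_derivative[OF smooth_on_derivative[OF f], of v w] Ck_on.simps(1) unfolding H_def smooth_on_def by blast
    then show ?thesis using S continuous_on_eq_continuous_at by blast
  qed
  have "\<bar>H v w x - H w v x\<bar> \<le> 0"
  proof (rule field_le_epsilon)
    fix e :: real assume "e > 0"
    then have e2: "e / 2 > 0" by simp
    obtain d0 where d0: "d0 > 0" "ball x d0 \<subseteq> S" using S openE by blast
    obtain d1 where d1: "d1 > 0" "\<And>y. norm (y - x) < d1 \<Longrightarrow> \<bar>H v w y - H v w x\<bar> < e / 2"
      using cont[of v w] e2 unfolding continuous_at_eps_delta dist_norm real_norm_def by blast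
    obtain d2 where d2: "d2 > 0" "\<And>y. norm (y - x) < d2 \<Longrightarrow> \<bar>H w v y - H w v x\<bar> < e / 2"
      using cont[of w v] e2 unfolding continuous_at_eps_delta dist_norm real_norm_def by blast
    define d where "d = min d0 (min d1 d2)"
    define m where "m = norm v + norm w + 1"
    have "m > 0" by (simp add: m_def add_nonneg_pos)
    have "d > 0" using d0 d1 d2 by (simp add: d_def)
    \<comment> \<open>Small enough for the whole parallelogram with sides along \<open>v\<close> and
      \<open>w\<close> to lie within distance \<open>d\<close> of \<open>x\<close>.\<close>
    define s where "s = d / (2 * m)"
    have "s > 0" using \<open>d > 0\<close> \<open>m > 0\<close> by (simp add: s_def)
    have near: "norm (x + \<sigma> *\<^sub>R a + \<tau> *\<^sub>R b - x) < d"
      if "0 \<le> \<sigma>" "\<sigma> \<le> s" "0 \<le> \<tau>" "\<tau> \<le> s" "norm a + norm b + 1 = m" for \<sigma> \<tau> a b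
    proof -
      have "norm (x + \<sigma> *\<^sub>R a + \<tau> *\<^sub>R b - x) \<le> \<sigma> * norm a + \<tau> * norm b"
        using norm_triangle_ineq[of "\<sigma> *\<^sub>R a" "\<tau> *\<^sub>R b"] that by (simp add: add.assoc)
      also have "\<dots> \<le> s * norm a + s * norm b" using that by (intro add_mono mult_right_mono) auto
      also have "\<dots> \<le> s * m" using that(5) \<open>s > 0\<close> by (simp add: distrib_left[symmetric])
      also have "\<dots> < d" using \<open>d > 0\<close> \<open>m > 0\<close> by (simp add: s_def)
      finally show ?thesis .
    qed
    have inS: "x + \<sigma> *\<^sub>R a + \<tau> *\<^sub>R b \<in> S"
      if "0 \<le> \<sigma>" "\<sigma> \<le> s" "0 \<le> \<tau>" "\<tau> \<le> s" "norm a + norm b + 1 = m" for \<sigma> \<tau> a b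
    proof (rule subsetD[OF d0(2)])
      have "dist (x + \<sigma> *\<^sub>R a + \<tau> *\<^sub>R b) x < d0" using near[OF that] unfolding dist_norm d_def by linarith
      then show "x + \<sigma> *\<^sub>R a + \<tau> *\<^sub>R b \<in> ball x d0" by (simp only: mem_ball dist_commute)
    qed
    obtain \<sigma> \<tau> where 1: "0 \<le> \<sigma>" "\<sigma> \<le> s" "0 \<le> \<tau>" "\<tau> \<le> s"
      "f (x + s *\<^sub>R v + s *\<^sub>R w) - f (x + s *\<^sub>R v) - f (x + s *\<^sub>R w) + f x = s * s * H v w (x + \<sigma> *\<^sub>R v + \<tau> *\<^sub>R w)"
      using second_difference_mvt[OF S(1) f \<open>s > 0\<close> inS, of v w] by (auto simp: H_def m_def)
    obtain \<sigma>' \<tau>' where 2: "0 \<le> \<sigma>'" "\<sigma>' \<le> s" "0 \<le> \<tau>'" "\<tau>' \<le> s"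
      "f (x + s *\<^sub>R w + s *\<^sub>R v) - f (x + s *\<^sub>R w) - f (x + s *\<^sub>R v) + f x = s * s * H w v (x + \<sigma>' *\<^sub>R w + \<tau>' *\<^sub>R v)"
      using second_difference_mvt[OF S(1) f \<open>s > 0\<close> inS, of w v] by (auto simp: H_def m_def)
    have eq: "x + s *\<^sub>R w + s *\<^sub>R v = x + s *\<^sub>R v + s *\<^sub>R w" by (simp add: add_ac)
    have "s * s * H v w (x + \<sigma> *\<^sub>R v + \<tau> *\<^sub>R w) = s * s * H w v (x + \<sigma>' *\<^sub>R w + \<tau>' *\<^sub>R v)"
      using 1(5) 2(5)[unfolded eq] by linarith
    then have "H v w (x + \<sigma> *\<^sub>R v + \<tau> *\<^sub>R w) = H w v (x + \<sigma>' *\<^sub>R w + \<tau>' *\<^sub>R v)"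
      using \<open>s > 0\<close> by simp
    moreover have "\<bar>H v w (x + \<sigma> *\<^sub>R v + \<tau> *\<^sub>R w) - H v w x\<bar> < e / 2"
      using near[OF 1(1-4), of v w] by (intro d1) (simp add: d_def m_def)
    moreover have "\<bar>H w v (x + \<sigma>' *\<^sub>R w + \<tau>' *\<^sub>R v) - H w v x\<bar> < e / 2"
      using near[OF 2(1-4), of w v] by (intro d2) (simp add: d_def m_def)
    ultimately show "\<bar>H v w x - H w v x\<bar> \<le> 0 + e" by linarith
  qed
  then show ?thesis by (simp add: H_def)
qed

lemma second_derivative_symmetric:
  fixes f :: "'a::real_normed_vector \<Rightarrow> 'b::euclidean_space"
  assumes S: "open S" "x \<in> S" and f: "smooth_on f S"
  shows "fderiv (\<lambda>y. fderiv f y v) x w =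
    fderiv (\<lambda>y. fderiv f y w) x v"
proof (rule euclidean_eqI)
  fix b :: 'b assume "b \<in> Basis"
  define g where "g = (\<lambda>y. f y \<bullet> b)"
  have g: "smooth_on g S"
    using f unfolding g_def smooth_on_def by (auto intro!: Ck_on_bilinear[OF bounded_bilinear_inner] Ck_on_const S)
  have D: "fderiv (\<lambda>y. h y \<bullet> b) y v = fderiv h y v \<bullet> b"
    if "smooth_on h S" "y \<in> S" for h :: "'a \<Rightarrow> 'b" and y v
  proof -
    have "((\<lambda>y. h y \<bullet> b) has_derivative (\<lambda>v. fderiv h y v \<bullet> b)) (at y)"
      using smooth_on_has_derivative[OF that] by (intro has_derivative_inner_left)
    from frechet_derivative_at[OF this] show ?thesis by metis
  qed
  have "fderiv (\<lambda>y. fderiv g y v) x w =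
      fderiv (\<lambda>y. fderiv f y v) x w \<bullet> b" for v w
  proof -
    have "fderiv (\<lambda>y. fderiv g y v) x =
        fderiv (\<lambda>y. fderiv f y v \<bullet> b) x"
      using D[OF f] by (intro frechet_derivative_cong_open[OF S]) (simp add: g_def)
    then show ?thesis using D[OF smooth_on_derivative[OF f] S(2)] by simp
  qed
  then show "fderiv (\<lambda>y. fderiv f y v) x w \<bullet> b =
      fderiv (\<lambda>y. fderiv f y w) x v \<bullet> b"
    using second_derivative_symmetric_real[OF S g] by metis
qed

text \<open>Applying two fields in succession yields a Hessian term and a first-order term. The
  Hessian terms of the two orders cancel by symmetry; the first-order terms assemble into the
  bracket.\<close>

lemma act_lie_bracket:
  fixes f :: "'a::euclidean_space \<Rightarrow> 'b::euclidean_space"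
  assumes S: "open S" "x \<in> S" and f: "smooth_on f S" and X: "smooth_on X S" and Y: "smooth_on Y S"
  shows "act (lie_bracket X Y) f x = act X (act Y f) x - act Y (act X f) x"
proof -
  define H where "H = (\<lambda>v w. fderiv (\<lambda>y. fderiv f y v) x w)"
  have sym: "H v w = H w v" for v w unfolding H_def by (rule second_derivative_symmetric[OF S f])
  have linf: "linear (fderiv f x)" by (rule smooth_on_linear_derivative[OF f S(2)])
  have H_exp: "H b v = (\<Sum>c\<in>Basis. (v \<bullet> c) *\<^sub>R H b c)" for b v
    unfolding H_def by (rule derivative_basis_expansion[OF smooth_on_derivative[OF f] S(2)])
  \<comment> \<open>The Hessian is expanded in a basis in both slots, so that the product rule is
    needed only for derivatives in fixed directions.\<close>
  have key: "act U (act V f) x = fderiv f x (fderiv V x (U x)) +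
      (\<Sum>b\<in>Basis. \<Sum>c\<in>Basis. (V x \<bullet> b) *\<^sub>R (U x \<bullet> c) *\<^sub>R H b c)" if V: "smooth_on V S" for U V
  proof -
    have D: "((\<lambda>y. \<Sum>b\<in>Basis. (V y \<bullet> b) *\<^sub>R fderiv f y b) has_derivative
        (\<lambda>h. \<Sum>b\<in>Basis. (V x \<bullet> b) *\<^sub>R H b h + (fderiv V x h \<bullet> b) *\<^sub>R fderiv f x b)) (at x)"
      unfolding H_def
      using smooth_on_has_derivative[OF V S(2)] smooth_on_has_derivative[OF smooth_on_derivative[OF f] S(2)]
      by (intro has_derivative_sum has_derivative_scaleR has_derivative_inner_left)
    have "fderiv (act V f) x = fderiv (\<lambda>y. \<Sum>b\<in>Basis. (V y \<bullet> b) *\<^sub>R fderiv f y b) x"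
      using derivative_basis_expansion[OF f] by (intro frechet_derivative_cong_open[OF S]) (simp add: act_def)
    also have "\<dots> = (\<lambda>h. \<Sum>b\<in>Basis. (V x \<bullet> b) *\<^sub>R H b h + (fderiv V x h \<bullet> b) *\<^sub>R fderiv f x b)"
      by (rule frechet_derivative_at[OF D, symmetric])
    finally have "act U (act V f) x = (\<Sum>b\<in>Basis. (V x \<bullet> b) *\<^sub>R H b (U x)) +
        (\<Sum>b\<in>Basis. (fderiv V x (U x) \<bullet> b) *\<^sub>R fderiv f x b)"
      by (simp add: act_def sum.distrib)
    also have "(\<Sum>b\<in>Basis. (fderiv V x (U x) \<bullet> b) *\<^sub>R fderiv f x b) =
        fderiv f x (fderiv V x (U x))"
      by (rule derivative_basis_expansion[OF f S(2), symmetric])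
    also have "(\<Sum>b\<in>Basis. (V x \<bullet> b) *\<^sub>R H b (U x)) = (\<Sum>b\<in>Basis. \<Sum>c\<in>Basis. (V x \<bullet> b) *\<^sub>R (U x \<bullet> c) *\<^sub>R H b c)"
      by (subst H_exp) (simp only: scaleR_sum_right)
    finally show ?thesis by (simp only: add.commute)
  qed
  have "(\<Sum>b\<in>Basis. \<Sum>c\<in>Basis. (Y x \<bullet> b) *\<^sub>R (X x \<bullet> c) *\<^sub>R H b c) = (\<Sum>c\<in>Basis. \<Sum>b\<in>Basis. (Y x \<bullet> b) *\<^sub>R (X x \<bullet> c) *\<^sub>R H b c)"
    by (rule sum.swap)
  also have "\<dots> = (\<Sum>c\<in>Basis. \<Sum>b\<in>Basis. (X x \<bullet> c) *\<^sub>R (Y x \<bullet> b) *\<^sub>R H c b)"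
    by (intro sum.cong refl) (simp add: sym mult.commute)
  finally have "(\<Sum>b\<in>Basis. \<Sum>c\<in>Basis. (Y x \<bullet> b) *\<^sub>R (X x \<bullet> c) *\<^sub>R H b c) = (\<Sum>c\<in>Basis. \<Sum>b\<in>Basis. (X x \<bullet> c) *\<^sub>R (Y x \<bullet> b) *\<^sub>R H c b)" .
  then show ?thesis
    unfolding key[OF X] key[OF Y] by (simp add: act_def lie_bracket_def linear_diff[OF linf])
qed

subsection \<open>The free algebra and the filtration of commutators\<close>

lemma poly_mapping_eq_sum_single:
  "P = (\<Sum>J\<in>Poly_Mapping.keys P. Poly_Mapping.single J (Poly_Mapping.lookup P J))"
proof (rule poly_mapping_eqI)
  fix k
  have "(\<Sum>J\<in>Poly_Mapping.keys P. Poly_Mapping.lookup P J when J = k) = Poly_Mapping.lookup P k"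
    by (simp add: when_def in_keys_iff)
  then show "Poly_Mapping.lookup P k =
      Poly_Mapping.lookup (\<Sum>J\<in>Poly_Mapping.keys P. Poly_Mapping.single J (Poly_Mapping.lookup P J)) k"
    by (simp add: lookup_sum lookup_single)
qed

lemma weight_append: "weight (I @ J) = weight I + weight J"
  by (simp add: weight_def)

lemma weight_Cons: "weight (i # J) = field_weight i + weight J"
  by (simp add: weight_def)

lemma nested_bracket_Cons: "J \<noteq> [] \<Longrightarrow> nested_bracket br g (i # J) = br (g i) (nested_bracket br g J)"
  by (cases J) auto

lemma comm_xi_Cons: "J \<noteq> [] \<Longrightarrow> comm_xi (i # J) = xi i * comm_xi J - comm_xi J * xi i"
  by (simp add: comm_xi_def nested_bracket_Cons)

lemma comm_xi_single: "comm_xi [i] = xi i"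
  by (simp add: comm_xi_def)

lemma comm_field_Cons: "J \<noteq> [] \<Longrightarrow> comm_field X (i # J) = lie_bracket (X i) (comm_field X J)"
  by (simp add: comm_field_def nested_bracket_Cons)

lemma comm_field_single: "comm_field X [i] = X i"
  by (simp add: comm_field_def)

text \<open>Both products of a commutator concatenate the same letters and weight is additive. This
  homogeneity is what later allows a linear relation to be cut down to a single weight.\<close>

lemma keys_comm_xi:
  "I \<noteq> [] \<Longrightarrow> Poly_Mapping.keys (comm_xi I) \<subseteq> {J. set J \<subseteq> set I \<and> weight J = weight I}"
proof (induction I)
  case (Cons i I)
  show ?case
  proof (cases "I = []")
    case True
    then show ?thesis by (simp add: comm_xi_single xi_def)
  next
    case False
    have xi: "Poly_Mapping.keys (xi i) = {[i]}" by (simp add: xi_def)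
    have "Poly_Mapping.keys (comm_xi (i # I)) \<subseteq>
        Poly_Mapping.keys (xi i * comm_xi I) \<union> Poly_Mapping.keys (comm_xi I * xi i)"
      unfolding comm_xi_Cons[OF False] by (rule keys_diff)
    also have "\<dots> \<subseteq> {a + b | a b. a \<in> {[i]} \<and> b \<in> Poly_Mapping.keys (comm_xi I)} \<union>
        {a + b | a b. a \<in> Poly_Mapping.keys (comm_xi I) \<and> b \<in> {[i]}}"
      using keys_mult[of "xi i" "comm_xi I"] keys_mult[of "comm_xi I" "xi i"] unfolding xi by (rule Un_mono)
    also have "\<dots> \<subseteq> {J. set J \<subseteq> set (i # I) \<and> weight J = weight (i # I)}"
      by (auto simp: plus_list_def weight_append weight_Cons weight_def dest!: subsetD[OF Cons.IH[OF False]])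
    finally show ?thesis .
  qed
qed simp

lemma comm_coeff_weight: "I \<noteq> [] \<Longrightarrow> comm_coeff I J \<noteq> 0 \<Longrightarrow> weight J = weight I"
  using keys_comm_xi[of I] by (auto simp: comm_coeff_def in_keys_iff)

text \<open>Closure under differences suffices, because the Jacobi identity produces only integer
  combinations. The index \<open>m\<close> records the common weight of the generators.\<close>

inductive_set lie_span :: "nat \<Rightarrow> nat \<Rightarrow> (nat list \<Rightarrow>\<^sub>0 real) set" for n m where
  comm: "K \<noteq> [] \<Longrightarrow> set K \<subseteq> {0..n} \<Longrightarrow> weight K = m \<Longrightarrow> comm_xi K \<in> lie_span n m"
| zero: "0 \<in> lie_span n m"
| diff: "P \<in> lie_span n m \<Longrightarrow> Q \<in> lie_span n m \<Longrightarrow> P - Q \<in> lie_span n m"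

lemma lie_span_xi:
  assumes "P \<in> lie_span n m" "i \<le> n"
  shows "xi i * P - P * xi i \<in> lie_span n (field_weight i + m)"
  using assms(1)
proof induction
  case (comm K)
  then have "comm_xi (i # K) \<in> lie_span n (field_weight i + m)"
    using assms(2) by (intro lie_span.comm) (auto simp: weight_Cons)
  then show ?case using comm by (simp add: comm_xi_Cons)
next
  case zero
  show ?case using lie_span.zero by simp
next
  case (diff P Q)
  have "xi i * (P - Q) - (P - Q) * xi i = (xi i * P - P * xi i) - (xi i * Q - Q * xi i)"
    by (simp add: algebra_simps)
  then show ?case using lie_span.diff[OF diff.IH] by simp
qed

text \<open>Jacobi identity \<open>[[\<xi>, c], P] = [\<xi>, [c, P]] - [c, [\<xi>, P]]\<close>,
  which moves all brackets to the right. \<open>P\<close> and \<open>m\<close> stay arbitrary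
  because the last term applies the induction hypothesis to \<open>[\<xi>, P]\<close>, whose weight
  is larger.\<close>

lemma lie_span_comm:
  assumes "I \<noteq> []" "set I \<subseteq> {0..n}" "P \<in> lie_span n m"
  shows "comm_xi I * P - P * comm_xi I \<in> lie_span n (weight I + m)"
  using assms
proof (induction I arbitrary: P m)
  case (Cons i I)
  show ?case
  proof (cases "I = []")
    case True
    then show ?thesis using lie_span_xi[OF Cons.prems(3), of i] Cons.prems(2)
      by (simp add: comm_xi_single weight_def)
  next
    case False
    let ?c = "comm_xi I"
    have i: "i \<le> n" and I: "set I \<subseteq> {0..n}" using Cons.prems by auto
    have 1: "xi i * (?c * P - P * ?c) - (?c * P - P * ?c) * xi i \<in> lie_span n (weight (i # I) + m)"
      using lie_span_xi[OF Cons.IH[OF False I Cons.prems(3)] i] by (simp add: weight_Cons add_ac)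
    have 2: "?c * (xi i * P - P * xi i) - (xi i * P - P * xi i) * ?c \<in> lie_span n (weight (i # I) + m)"
      using Cons.IH[OF False I lie_span_xi[OF Cons.prems(3) i]] by (simp add: weight_Cons add_ac)
    have "comm_xi (i # I) * P - P * comm_xi (i # I) =
        (xi i * (?c * P - P * ?c) - (?c * P - P * ?c) * xi i) - (?c * (xi i * P - P * xi i) - (xi i * P - P * xi i) * ?c)"
      unfolding comm_xi_Cons[OF False] by (simp add: algebra_simps)
    then show ?thesis using lie_span.diff[OF 1 2] by simp
  qed
qed simp

section \<open>Vector fields as differential operators: a representation of the free algebra\<close>

locale smooth_fields =
  fixes S :: "'a::euclidean_space set" and n :: nat and X :: "nat \<Rightarrow> 'a \<Rightarrow> 'a"
  assumes open_S: "open S" and smooth_X: "\<And>i. i \<le> n \<Longrightarrow> smooth_on (X i) S"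
begin

lemma smooth_comm_field: "I \<noteq> [] \<Longrightarrow> set I \<subseteq> {0..n} \<Longrightarrow> smooth_on (comm_field X I) S"
proof (induction I)
  case (Cons i I)
  then show ?case
    using smooth_X[of i] smooth_on_lie_bracket[OF open_S]
    by (cases "I = []") (auto simp: comm_field_single comm_field_Cons)
qed simp

text \<open>The first letter acts last, so that concatenation of words becomes composition of
  operators.\<close>

definition word_act :: "nat list \<Rightarrow> ('a \<Rightarrow> 'a) \<Rightarrow> 'a \<Rightarrow> 'a" where
  "word_act J f = foldr (\<lambda>i g. act (X i) g) J f"

lemma word_act_Cons: "word_act (i # J) f = act (X i) (word_act J f)"
  by (simp add: word_act_def)

lemma word_act_append: "word_act (I @ J) f = word_act I (word_act J f)"
  by (simp add: word_act_def)

lemma smooth_word_act: "set J \<subseteq> {0..n} \<Longrightarrow> smooth_on f S \<Longrightarrow> smooth_on (word_act J f) S"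
proof (induction J)
  case Nil
  then show ?case by (simp add: word_act_def)
next
  case (Cons i J)
  then show ?case unfolding word_act_Cons by (intro smooth_on_act open_S smooth_X) auto
qed

lemma act_sum:
  assumes "finite A" "\<And>i. i \<in> A \<Longrightarrow> smooth_on (f i) S" "x \<in> S"
  shows "act Z (\<lambda>y. \<Sum>i\<in>A. c i *\<^sub>R f i y) x = (\<Sum>i\<in>A. c i *\<^sub>R act Z (f i) x)"
proof -
  have "((\<lambda>y. \<Sum>i\<in>A. c i *\<^sub>R f i y) has_derivative (\<lambda>h. \<Sum>i\<in>A. c i *\<^sub>R fderiv (f i) x h)) (at x)"
    using assms by (intro has_derivative_sum has_derivative_scaleR_right smooth_on_has_derivative)
  from frechet_derivative_at[OF this, symmetric] show ?thesis by (simp add: act_def)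
qed

lemma word_act_sum:
  assumes "set J \<subseteq> {0..n}" "finite A" "\<And>i. i \<in> A \<Longrightarrow> smooth_on (f i) S" "x \<in> S"
  shows "word_act J (\<lambda>y. \<Sum>i\<in>A. c i *\<^sub>R f i y) x = (\<Sum>i\<in>A. c i *\<^sub>R word_act J (f i) x)"
  using assms(1,4)
proof (induction J arbitrary: x)
  case Nil
  then show ?case by (simp add: word_act_def)
next
  case (Cons i J)
  have "act (X i) (word_act J (\<lambda>y. \<Sum>i\<in>A. c i *\<^sub>R f i y)) x = act (X i) (\<lambda>y. \<Sum>k\<in>A. c k *\<^sub>R word_act J (f k) y) x"
    using Cons by (intro act_cong[OF open_S]) auto
  also have "\<dots> = (\<Sum>k\<in>A. c k *\<^sub>R act (X i) (word_act J (f k)) x)"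
    using Cons.prems assms by (intro act_sum smooth_word_act) auto
  finally show ?case by (simp add: word_act_Cons)
qed

text \<open>The action of the free algebra on smooth maps obtained by substituting \<open>X\<^sub>i\<close> for \<open>\<xi>\<^sub>i\<close>.\<close>

definition alg_act :: "(nat list \<Rightarrow>\<^sub>0 real) \<Rightarrow> ('a \<Rightarrow> 'a) \<Rightarrow> 'a \<Rightarrow> 'a" where
  "alg_act P f x = (\<Sum>J\<in>Poly_Mapping.keys P. Poly_Mapping.lookup P J *\<^sub>R word_act J f x)"

lemma alg_act_superset:
  assumes "finite A" "Poly_Mapping.keys P \<subseteq> A"
  shows "alg_act P f x = (\<Sum>J\<in>A. Poly_Mapping.lookup P J *\<^sub>R word_act J f x)"
  unfolding alg_act_def using assms by (intro sum.mono_neutral_left) (auto simp: in_keys_iff)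

lemma alg_act_zero: "alg_act 0 f x = 0"
  by (simp add: alg_act_def)

lemma alg_act_add: "alg_act (P + Q) f x = alg_act P f x + alg_act Q f x"
proof -
  let ?A = "Poly_Mapping.keys P \<union> Poly_Mapping.keys Q"
  show ?thesis
    using Poly_Mapping.keys_add[of P Q]
    by (subst (1 2 3) alg_act_superset[of ?A]) (auto simp: lookup_add scaleR_add_left sum.distrib)
qed

lemma alg_act_diff: "alg_act (P - Q) f x = alg_act P f x - alg_act Q f x"
  using alg_act_add[of "P - Q" Q f x] by simp

lemma alg_act_sum: "finite A \<Longrightarrow> alg_act (\<Sum>i\<in>A. P i) f x = (\<Sum>i\<in>A. alg_act (P i) f x)"
  by (induction A rule: finite_induct) (auto simp: alg_act_zero alg_act_add)

lemma alg_act_single: "alg_act (Poly_Mapping.single J c) f x = c *\<^sub>R word_act J f x"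
  by (simp add: alg_act_def)

text \<open>Multiplicativity of the substitution. Words are restricted to letters up to
  \<open>n\<close>, since only those fields are smooth and the sums must pass through their
  derivatives.\<close>

lemma alg_act_mult:
  assumes P: "Poly_Mapping.keys P \<subseteq> {J. set J \<subseteq> {0..n}}" and Q: "Poly_Mapping.keys Q \<subseteq> {J. set J \<subseteq> {0..n}}"
    and f: "smooth_on f S" and x: "x \<in> S"
  shows "alg_act (P * Q) f x = alg_act P (alg_act Q f) x"
proof -
  let ?p = "Poly_Mapping.lookup P" and ?q = "Poly_Mapping.lookup Q"
  let ?KP = "Poly_Mapping.keys P" and ?KQ = "Poly_Mapping.keys Q"
  have "P * Q = (\<Sum>I\<in>?KP. Poly_Mapping.single I (?p I)) * (\<Sum>J\<in>?KQ. Poly_Mapping.single J (?q J))"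
    by (simp only: poly_mapping_eq_sum_single[symmetric])
  also have "\<dots> = (\<Sum>I\<in>?KP. \<Sum>J\<in>?KQ. Poly_Mapping.single (I @ J) (?p I * ?q J))"
    by (simp add: sum_product mult_single plus_list_def)
  finally have "alg_act (P * Q) f x = (\<Sum>I\<in>?KP. \<Sum>J\<in>?KQ. (?p I * ?q J) *\<^sub>R word_act I (word_act J f) x)"
    by (simp add: alg_act_sum alg_act_single word_act_append)
  also have "\<dots> = (\<Sum>I\<in>?KP. ?p I *\<^sub>R word_act I (alg_act Q f) x)"
  proof (rule sum.cong[OF refl])
    fix I assume "I \<in> ?KP"
    then have I: "set I \<subseteq> {0..n}" using P by auto
    have "word_act I (alg_act Q f) x = (\<Sum>J\<in>?KQ. ?q J *\<^sub>R word_act I (word_act J f) x)"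
      unfolding alg_act_def[abs_def] using Q f x by (intro word_act_sum[OF I] smooth_word_act) auto
    then show "(\<Sum>J\<in>?KQ. (?p I * ?q J) *\<^sub>R word_act I (word_act J f) x) = ?p I *\<^sub>R word_act I (alg_act Q f) x"
      by (simp add: scaleR_sum_right)
  qed
  finally show ?thesis by (simp add: alg_act_def)
qed

lemma smooth_alg_act:
  "Poly_Mapping.keys P \<subseteq> {J. set J \<subseteq> {0..n}} \<Longrightarrow> smooth_on f S \<Longrightarrow> smooth_on (alg_act P f) S"
  unfolding alg_act_def[abs_def] by (intro smooth_on_sum_scaleR open_S smooth_word_act) auto

lemma keys_comm_xi_words: "I \<noteq> [] \<Longrightarrow> set I \<subseteq> {0..n} \<Longrightarrow> Poly_Mapping.keys (comm_xi I) \<subseteq> {J. set J \<subseteq> {0..n}}"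
  using keys_comm_xi[of I] by blast

text \<open>Substitution sends algebra commutators to operator commutators, which are the actions of
  the brackets by \<open>act_lie_bracket\<close>. \<open>f\<close> is arbitrary in the induction
  because the shorter commutator also acts on \<open>act (X i) f\<close>.\<close>

lemma act_comm_field:
  assumes "I \<noteq> []" "set I \<subseteq> {0..n}" "smooth_on f S" "x \<in> S"
  shows "act (comm_field X I) f x = alg_act (comm_xi I) f x"
  using assms
proof (induction I arbitrary: f x)
  case (Cons i I)
  have xi_act: "alg_act (xi i) g = act (X i) g" for g :: "'a \<Rightarrow> 'a"
    by (simp add: xi_def alg_act_single fun_eq_iff word_act_def)
  show ?case
  proof (cases "I = []")
    case True
    then show ?thesis by (simp add: comm_field_single comm_xi_single xi_act)
  next
    case False
    have I: "set I \<subseteq> {0..n}" and i: "i \<le> n" using Cons.prems by auto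
    note kI = keys_comm_xi_words[OF False I]
    have ki: "Poly_Mapping.keys (xi i) \<subseteq> {J. set J \<subseteq> {0..n}}" using i by (simp add: xi_def)
    note f = Cons.prems(3) and x = Cons.prems(4)
    have sXf: "smooth_on (act (X i) f) S" by (rule smooth_on_act[OF open_S f smooth_X[OF i]])
    have "act (comm_field X (i # I)) f x = act (X i) (act (comm_field X I) f) x - act (comm_field X I) (act (X i) f) x"
      unfolding comm_field_Cons[OF False]
      by (rule act_lie_bracket[OF open_S x f smooth_X[OF i] smooth_comm_field[OF False I]])
    also have "act (X i) (act (comm_field X I) f) x = act (X i) (alg_act (comm_xi I) f) x"
      using Cons.IH[OF False I f] by (rule act_cong[OF open_S x])
    also have "act (comm_field X I) (act (X i) f) x = alg_act (comm_xi I) (act (X i) f) x"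
      by (rule Cons.IH[OF False I sXf x])
    finally show ?thesis
      unfolding comm_xi_Cons[OF False] alg_act_diff alg_act_mult[OF ki kI f x] alg_act_mult[OF kI ki f x] xi_act .
  qed
qed simp

text \<open>Testing an operator on the identity map recovers the coefficient vector; identities
  between operators thereby become identities between fields.\<close>

lemma act_ident: "act Z (\<lambda>y. y) x = Z x"
  by (simp add: act_def)

lemma comm_field_eq_alg_act:
  assumes "I \<noteq> []" "set I \<subseteq> {0..n}" "x \<in> S"
  shows "comm_field X I x = alg_act (comm_xi I) (\<lambda>y. y) x"
  using act_comm_field[OF assms(1,2) smooth_on_id assms(3)] by (simp add: act_ident)

lemma lie_bracket_eq_alg_act:
  assumes I: "I \<noteq> []" "set I \<subseteq> {0..n}" and J: "J \<noteq> []" "set J \<subseteq> {0..n}" and x: "x \<in> S"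
  shows "lie_bracket (comm_field X I) (comm_field X J) x =
    alg_act (comm_xi I * comm_xi J - comm_xi J * comm_xi I) (\<lambda>y. y) x"
proof -
  note sm = smooth_comm_field[OF I] smooth_comm_field[OF J]
  have *: "act (comm_field X I) (act (comm_field X J) (\<lambda>y. y)) x = alg_act (comm_xi I * comm_xi J) (\<lambda>y. y) x"
    if I: "I \<noteq> []" "set I \<subseteq> {0..n}" and J: "J \<noteq> []" "set J \<subseteq> {0..n}" for I J
  proof -
    note k = keys_comm_xi_words[OF I] keys_comm_xi_words[OF J]
    have "act (comm_field X I) (act (comm_field X J) (\<lambda>y. y)) x = act (comm_field X I) (alg_act (comm_xi J) (\<lambda>y. y)) x"
      using act_comm_field[OF J smooth_on_id] by (rule act_cong[OF open_S x])
    also have "\<dots> = alg_act (comm_xi I) (alg_act (comm_xi J) (\<lambda>y. y)) x"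
      by (rule act_comm_field[OF I smooth_alg_act[OF k(2) smooth_on_id] x])
    finally show ?thesis by (simp only: alg_act_mult[OF k smooth_on_id x])
  qed
  have "lie_bracket (comm_field X I) (comm_field X J) x = act (lie_bracket (comm_field X I) (comm_field X J)) (\<lambda>y. y) x"
    by (simp add: act_ident)
  also have "\<dots> = act (comm_field X I) (act (comm_field X J) (\<lambda>y. y)) x - act (comm_field X J) (act (comm_field X I) (\<lambda>y. y)) x"
    by (rule act_lie_bracket[OF open_S x smooth_on_id sm])
  finally show ?thesis unfolding *[OF I J] *[OF J I] alg_act_diff .
qed

lemma alg_act_lie_span:
  assumes "P \<in> lie_span n m" "x \<in> S"
  shows "alg_act P (\<lambda>y. y) x \<in> span ((\<lambda>K. comm_field X K x) ` {K. K \<noteq> [] \<and> set K \<subseteq> {0..n} \<and> weight K = m})"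
  using assms(1)
proof induction
  case (comm K)
  then show ?case
    using comm_field_eq_alg_act[of K x] assms(2) by (intro span_base) (auto intro!: image_eqI[of _ _ K])
next
  case zero
  show ?case by (simp add: alg_act_zero span_zero)
next
  case (diff P Q)
  then show ?case by (simp add: alg_act_diff span_diff)
qed

lemma bracket_in_span:
  assumes I: "I \<noteq> []" "set I \<subseteq> {0..n}" and J: "J \<noteq> []" "set J \<subseteq> {0..n}" and x: "x \<in> S"
  shows "lie_bracket (comm_field X I) (comm_field X J) x \<in>
    span ((\<lambda>K. comm_field X K x) ` {K. K \<noteq> [] \<and> set K \<subseteq> {0..n} \<and> weight K = weight I + weight J})"
  unfolding lie_bracket_eq_alg_act[OF assms]
  by (intro alg_act_lie_span x lie_span_comm I lie_span.comm J refl)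

text \<open>The converse direction of freeness: expand each field over words and exchange the sums,
  so that every word is multiplied by a coefficient that vanishes in the algebra.\<close>

lemma relation_transfer:
  assumes "finite A" and A: "\<And>I. I \<in> A \<Longrightarrow> I \<noteq> [] \<and> set I \<subseteq> {0..n}"
    and rel: "\<And>J. (\<Sum>I\<in>A. a I * comm_coeff I J) = 0" and x: "x \<in> S"
  shows "(\<Sum>I\<in>A. a I *\<^sub>R comm_field X I x) = 0"
proof -
  define U where "U = (\<Union>I\<in>A. Poly_Mapping.keys (comm_xi I))"
  have "finite U" using \<open>finite A\<close> by (simp add: U_def)
  have "(\<Sum>I\<in>A. a I *\<^sub>R comm_field X I x) = (\<Sum>I\<in>A. \<Sum>J\<in>U. (a I * comm_coeff I J) *\<^sub>R word_act J (\<lambda>y. y) x)"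
  proof (rule sum.cong[OF refl])
    fix I assume I: "I \<in> A"
    have "comm_field X I x = alg_act (comm_xi I) (\<lambda>y. y) x" using A[OF I] x by (intro comm_field_eq_alg_act) auto
    also have "\<dots> = (\<Sum>J\<in>U. comm_coeff I J *\<^sub>R word_act J (\<lambda>y. y) x)"
      unfolding comm_coeff_def using \<open>finite U\<close> I by (intro alg_act_superset) (auto simp: U_def)
    finally show "a I *\<^sub>R comm_field X I x = (\<Sum>J\<in>U. (a I * comm_coeff I J) *\<^sub>R word_act J (\<lambda>y. y) x)"
      by (simp add: scaleR_sum_right)
  qed
  also have "\<dots> = (\<Sum>J\<in>U. (\<Sum>I\<in>A. a I * comm_coeff I J) *\<^sub>R word_act J (\<lambda>y. y) x)"
    by (subst sum.swap) (simp add: scaleR_sum_left)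
  finally show ?thesis by (simp add: rel)
qed

end

subsection \<open>Absolutely continuous curves and initial value problems\<close>

definition interval_family :: "real \<Rightarrow> real \<Rightarrow> (real \<times> real) set \<Rightarrow> bool" where
  "interval_family a b D \<longleftrightarrow> finite D \<and> (\<forall>(s,t)\<in>D. a \<le> s \<and> s \<le> t \<and> t \<le> b) \<and>
    pairwise (\<lambda>(s,t) (s',t'). {s<..<t} \<inter> {s'<..<t'} = {}) D"

lemma absolutely_continuous_iff:
  "absolutely_continuous_on_interval a b f \<longleftrightarrow> (\<forall>\<epsilon>>0. \<exists>\<delta>>0. \<forall>D. interval_family a b D \<longrightarrow>
    (\<Sum>(s,t)\<in>D. t - s) < \<delta> \<longrightarrow> (\<Sum>(s,t)\<in>D. dist (f s) (f t)) < \<epsilon>)"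
  unfolding absolutely_continuous_on_interval_def interval_family_def imp_conjL by (rule refl)

lemma absolutely_continuous_norm_diff_le:
  fixes f :: "real \<Rightarrow> 'a::real_normed_vector"
  assumes ac: "absolutely_continuous_on_interval a\<^sub>0 b\<^sub>0 f" and "a\<^sub>0 \<le> a" "a \<le> b" "b \<le> b\<^sub>0" and "0 \<le> M"
    and N: "negligible N"
    and deriv: "\<And>t e. t \<in> {a..b} - N \<Longrightarrow> e > 0 \<Longrightarrow>
      \<exists>d>0. \<forall>s\<in>{a..b}. \<bar>s - t\<bar> < d \<longrightarrow> norm (f s - f t) \<le> (M + e) * \<bar>s - t\<bar>"
  shows "norm (f b - f a) \<le> M * (b - a)"
proof -
  have main: "norm (f b - f a) \<le> (M + e) * (b - a) + e" if "e > 0" for e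
  proof -
    obtain \<delta> where "\<delta> > 0" and \<delta>: "\<And>D. interval_family a\<^sub>0 b\<^sub>0 D \<Longrightarrow>
        (\<Sum>(s,t)\<in>D. t - s) < \<delta> \<Longrightarrow> (\<Sum>(s,t)\<in>D. dist (f s) (f t)) < e"
      using ac \<open>e > 0\<close> unfolding absolutely_continuous_iff by meson
    have "N \<in> sets lebesgue"
      using N negligible_iff_null_sets by blast
    then obtain T where T: "open T" "N \<subseteq> T" "(T - N) \<in> lmeasurable" "emeasure lebesgue (T - N) < ennreal \<delta>"
      using sets_lebesgue_outer_open \<open>\<delta> > 0\<close> by blast
    have "emeasure lebesgue T = emeasure lebesgue (T - N)"
      using N T(1) by (intro emeasure_Diff_null_set[symmetric]) (auto simp: negligible_iff_null_sets lborelD)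
    with T have emT: "emeasure lebesgue T < ennreal \<delta>" by simp
    have "\<forall>t\<in>{a..b} - N. \<exists>d>0. \<forall>s\<in>{a..b}. \<bar>s - t\<bar> < d \<longrightarrow> norm (f s - f t) \<le> (M + e) * \<bar>s - t\<bar>"
      using deriv \<open>e > 0\<close> by blast
    then obtain d where d: "\<And>t. t \<in> {a..b} - N \<Longrightarrow> d t > 0"
      "\<And>t s. t \<in> {a..b} - N \<Longrightarrow> s \<in> {a..b} \<Longrightarrow> \<bar>s - t\<bar> < d t \<Longrightarrow> norm (f s - f t) \<le> (M + e) * \<bar>s - t\<bar>"
      by metis
    \<comment> \<open>A piece tagged in \<open>N\<close> must lie in the open set \<open>T\<close>
      of measure less than \<delta>; a piece tagged elsewhere must lie where the local bound at its
      tag applies.\<close>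
    define \<gamma> where "\<gamma> = (\<lambda>t. if t \<in> N then T else if t \<in> {a..b} then ball t (d t) else ball t 1)"
    have "gauge \<gamma>"
      using T d unfolding \<gamma>_def gauge_def by (auto simp: split: if_splits)
    then obtain p where p: "p tagged_division_of {a..b}" "\<gamma> fine p"
      using fine_division_exists_real by blast
    note pD = tagged_division_ofD[OF p(1)]
    define p1 where "p1 = {q \<in> p. fst q \<in> N}"
    define p2 where "p2 = {q \<in> p. fst q \<notin> N}"
    have psplit: "p = p1 \<union> p2" "p1 \<inter> p2 = {}" "finite p1" "finite p2"
      using pD(1) by (auto simp: p1_def p2_def)
    have Kform: "x \<in> K \<and> Inf K \<in> K \<and> Sup K \<in> K \<and> interior K = {Inf K<..<Sup K} \<and> Inf K \<le> Sup K \<and> a \<le> Inf K \<and> Sup K \<le> b \<and> Inf K \<le> x \<and> x \<le> Sup K"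
      if xK: "(x,K) \<in> p" for x K
    proof -
      obtain u v where uv: "K = {u..v}" using pD(4)[OF xK] by (auto simp: box_real)
      have "x \<in> K" using pD(2)[OF xK] .
      with uv have "u \<le> v" by auto
      have "Inf K = u" "Sup K = v" using uv \<open>u \<le> v\<close> by auto
      moreover have "K \<subseteq> {a..b}" using pD(3)[OF xK] .
      ultimately show ?thesis using \<open>x \<in> K\<close> uv \<open>u \<le> v\<close> by auto
    qed
    have tele: "f b - f a = (\<Sum>(x,K)\<in>p. f (Sup K) - f (Inf K))"
      using additive_tagged_division_1[OF \<open>a \<le> b\<close> p(1), of f] by simp
    have tot: "(\<Sum>(x,K)\<in>p. Sup K - Inf K) = b - a"
      using additive_tagged_division_1[OF \<open>a \<le> b\<close> p(1), of "\<lambda>x. x"] by simp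
    have s2: "(\<Sum>(x,K)\<in>p2. norm (f (Sup K) - f (Inf K))) \<le> (M + e) * (b - a)"
    proof -
      have "(\<Sum>(x,K)\<in>p2. norm (f (Sup K) - f (Inf K))) \<le> (\<Sum>(x,K)\<in>p2. (M + e) * (Sup K - Inf K))"
      proof (rule sum_mono, clarsimp)
        fix x K assume xK2: "(x,K) \<in> p2"
        then have xK: "(x,K) \<in> p" "x \<notin> N" by (auto simp: p2_def)
        note F = Kform[OF xK(1)]
        have xab: "x \<in> {a..b} - N" using F xK by auto
        have "K \<subseteq> ball x (d x)"
          using p(2) xK xab unfolding fine_def \<gamma>_def by fastforce
        moreover have "Inf K \<in> K" "Sup K \<in> K" using F by auto
        ultimately have "\<bar>Inf K - x\<bar> < d x" "\<bar>Sup K - x\<bar> < d x" by (auto simp: dist_real_def)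
        then have "norm (f (Sup K) - f x) \<le> (M + e) * \<bar>Sup K - x\<bar>" "norm (f (Inf K) - f x) \<le> (M + e) * \<bar>Inf K - x\<bar>"
          using d(2)[OF xab, of "Sup K"] d(2)[OF xab, of "Inf K"] F by simp_all
        then have "norm (f (Sup K) - f (Inf K)) \<le> (M + e) * (Sup K - x) + (M + e) * (x - Inf K)"
          using F norm_triangle_ineq4[of "f (Sup K) - f x" "f (Inf K) - f x"] by simp
        also have "\<dots> = (M + e) * (Sup K - Inf K)" by (simp add: algebra_simps)
        finally show "norm (f (Sup K) - f (Inf K)) \<le> (M + e) * (Sup K - Inf K)" .
      qed
      also have "\<dots> \<le> (\<Sum>(x,K)\<in>p. (M + e) * (Sup K - Inf K))"
        using Kform \<open>0 \<le> M\<close> \<open>e > 0\<close> pD(1) by (intro sum_mono2) (auto simp: p2_def)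
      also have "\<dots> = (M + e) * (b - a)"
        unfolding tot[symmetric] by (simp add: sum_distrib_left case_prod_unfold)
      finally show ?thesis .
    qed
    define h where "h = (\<lambda>(x::real,K::real set). (Inf K, Sup K))"
    have disj: "{Inf K<..<Sup K} \<inter> {Inf K'<..<Sup K'} = {}"
      if "(x,K) \<in> p" "(x',K') \<in> p" "(x,K) \<noteq> (x',K')" for x K x' K'
    proof -
      have "interior K \<inter> interior K' = {}" using pD(5) that by blast
      moreover have "{Inf K<..<Sup K} = interior K" "{Inf K'<..<Sup K'} = interior K'"
        using Kform that by metis+
      ultimately show ?thesis by simp
    qed
    \<comment> \<open>\<open>h\<close> may identify different tagged pieces, but pieces with the
      same end points and disjoint interiors are degenerate, and then the summand vanishes.\<close>
    have reindex: "(\<Sum>(s,t)\<in>h ` p1. g s t) = (\<Sum>(x,K)\<in>p1. g (Inf K) (Sup K))"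
      if g0: "\<And>s. g s s = (0::real)" for g
    proof -
      have "sum (\<lambda>(s,t). g s t) (h ` p1) = sum ((\<lambda>(s,t). g s t) \<circ> h) p1"
      proof (rule sum.reindex_nontrivial[OF psplit(3)])
        fix q q' assume q: "q \<in> p1" "q' \<in> p1" "q \<noteq> q'" "h q = h q'"
        obtain x K x' K' where e: "q = (x,K)" "q' = (x',K')" by fastforce
        have "{Inf K<..<Sup K} \<inter> {Inf K'<..<Sup K'} = {}"
          using disj q e by (auto simp: p1_def)
        moreover have "Inf K = Inf K'" "Sup K = Sup K'" using q e by (auto simp: h_def)
        ultimately have "\<not> Inf K < Sup K" by auto
        moreover have "Inf K \<le> Sup K" using Kform q e by (auto simp: p1_def)
        ultimately show "(case h q of (s,t) \<Rightarrow> g s t) = 0" using g0 e by (simp add: h_def)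
      qed
      then show ?thesis by (simp add: o_def h_def case_prod_unfold)
    qed
    have s1: "(\<Sum>(x,K)\<in>p1. norm (f (Sup K) - f (Inf K))) < e"
    proof -
      have "(\<Sum>(s,t)\<in>h ` p1. dist (f s) (f t)) < e"
      proof (rule \<delta>)
        have pw: "pairwise (\<lambda>(s,t) (s',t'). {s<..<t} \<inter> {s'<..<t'} = {}) (h ` p1)"
          using disj by (fastforce simp: pairwise_def h_def p1_def)
        moreover have "\<forall>(s,t)\<in>h ` p1. a\<^sub>0 \<le> s \<and> s \<le> t \<and> t \<le> b\<^sub>0"
          using Kform \<open>a\<^sub>0 \<le> a\<close> \<open>b \<le> b\<^sub>0\<close> by (fastforce simp: h_def p1_def)
        ultimately show "interval_family a\<^sub>0 b\<^sub>0 (h ` p1)"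
          using psplit by (simp add: interval_family_def)
        have "ennreal (\<Sum>(s,t)\<in>h ` p1. t - s) = (\<Sum>(s,t)\<in>h ` p1. ennreal (t - s))"
          using Kform by (subst sum_ennreal[symmetric]) (auto simp: h_def p1_def case_prod_unfold intro!: sum.cong)
        also have "\<dots> = (\<Sum>q\<in>h ` p1. emeasure lebesgue {fst q<..<snd q})"
          using Kform by (intro sum.cong) (auto simp: h_def p1_def)
        also have "\<dots> = emeasure lebesgue (\<Union>q\<in>h ` p1. {fst q<..<snd q})"
          using pw psplit by (intro sum_emeasure) (auto simp: disjoint_family_on_def pairwise_def case_prod_unfold)
        also have "\<dots> \<le> emeasure lebesgue T"
        proof (rule emeasure_mono)
          show "(\<Union>q\<in>h ` p1. {fst q<..<snd q}) \<subseteq> T"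
          proof (clarsimp simp: h_def)
            fix x K y assume "(x,K) \<in> p1" "Inf K < y" "y < Sup K"
            then have xK: "(x,K) \<in> p" "x \<in> N" by (auto simp: p1_def)
            have "y \<in> interior K" using Kform[OF xK(1)] \<open>Inf K < y\<close> \<open>y < Sup K\<close> by simp
            then have "y \<in> K" using interior_subset by blast
            with xK show "y \<in> T" using p(2) by (fastforce simp: fine_def \<gamma>_def)
          qed
          show "T \<in> sets lebesgue" using T by (simp add: lborelD)
        qed
        also have "\<dots> < ennreal \<delta>" by (rule emT)
        finally show "(\<Sum>(s,t)\<in>h ` p1. t - s) < \<delta>"
          using ennreal_less_iff Kform by (smt (verit) ennreal_leI not_le)
      qed
      then show ?thesis
        by (subst (asm) reindex) (auto simp: dist_norm norm_minus_commute case_prod_unfold)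
    qed
    have "norm (f b - f a) \<le> (\<Sum>(x,K)\<in>p. norm (f (Sup K) - f (Inf K)))"
      unfolding tele by (rule order_trans[OF norm_sum]) (simp add: case_prod_unfold)
    also have "\<dots> = (\<Sum>(x,K)\<in>p1. norm (f (Sup K) - f (Inf K))) + (\<Sum>(x,K)\<in>p2. norm (f (Sup K) - f (Inf K)))"
      by (subst psplit(1)) (rule sum.union_disjoint[OF psplit(3,4,2)])
    also have "\<dots> \<le> (M + e) * (b - a) + e" using s1 s2 by simp
    finally show ?thesis .
  qed
  show ?thesis
  proof (rule field_le_epsilon)
    fix \<epsilon> :: real assume "\<epsilon> > 0"
    define e where "e = \<epsilon> / (b - a + 1)"
    have "e * (b - a + 1) = \<epsilon>" using \<open>a \<le> b\<close> by (simp add: e_def)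
    then have "e * (b - a) + e = \<epsilon>" by (simp add: algebra_simps)
    moreover have "e > 0" using \<open>\<epsilon> > 0\<close> \<open>a \<le> b\<close> by (simp add: e_def)
    ultimately show "norm (f b - f a) \<le> M * (b - a) + \<epsilon>"
      using main[of e] by (simp add: algebra_simps)
  qed
qed

text \<open>Continuity argument: by compactness there is a first time at which some bound fails, and
  \<open>step\<close> excludes it. At \<open>T = 0\<close> the premise of \<open>step\<close> is
  vacuous, so \<open>step\<close> also carries the initial condition.\<close>

lemma continuous_first_exit:
  fixes g :: "'i \<Rightarrow> real \<Rightarrow> real"
  assumes fin: "finite I" and cont: "\<And>i. i \<in> I \<Longrightarrow> continuous_on {0..1} (g i)"
    and step: "\<And>T. 0 \<le> T \<Longrightarrow> T \<le> 1 \<Longrightarrow> (\<And>t i. 0 \<le> t \<Longrightarrow> t < T \<Longrightarrow> i \<in> I \<Longrightarrow> g i t < c i) \<Longrightarrow> \<forall>i\<in>I. g i T < c i"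
    and t: "0 \<le> t" "t \<le> 1" and i: "i \<in> I"
  shows "g i t < c i"
proof (rule ccontr)
  assume "\<not> g i t < c i"
  define S where "S = (\<Union>i\<in>I. {t \<in> {0..1}. c i \<le> g i t})"
  have "t \<in> S" using t i \<open>\<not> g i t < c i\<close> by (auto simp: S_def not_less)
  have "compact {t \<in> {0..1}. c i \<le> g i t}" if "i \<in> I" for i
  proof -
    have "closed ({0..1} \<inter> g i -` {c i..})"
      by (rule continuous_closed_preimage[OF cont[OF that]]) auto
    moreover have "{0..1} \<inter> g i -` {c i..} = {t \<in> {0..1}. c i \<le> g i t}" by auto
    ultimately show ?thesis
      by (metis (no_types, lifting) compact_Icc compact_eq_bounded_closed bounded_subset Int_lower1)
  qed
  then have "compact S"
    unfolding S_def using fin by (intro compact_UN)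
  then obtain T where T: "T \<in> S" "\<forall>s\<in>S. T \<le> s"
    using \<open>t \<in> S\<close> by (metis compact_attains_inf empty_iff)
  have T01: "0 \<le> T" "T \<le> 1" using T by (auto simp: S_def)
  have "\<And>t i. 0 \<le> t \<Longrightarrow> t < T \<Longrightarrow> i \<in> I \<Longrightarrow> g i t < c i"
    using T(2) T01 unfolding S_def by force
  from step[OF T01 this] have "\<forall>i\<in>I. g i T < c i" by blast
  then show False using T(1) by (auto simp: S_def)
qed

lemma norm_diff_le_derivative_bound:
  fixes f :: "real \<Rightarrow> 'a::real_normed_vector"
  assumes "\<And>t. t \<in> {0..1} \<Longrightarrow> (f has_vector_derivative f' t) (at t within {0..1})"
    and "\<And>t. t \<in> {0..1} \<Longrightarrow> norm (f' t) \<le> M"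
    and "s \<in> {0..1}" "t \<in> {0..1}"
  shows "norm (f s - f t) \<le> M * \<bar>s - t\<bar>"
  using differentiable_bound[of "{0..1}" f "\<lambda>s h. h *\<^sub>R f' s" M s t] assms
  by (auto simp: has_vector_derivative_def onorm_scaleR_left onorm_id)

lemma small_gronwall:
  fixes D :: "real \<Rightarrow> 'a::real_normed_vector"
  assumes D: "\<And>t. t \<in> {0..1} \<Longrightarrow> (D has_vector_derivative D' t) (at t within {0..1})"
    and D0: "D 0 = 0"
    and bd: "\<And>t. t \<in> {0..1} \<Longrightarrow> norm (D' t) \<le> norm (D t) / 2 + b"
    and t: "t \<in> {0..1}"
  shows "norm (D t) \<le> 2 * b"
proof -
  have cont: "continuous_on {0..1} D"
    using D by (meson continuous_on_eq_continuous_within has_vector_derivative_continuous)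
  then have "continuous_on {0..1} (\<lambda>t. norm (D t))" by (intro continuous_intros)
  then obtain T where T: "T \<in> {0..1}" "\<And>t. t \<in> {0..1} \<Longrightarrow> norm (D t) \<le> norm (D T)"
    using continuous_attains_sup[of "{0..1::real}" "\<lambda>t. norm (D t)"] by auto
  have "norm (D' s) \<le> norm (D T) / 2 + b" if "s \<in> {0..1}" for s
    using bd[OF that] T(2)[OF that] by simp
  then have "norm (D T - D 0) \<le> (norm (D T) / 2 + b) * norm (T - 0)"
    using norm_diff_le_derivative_bound[OF D, of "norm (D T) / 2 + b" T 0] T(1) by simp
  then have 1: "norm (D T) \<le> (norm (D T) / 2 + b) * T" using D0 T(1) by simp
  have "0 \<le> norm (D T) / 2 + b" using order_trans[OF norm_ge_zero bd[OF T(1)]] .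
  then have "(norm (D T) / 2 + b) * T \<le> norm (D T) / 2 + b"
    using T(1) by (simp add: mult_left_le)
  with 1 have "norm (D T) \<le> 2 * b" by simp
  with T(2)[OF t] show ?thesis by simp
qed

text \<open>The speed bound \<rho> keeps curves in the closed ball for unit time, and the Lipschitz
  constant 1/2 makes the integral operator a contraction on the whole unit interval.\<close>

lemma picard_unit_interval:
  fixes F :: "'a::euclidean_space \<Rightarrow> 'a"
  assumes "0 \<le> \<rho>" and bd: "\<And>y. y \<in> cball x \<rho> \<Longrightarrow> norm (F y) \<le> \<rho>"
    and lip: "\<And>y z. y \<in> cball x \<rho> \<Longrightarrow> z \<in> cball x \<rho> \<Longrightarrow> norm (F y - F z) \<le> norm (y - z) / 2"
  obtains \<phi> where "\<phi> 0 = x" "\<And>t. t \<in> {0..1} \<Longrightarrow> \<phi> t \<in> cball x \<rho>"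
    "\<And>t. t \<in> {0..1} \<Longrightarrow> (\<phi> has_vector_derivative F (\<phi> t)) (at t within {0..1})"
proof -
  \<comment> \<open>Clamping time to the unit interval extends curves to bounded continuous
    functions on the line, which form a complete metric space.\<close>
  define cl where "cl = (\<lambda>t::real. max 0 (min 1 t))"
  have clI: "cl t \<in> {0..1}" for t by (auto simp: cl_def)
  have clc: "continuous_on UNIV cl" unfolding cl_def by (intro continuous_intros)
  define S where "S = PiC UNIV (\<lambda>_::real. cball x \<rho>)"
  have contF: "continuous_on (cball x \<rho>) F"
    using lip by (intro lipschitz_on_continuous_on[of "1/2"] lipschitz_onI) (auto simp: dist_norm)
  have SI: "apply_bcontfun f t \<in> cball x \<rho>" if "f \<in> S" for f t
    using that unfolding S_def by (auto simp: mem_PiC_iff)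
  have contFf: "continuous_on A (\<lambda>s. F (apply_bcontfun f s))" if "f \<in> S" for f A
    by (rule continuous_on_compose2[OF contF]) (use SI[OF that] in auto)
  define P where "P = (\<lambda>f t. x + integral {0..cl t} (\<lambda>s. F (apply_bcontfun f s)))"
  have intb: "norm (integral {0..cl t} g) \<le> B" if "continuous_on {0..cl t} g" "\<And>s. s \<in> {0..cl t} \<Longrightarrow> norm (g s) \<le> B" "0 \<le> B"
    for t B and g :: "real \<Rightarrow> 'a"
  proof -
    have "norm (integral {0..cl t} g) \<le> B * (cl t - 0)"
      using clI[of t] that by (intro integral_bound) auto
    also have "\<dots> \<le> B" using clI[of t] that(3) by (simp add: mult_left_le)
    finally show ?thesis .
  qed
  have Pcb: "P f t \<in> cball x \<rho>" if "f \<in> S" for f t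
    using intb[OF contFf[OF that], of t \<rho>] bd SI[OF that] \<open>0 \<le> \<rho>\<close> by (simp add: P_def dist_norm)
  have Pcont: "continuous_on UNIV (P f)" if "f \<in> S" for f
  proof -
    have "continuous_on {0..1} (\<lambda>t. integral {0..t} (\<lambda>s. F (apply_bcontfun f s)))"
      by (intro indefinite_integral_continuous_1 integrable_continuous_interval contFf that)
    then have "continuous_on UNIV (\<lambda>t. integral {0..cl t} (\<lambda>s. F (apply_bcontfun f s)))"
      by (rule continuous_on_compose2[OF _ clc]) (use clI in auto)
    then show ?thesis
      unfolding P_def by (intro continuous_intros)
  qed
  have Pb: "P f \<in> bcontfun" if "f \<in> S" for f
  proof -
    have "range (P f) \<subseteq> cball x \<rho>" using Pcb[OF that] by blast
    then have "bounded (range (P f))" using bounded_cball bounded_subset by blast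
    then show ?thesis using Pcont[OF that] by (auto simp: bcontfun_def)
  qed
  have "\<exists>!f. f \<in> S \<and> Bcontfun (P f) = f"
  proof (rule Banach_fix[of S "1/2"])
    show "complete S" unfolding S_def by (intro closed_PiC complete_eq_closed[THEN iffD2]) auto
    have "const_bcontfun x \<in> S" using \<open>0 \<le> \<rho>\<close> unfolding S_def by (simp add: mem_PiC_iff const_bcontfun.rep_eq)
    then show "S \<noteq> {}" by auto
    show "(\<lambda>f. Bcontfun (P f)) ` S \<subseteq> S"
      using Pcb Pb unfolding S_def by (auto simp: mem_PiC_iff Bcontfun_inverse)
    fix f g assume fg: "f \<in> S" "g \<in> S"
    have "dist (apply_bcontfun (Bcontfun (P f)) t) (apply_bcontfun (Bcontfun (P g)) t) \<le> 1 / 2 * dist f g" for t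
    proof -
      have "P f t - P g t = integral {0..cl t} (\<lambda>s. F (apply_bcontfun f s) - F (apply_bcontfun g s))"
        unfolding P_def by (subst Henstock_Kurzweil_Integration.integral_diff) (auto intro!: integrable_continuous_interval contFf fg)
      moreover have "norm \<dots> \<le> 1 / 2 * dist f g"
      proof (rule intb)
        show "continuous_on {0..cl t} (\<lambda>s. F (apply_bcontfun f s) - F (apply_bcontfun g s))"
          by (intro continuous_intros contFf fg)
        fix s
        have "norm (F (apply_bcontfun f s) - F (apply_bcontfun g s)) \<le> norm (apply_bcontfun f s - apply_bcontfun g s) / 2"
          by (intro lip SI fg)
        then show "norm (F (apply_bcontfun f s) - F (apply_bcontfun g s)) \<le> 1 / 2 * dist f g"
          using dist_bounded[of f s g] by (simp add: dist_norm)
      qed auto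
      ultimately show ?thesis using fg by (simp add: Bcontfun_inverse Pb dist_norm)
    qed
    then show "dist (Bcontfun (P f)) (Bcontfun (P g)) \<le> 1 / 2 * dist f g"
      by (rule dist_bound)
  qed auto
  then obtain f where f: "f \<in> S" "Bcontfun (P f) = f" by blast
  then have fP: "apply_bcontfun f t = P f t" for t 
    using Bcontfun_inverse[OF Pb[OF f(1)]] unfolding f(2) by simp
  show ?thesis
  proof
    show "apply_bcontfun f 0 = x" using fP[of 0] by (simp add: P_def cl_def)
    show "apply_bcontfun f t \<in> cball x \<rho>" for t by (rule SI[OF f(1)])
    fix t :: real assume t: "t \<in> {0..1}"
    have "((\<lambda>t. integral {0..t} (\<lambda>s. F (apply_bcontfun f s))) has_vector_derivative F (apply_bcontfun f t)) (at t within {0..1})"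
      by (rule integral_has_vector_derivative[OF contFf[OF f(1)] t])
    then have "((\<lambda>t. x + integral {0..t} (\<lambda>s. F (apply_bcontfun f s))) has_vector_derivative F (apply_bcontfun f t)) (at t within {0..1})"
      by (auto intro!: derivative_eq_intros)
    then show "(apply_bcontfun f has_vector_derivative F (apply_bcontfun f t)) (at t within {0..1})"
    proof (rule has_vector_derivative_transform[OF t, rotated])
      fix s :: real assume "s \<in> {0..1}"
      then show "apply_bcontfun f s = x + integral {0..s} (\<lambda>s. F (apply_bcontfun f s))"
        using fP[of s] by (simp add: P_def cl_def)
    qed
  qed
qed

text \<open>Two uses are intended: \<open>K' = 0\<close> for the image of a curve under a Lipschitz
  map, and \<open>K = 1\<close> for a curve to which a linear drift is added.\<close>

lemma absolutely_continuous_dominated: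
  assumes f: "absolutely_continuous_on_interval a b f" and "0 \<le> K" "0 \<le> K'"
    and le: "\<And>s t. s \<in> {a..b} \<Longrightarrow> t \<in> {a..b} \<Longrightarrow> dist (g s) (g t) \<le> K * dist (f s) (f t) + K' * \<bar>s - t\<bar>"
  shows "absolutely_continuous_on_interval a b g"
  unfolding absolutely_continuous_iff
proof (intro allI impI)
  fix e :: real assume "e > 0"
  define e' where "e' = e / (2 * (K + 1))"
  have "e' > 0" using \<open>e > 0\<close> \<open>0 \<le> K\<close> by (simp add: e'_def)
  have e': "(K + 1) * e' = e / 2" using \<open>0 \<le> K\<close> by (simp add: e'_def field_simps)
  obtain \<delta> where \<delta>: "\<delta> > 0" "\<And>D. interval_family a b D \<Longrightarrow>
        (\<Sum>(s,t)\<in>D. t - s) < \<delta> \<Longrightarrow> (\<Sum>(s,t)\<in>D. dist (f s) (f t)) < e'"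
    using f \<open>e' > 0\<close> unfolding absolutely_continuous_iff by meson
  define d where "d = min \<delta> (e / (2 * (K' + 1)))"
  show "\<exists>\<delta>>0. \<forall>D. interval_family a b D \<longrightarrow>
        (\<Sum>(s,t)\<in>D. t - s) < \<delta> \<longrightarrow> (\<Sum>(s,t)\<in>D. dist (g s) (g t)) < e"
  proof (intro exI[of _ d] conjI allI impI)
    show "0 < d" using \<delta> \<open>e > 0\<close> \<open>0 \<le> K'\<close> by (simp add: d_def)
    fix D assume D: "interval_family a b D" "(\<Sum>(s,t)\<in>D. t - s) < d"
    have "(\<Sum>(s,t)\<in>D. t - s) < \<delta>" using D(2) by (simp add: d_def)
    from \<delta>(2)[OF D(1) this] have 1: "(\<Sum>(s,t)\<in>D. dist (f s) (f t)) < e'" .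
    have "(\<Sum>(s,t)\<in>D. dist (g s) (g t)) \<le> (\<Sum>(s,t)\<in>D. K * dist (f s) (f t) + K' * (t - s))"
    proof (rule sum_mono, clarify)
      fix s t assume "(s,t) \<in> D"
      then have "s \<in> {a..b}" "t \<in> {a..b}" "s \<le> t" using D(1) unfolding interval_family_def by fastforce+
      then show "dist (g s) (g t) \<le> K * dist (f s) (f t) + K' * (t - s)"
        using le[of s t] by simp
    qed
    also have "\<dots> = K * (\<Sum>(s,t)\<in>D. dist (f s) (f t)) + K' * (\<Sum>(s,t)\<in>D. t - s)"
      by (simp add: case_prod_unfold sum.distrib sum_distrib_left)
    also have "\<dots> \<le> K * e' + K' * (e / (2 * (K' + 1)))"
      using 1 D(2) \<open>0 \<le> K\<close> \<open>0 \<le> K'\<close> by (intro add_mono mult_left_mono) (auto simp: d_def)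
    also have "\<dots> < (K + 1) * e' + (K' + 1) * (e / (2 * (K' + 1)))"
      using \<open>e' > 0\<close> \<open>e > 0\<close> \<open>0 \<le> K'\<close> by (intro add_strict_mono mult_strict_right_mono) auto
    also have "(K' + 1) * (e / (2 * (K' + 1))) = e / 2"
    proof -
      have "K' + 1 \<noteq> 0" using \<open>0 \<le> K'\<close> by simp
      then show ?thesis by (simp add: divide_simps)
    qed
    also have "(K + 1) * e' + e / 2 = e" using e' by simp
    finally show "(\<Sum>(s,t)\<in>D. dist (g s) (g t)) < e" .
  qed
qed

lemma lipschitz_absolutely_continuous:
  assumes "0 \<le> K" "\<And>s t. s \<in> {a..b} \<Longrightarrow> t \<in> {a..b} \<Longrightarrow> dist (g s) (g t) \<le> K * \<bar>s - t\<bar>"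
  shows "absolutely_continuous_on_interval a b g"
proof (rule absolutely_continuous_dominated[of a b "\<lambda>_. 0::real" 0 K])
  show "absolutely_continuous_on_interval a b (\<lambda>_. 0::real)"
    unfolding absolutely_continuous_iff by (auto intro: exI[of _ 1])
qed (use assms in auto)

lemma absolutely_continuous_imp_continuous:
  assumes "absolutely_continuous_on_interval a b f"
  shows "continuous_on {a..b} f"
  unfolding continuous_on_iff
proof (intro ballI allI impI)
  fix t e :: real assume t: "t \<in> {a..b}" and "e > 0"
  obtain \<delta> where \<delta>: "\<delta> > 0" "\<And>D. interval_family a b D \<Longrightarrow>
        (\<Sum>(s,t)\<in>D. t - s) < \<delta> \<Longrightarrow> (\<Sum>(s,t)\<in>D. dist (f s) (f t)) < e"
    using assms \<open>e > 0\<close> unfolding absolutely_continuous_iff by meson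
  show "\<exists>d>0. \<forall>s\<in>{a..b}. dist s t < d \<longrightarrow> dist (f s) (f t) < e"
  proof (intro exI[of _ \<delta>] conjI ballI impI)
    fix s assume s: "s \<in> {a..b}" "dist s t < \<delta>"
    show "dist (f s) (f t) < e"
      using \<delta>(2)[of "{(min s t, max s t)}"] s t
      by (cases "s \<le> t") (auto simp: interval_family_def min_def max_def dist_real_def dist_commute)
  qed (rule \<delta>)
qed

lemma has_vector_derivative_imp_increment_le:
  fixes f :: "real \<Rightarrow> 'a::real_normed_vector"
  assumes "(f has_vector_derivative f') (at t within S)" "norm f' \<le> m" "e > 0"
  shows "\<exists>d>0. \<forall>s\<in>S. \<bar>s - t\<bar> < d \<longrightarrow> norm (f s - f t) \<le> (m + e) * \<bar>s - t\<bar>"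
proof -
  obtain d where d: "d > 0" "\<And>s. s \<in> S \<Longrightarrow> norm (s - t) < d \<Longrightarrow> norm (f s - f t - (s - t) *\<^sub>R f') \<le> e * norm (s - t)"
    using assms(1,3) unfolding has_vector_derivative_def has_derivative_within_alt by meson
  have "norm (f s - f t) \<le> (m + e) * \<bar>s - t\<bar>" if "s \<in> S" "\<bar>s - t\<bar> < d" for s
  proof -
    have "norm (f s - f t) \<le> norm (f s - f t - (s - t) *\<^sub>R f') + norm ((s - t) *\<^sub>R f')"
      using norm_triangle_ineq[of "f s - f t - (s - t) *\<^sub>R f'" "(s - t) *\<^sub>R f'"] by simp
    also have "\<dots> \<le> e * \<bar>s - t\<bar> + m * \<bar>s - t\<bar>"
      using d(2)[OF that(1)] that(2) assms(2) by (intro add_mono) (auto simp: mult.commute mult_right_mono)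
    finally show ?thesis by (simp add: algebra_simps)
  qed
  with d(1) show ?thesis by blast
qed

subsection \<open>Lipschitz images and Lebesgue measure\<close>

text \<open>Cover \<open>S\<close> by non-overlapping dyadic cubes inside \<open>S\<close>. A cube
  of side \<open>h\<close> has diameter at most \<open>n * h\<close>, so its image lies in a cube of
  side \<open>2 * L * n * h\<close>.\<close>

lemma emeasure_lipschitz_image_le:
  fixes f :: "'a::euclidean_space \<Rightarrow> 'a"
  assumes S: "open S" "bounded S" and "0 \<le> L"
    and lip: "\<And>x y. x \<in> S \<Longrightarrow> y \<in> S \<Longrightarrow> norm (f x - f y) \<le> L * norm (x - y)"
  shows "emeasure lebesgue (f ` S) \<le> ennreal ((2 * L * DIM('a)) ^ DIM('a)) * emeasure lebesgue S"
proof -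
  define n where "n = DIM('a)"
  define c where "c = (2 * L * n) ^ n"
  obtain r where "r > 0" and r: "\<And>x. x \<in> S \<Longrightarrow> norm x \<le> r"
    using S(2) by (auto simp: bounded_pos)
  \<comment> \<open>Every covering cube lies in \<open>g x\<close> for some of its points
    \<open>x\<close> in \<open>S\<close>, hence in \<open>S\<close>.\<close>
  define g where "g = (\<lambda>x. if x \<in> S then S else UNIV)"
  have "S \<subseteq> cbox (- (r *\<^sub>R One)) (r *\<^sub>R (One::'a))"
  proof
    fix x assume "x \<in> S"
    have "\<bar>x \<bullet> i\<bar> \<le> r" if "i \<in> Basis" for i
      using r[OF \<open>x \<in> S\<close>] Basis_le_norm[OF that, of x] by linarith
    then show "x \<in> cbox (- (r *\<^sub>R One)) (r *\<^sub>R (One::'a))"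
      by (fastforce simp: mem_box abs_le_iff)
  qed
  moreover have "box (- (r *\<^sub>R One)) (r *\<^sub>R (One::'a)) \<noteq> {}"
    using \<open>r > 0\<close> by (auto simp: box_ne_empty)
  moreover have "gauge g" using S by (auto simp: gauge_def g_def)
  ultimately obtain \<D> where cnt: "countable \<D>"
    and K: "\<And>K. K \<in> \<D> \<Longrightarrow> interior K \<noteq> {} \<and> (\<exists>c d. K = cbox c d)"
    and pw: "pairwise (\<lambda>A B. interior A \<inter> interior B = {}) \<D>"
    and Kg: "\<And>K. K \<in> \<D> \<Longrightarrow> \<exists>x \<in> S \<inter> K. K \<subseteq> g x"
    and side: "\<And>u v. cbox u v \<in> \<D> \<Longrightarrow> \<exists>n. \<forall>i \<in> Basis. v \<bullet> i - u \<bullet> i = (r *\<^sub>R One \<bullet> i - (- (r *\<^sub>R One)) \<bullet> i) / 2^n"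
    and SD: "S \<subseteq> \<Union>\<D>"
    by (rule covering_lemma) blast
  have KS: "K \<subseteq> S" if "K \<in> \<D>" for K
    using Kg[OF that] by (auto simp: g_def)
  have "\<exists>C. f ` K \<subseteq> C \<and> C \<in> sets lebesgue \<and> emeasure lebesgue C \<le> ennreal c * emeasure lebesgue (interior K)" if KD: "K \<in> \<D>" for K
  proof -
    obtain u v where uv: "K = cbox u v" using K[OF KD] by blast
    then obtain N where N: "\<forall>i \<in> Basis. v \<bullet> i - u \<bullet> i = (r *\<^sub>R One \<bullet> i - (- (r *\<^sub>R One)) \<bullet> i) / 2^N"
      using side KD by blast
    define h where "h = 2 * r / 2 ^ N"
    have "h > 0" using \<open>r > 0\<close> by (simp add: h_def)
    have vu: "v \<bullet> i - u \<bullet> i = h" if "i \<in> Basis" for i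
      using N that by (simp add: h_def)
    define C where "C = cbox (f u - (L * n * h) *\<^sub>R One) (f u + (L * n * h) *\<^sub>R One)"
    have "f ` K \<subseteq> C"
    proof clarify
      fix x assume x: "x \<in> K"
      have "u \<in> K" unfolding uv using vu \<open>h > 0\<close> by (force simp: mem_box)
      have "norm (x - u) \<le> (\<Sum>i\<in>Basis. \<bar>(x - u) \<bullet> i\<bar>)" by (rule norm_le_l1)
      also have "\<dots> \<le> (\<Sum>i\<in>(Basis::'a set). h)"
      proof (rule sum_mono)
        fix i :: 'a assume "i \<in> Basis"
        then have "u \<bullet> i \<le> x \<bullet> i" "x \<bullet> i \<le> v \<bullet> i" using x uv by (auto simp: mem_box)
        with vu[OF \<open>i \<in> Basis\<close>] show "\<bar>(x - u) \<bullet> i\<bar> \<le> h" by (simp add: inner_diff_left)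
      qed
      also have "\<dots> = n * h" by (simp add: n_def)
      finally have "norm (x - u) \<le> n * h" .
      then have "norm (f x - f u) \<le> L * (n * h)"
        using lip[of x u] KS[OF KD] x \<open>u \<in> K\<close> mult_left_mono[OF _ \<open>0 \<le> L\<close>] by (meson order_trans subsetD)
      then have le: "\<bar>(f x - f u) \<bullet> i\<bar> \<le> L * n * h" if "i \<in> Basis" for i
        using Basis_le_norm[OF that, of "f x - f u"] by (simp add: mult.assoc)
      show "f x \<in> C"
        unfolding C_def mem_box
      proof
        fix i :: 'a assume "i \<in> Basis"
        with le[OF this] show "(f u - (L * n * h) *\<^sub>R One) \<bullet> i \<le> f x \<bullet> i \<and> f x \<bullet> i \<le> (f u + (L * n * h) *\<^sub>R One) \<bullet> i"
          by (auto simp: inner_diff_left inner_add_left abs_le_iff)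
      qed
    qed
    moreover have "emeasure lebesgue C = ennreal c * emeasure lebesgue (interior K)"
    proof -
      have "0 \<le> L * n * h" using \<open>0 \<le> L\<close> \<open>h > 0\<close> by simp
      then have "emeasure lborel C = ennreal (\<Prod>i\<in>(Basis::'a set). 2 * (L * n * h))"
        unfolding C_def by (subst emeasure_lborel_cbox) (auto simp: inner_diff_left inner_add_left mult_ac intro!: arg_cong[where f=ennreal] prod.cong)
      also have "(\<Prod>i\<in>(Basis::'a set). 2 * (L * n * h)) = c * h ^ n"
        by (simp add: c_def n_def power_mult_distrib mult_ac)
      finally have 1: "emeasure lborel C = ennreal (c * h ^ n)" .
      have "emeasure lborel (box u v) = ennreal (\<Prod>i\<in>(Basis::'a set). h)"
        by (subst emeasure_lborel_box) (use vu \<open>h > 0\<close> in \<open>auto simp: inner_diff_left intro!: arg_cong[where f=ennreal] prod.cong\<close>, force)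
      then have 2: "emeasure lborel (box u v) = ennreal (h ^ n)" by (simp add: n_def)
      have "0 \<le> c" using \<open>0 \<le> L\<close> by (simp add: c_def)
      have "C \<in> sets borel" by (simp add: C_def)
      with 1 2 \<open>0 \<le> c\<close> \<open>h > 0\<close> show ?thesis
        by (simp add: uv ennreal_mult)
    qed
    moreover have "C \<in> sets lebesgue" by (simp add: C_def)
    ultimately show ?thesis by (metis order_refl)
  qed
  then obtain C where C: "\<And>K. K \<in> \<D> \<Longrightarrow> f ` K \<subseteq> C K" "\<And>K. K \<in> \<D> \<Longrightarrow> C K \<in> sets lebesgue"
    "\<And>K. K \<in> \<D> \<Longrightarrow> emeasure lebesgue (C K) \<le> ennreal c * emeasure lebesgue (interior K)"
    by metis
  \<comment> \<open>The countable family of cubes is spread over the natural numbers: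
    \<open>A\<close> covers the image, and the disjoint interiors \<open>B\<close> fit into
    \<open>S\<close>.\<close>
  define I where "I = to_nat_on \<D> ` \<D>"
  define A where "A = (\<lambda>i. if i \<in> I then C (from_nat_into \<D> i) else {})"
  define B where "B = (\<lambda>i. if i \<in> I then interior (from_nat_into \<D> i) else {})"
  have ID: "from_nat_into \<D> i \<in> \<D>" if "i \<in> I" for i
    using that cnt by (auto simp: I_def)
  have Dinj: "inj_on (from_nat_into \<D>) I"
    using cnt by (intro inj_onI) (auto simp: I_def)
  have "f ` S \<subseteq> (\<Union>i. A i)"
  proof clarify
    fix x assume "x \<in> S"
    then obtain K where K: "K \<in> \<D>" "x \<in> K" using SD by blast
    then have "f x \<in> A (to_nat_on \<D> K)"
      using C(1)[OF K(1)] cnt by (auto simp: A_def I_def)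
    then show "f x \<in> (\<Union>i. A i)" by blast
  qed
  moreover have Am: "range A \<subseteq> sets lebesgue" using C(2) ID by (auto simp: A_def)
  ultimately have "emeasure lebesgue (f ` S) \<le> emeasure lebesgue (\<Union>i. A i)"
    by (intro emeasure_mono) auto
  also have "\<dots> \<le> suminf (\<lambda>i. emeasure lebesgue (A i))"
    by (rule emeasure_subadditive_countably[OF Am])
  also have "\<dots> \<le> suminf (\<lambda>i. ennreal c * emeasure lebesgue (B i))"
    using C(3) ID by (intro suminf_le) (auto simp: A_def B_def)
  also have "\<dots> = ennreal c * suminf (\<lambda>i. emeasure lebesgue (B i))" by simp
  also have "suminf (\<lambda>i. emeasure lebesgue (B i)) = emeasure lebesgue (\<Union>i. B i)"
  proof (rule suminf_emeasure)
    show "range B \<subseteq> sets lebesgue" by (auto simp: B_def lborelD)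
    show "disjoint_family B"
      using pw ID Dinj unfolding disjoint_family_on_def pairwise_def B_def inj_on_def
      by (smt (verit, best) Int_empty_left Int_empty_right)
  qed
  also have "emeasure lebesgue (\<Union>i. B i) \<le> emeasure lebesgue S"
    using KS ID interior_subset S(1) by (intro emeasure_mono) (auto simp: B_def lborelD split: if_splits, blast)
  finally show ?thesis
    by (simp add: c_def n_def mult_left_mono)
qed

lemma measure_lipschitz_image_le:
  fixes f :: "'a::euclidean_space \<Rightarrow> 'a"
  assumes S: "open S" "bounded S" and "0 \<le> L"
    and lip: "\<And>x y. x \<in> S \<Longrightarrow> y \<in> S \<Longrightarrow> norm (f x - f y) \<le> L * norm (x - y)"
  shows "measure lebesgue (f ` S) \<le> (2 * L * DIM('a)) ^ DIM('a) * measure lebesgue S"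
proof -
  have fin: "emeasure lebesgue S < \<infinity>"
    using emeasure_bounded_finite[OF S(2)] S(1) by simp
  have "measure lebesgue (f ` S) \<le> enn2real (ennreal ((2 * L * DIM('a)) ^ DIM('a)) * emeasure lebesgue S)"
    unfolding measure_def using emeasure_lipschitz_image_le[OF assms] fin
    by (intro enn2real_mono) (auto simp: ennreal_mult_less_top)
  also have "\<dots> = (2 * L * DIM('a)) ^ DIM('a) * measure lebesgue S"
    using \<open>0 \<le> L\<close> by (simp add: measure_def enn2real_mult)
  finally show ?thesis .
qed

subsection \<open>Exponential coordinates of a frame at a point\<close>

definition frame_comb :: "('p::finite \<Rightarrow> real^'p \<Rightarrow> real^'p) \<Rightarrow> real^'p \<Rightarrow> real^'p \<Rightarrow> real^'p" where
  "frame_comb Y y u = (\<Sum>k\<in>UNIV. u $ k *\<^sub>R Y k y)"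

lemma frame_comb_linear: "linear (frame_comb Y y)"
  by (rule linearI) (simp_all add: frame_comb_def scaleR_add_left sum.distrib scaleR_sum_right)

lemma frame_comb_axis: "frame_comb Y y (axis k 1) = Y k y"
  by (simp add: frame_comb_def axis_def if_distrib[of "\<lambda>z. z *\<^sub>R _"] cong: if_cong)

lemma sum_abs_component_le: "(\<Sum>k\<in>UNIV. \<bar>u $ k\<bar>) \<le> real CARD('p) * norm (u :: real^'p)"
  using sum_bounded_above[of UNIV "\<lambda>k. \<bar>u $ k\<bar>" "norm u"] component_le_norm_cart[of u] by simp

text \<open>The quantitative data of a frame near one point. The bounds mention the point only
  through \<rho> and \<open>L\<close>, which makes the resulting constants uniform. The difference
  in \<open>bracket\<close> is the value of \<open>lie_bracket (Y i) (Y j)\<close>; its coefficients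
  are chosen separately at each point, with no regularity.\<close>

locale frame_ball =
  fixes \<Omega> :: "(real^'p) set" and Y :: "'p \<Rightarrow> real^'p \<Rightarrow> real^'p" and w :: "'p \<Rightarrow> nat"
    and DY :: "'p \<Rightarrow> real^'p \<Rightarrow> real^'p \<Rightarrow> real^'p" and x :: "real^'p" and \<rho> L :: real
  assumes rho: "0 < \<rho>" and L1: "1 \<le> L" and sub: "cball x \<rho> \<subseteq> \<Omega>"
    and der: "\<And>k y. y \<in> cball x \<rho> \<Longrightarrow> (Y k has_derivative DY k y) (at y)"
    and M_up: "\<And>y u. y \<in> cball x \<rho> \<Longrightarrow> norm (frame_comb Y y u) \<le> L * norm u"
    and M_low: "\<And>y u. y \<in> cball x \<rho> \<Longrightarrow> norm u \<le> L * norm (frame_comb Y y u)"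
    and DY_bd: "\<And>k y v. y \<in> cball x \<rho> \<Longrightarrow> norm (DY k y v) \<le> L * norm v"
    and taylor: "\<And>k y z. y \<in> cball x \<rho> \<Longrightarrow> z \<in> cball x \<rho> \<Longrightarrow>
      norm (Y k z - Y k y - DY k y (z - y)) \<le> L * (norm (z - y))\<^sup>2"
    and bracket: "\<And>i j y. y \<in> cball x \<rho> \<Longrightarrow>
      \<exists>c. DY j y (Y i y) - DY i y (Y j y) = frame_comb Y y c \<and> (\<forall>k. w i + w j < w k \<longrightarrow> c $ k = 0)"
    and w1: "\<And>k. 1 \<le> w k"
begin

abbreviation M where "M \<equiv> frame_comb Y"

abbreviation U where "U \<equiv> cball x \<rho>"

definition P :: real where "P = real CARD('p)"

text \<open>The first bound keeps flows in the ball for unit time. The second makes the Lipschitz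
  constant \<open>P * L * \<epsilon>\<close> of the field at most 1/2 and the relative linearisation
  error of \<open>E\<close> at most \<open>1 / (2 * L)\<close>.\<close>

definition \<epsilon> :: real where "\<epsilon> = min (\<rho> / (2 * L)) (1 / (6 * P * L ^ 3))"

lemma P1: "1 \<le> P"
  by (simp add: P_def Suc_leI)

lemma eps_pos: "0 < \<epsilon>"
  using rho L1 P1 by (auto simp: \<epsilon>_def intro!: mult_pos_pos)

lemma eps_rho: "L * \<epsilon> \<le> \<rho> / 2"
proof -
  have "L * \<epsilon> \<le> L * (\<rho> / (2 * L))" using L1 by (intro mult_left_mono) (auto simp: \<epsilon>_def)
  then show ?thesis using L1 by simp
qed

lemma eps_L3: "3 * P * L\<^sup>2 * \<epsilon> \<le> 1 / (2 * L)"
proof -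
  have "3 * P * L\<^sup>2 * \<epsilon> \<le> 3 * P * L\<^sup>2 * (1 / (6 * P * L ^ 3))"
    using L1 P1 by (intro mult_left_mono) (auto simp: \<epsilon>_def)
  also have "\<dots> = 1 / (2 * L)" using L1 P1 by (simp add: field_simps power2_eq_square power3_eq_cube)
  finally show ?thesis .
qed

lemma eps_half: "P * L * \<epsilon> \<le> 1 / 2"
proof -
  have "P * L * \<epsilon> * 1 \<le> P * L * \<epsilon> * (3 * L)"
    using L1 P1 eps_pos by (intro mult_left_mono) auto
  also have "\<dots> = 3 * P * L\<^sup>2 * \<epsilon>" by (simp add: power2_eq_square)
  also have "\<dots> \<le> 1 / (2 * L)" by (rule eps_L3)
  also have "\<dots> \<le> 1 / 2" using L1 by (simp add: field_simps)
  finally show ?thesis by simp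
qed

lemma Y_bd: "y \<in> U \<Longrightarrow> norm (Y k y) \<le> L"
  using M_up[of y "axis k 1"] by (simp add: frame_comb_axis)

lemma Y_lip: "y \<in> U \<Longrightarrow> z \<in> U \<Longrightarrow> norm (Y k y - Y k z) \<le> L * norm (y - z)"
  using der DY_bd
  by (intro differentiable_bound[OF convex_cball[of x \<rho>], of "Y k" "DY k"])
     (auto intro: has_derivative_at_withinI onorm_le)

lemma norm_le_components:
  assumes "\<And>k. \<bar>v $ k\<bar> \<le> b"
  shows "norm (v :: real^'p) \<le> P * b"
proof -
  have "norm v \<le> (\<Sum>k\<in>UNIV. \<bar>v $ k\<bar>)" by (rule norm_le_l1_cart)
  also have "\<dots> \<le> (\<Sum>k\<in>(UNIV::'p set). b)" by (intro sum_mono assms)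
  finally show ?thesis by (simp add: P_def)
qed

lemma weighted_sum_le:
  assumes "\<And>k. norm (f k) \<le> b" and "0 \<le> b"
  shows "norm (\<Sum>k\<in>UNIV. (u::real^'p) $ k *\<^sub>R f k) \<le> P * norm u * b"
proof -
  have "norm (\<Sum>k\<in>UNIV. u $ k *\<^sub>R f k) \<le> (\<Sum>k\<in>UNIV. \<bar>u $ k\<bar> * b)"
    using assms by (intro order_trans[OF norm_sum] sum_mono) (simp add: mult_left_mono)
  also have "\<dots> \<le> P * norm u * b"
    using sum_abs_component_le[of u] assms by (simp add: P_def sum_distrib_right[symmetric] mult_right_mono)
  finally show ?thesis .
qed

lemma M_lip:
  assumes "y \<in> U" "z \<in> U"
  shows "norm (M y u - M z u) \<le> P * L * norm u * norm (y - z)"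
proof -
  have "M y u - M z u = (\<Sum>k\<in>UNIV. u $ k *\<^sub>R (Y k y - Y k z))"
    by (simp add: frame_comb_def sum_subtractf scaleR_diff_right)
  also have "norm \<dots> \<le> P * norm u * (L * norm (y - z))"
    using Y_lip[OF assms] L1 by (intro weighted_sum_le) auto
  finally show ?thesis by (simp add: mult_ac)
qed

lemma M_lip_eps:
  assumes "y \<in> U" "z \<in> U" "norm u \<le> \<epsilon>"
  shows "norm (M y u - M z u) \<le> norm (y - z) / 2"
proof -
  have "P * L * norm u * norm (y - z) \<le> P * L * \<epsilon> * norm (y - z)"
    using assms P1 L1 by (intro mult_right_mono mult_left_mono) auto
  also have "\<dots> \<le> 1 / 2 * norm (y - z)" using eps_half by (intro mult_right_mono) auto
  finally show ?thesis using M_lip[OF assms(1,2), of u] by simp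
qed

lemma M_diff: "M y (u - v) = M y u - M y v"
  using linear_diff[OF frame_comb_linear] by blast

lemma M_bij: "y \<in> U \<Longrightarrow> bij (M y)"
proof -
  assume y: "y \<in> U"
  have "inj (M y)"
  proof (subst linear_injective_0[OF frame_comb_linear], intro allI impI)
    show "u = 0" if "M y u = 0" for u using M_low[OF y, of u] that by simp
  qed
  then show "bij (M y)"
    using linear_injective_imp_surjective[OF frame_comb_linear] by (auto simp: bij_def)
qed

definition N where "N y = inv (M y)"

lemma M_N: "y \<in> U \<Longrightarrow> M y (N y z) = z"
  unfolding N_def by (meson M_bij bij_inv_eq_iff)

lemma N_M: "y \<in> U \<Longrightarrow> N y (M y z) = z"
  unfolding N_def by (simp add: M_bij bij_is_inj)

lemma N_bd: "y \<in> U \<Longrightarrow> norm (N y z) \<le> L * norm z"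
  using M_low[of y "N y z"] by (simp add: M_N)

lemma N_linear: "y \<in> U \<Longrightarrow> linear (N y)"
  unfolding N_def by (rule inj_linear_imp_inv_linear[OF frame_comb_linear]) (simp add: M_bij bij_is_inj)

lemma exists_flow:
  assumes u: "norm u \<le> \<epsilon>"
  shows "\<exists>\<phi>. \<phi> 0 = x \<and> (\<forall>t\<in>{0..1}. \<phi> t \<in> U \<and>
    (\<phi> has_vector_derivative M (\<phi> t) u) (at t within {0..1}))"
proof -
  have "norm (M y u) \<le> \<rho>" if "y \<in> U" for y
  proof -
    have "norm (M y u) \<le> L * \<epsilon>" using M_up[OF that, of u] u L1 by (meson mult_left_mono order_trans zero_le_one)
    then show ?thesis using eps_rho rho by simp
  qed
  then obtain \<phi> where "\<phi> 0 = x" "\<And>t. t \<in> {0..1} \<Longrightarrow> \<phi> t \<in> U"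
    "\<And>t. t \<in> {0..1} \<Longrightarrow> (\<phi> has_vector_derivative M (\<phi> t) u) (at t within {0..1})"
    using picard_unit_interval[of \<rho> x "\<lambda>y. M y u"] M_lip_eps u rho by (metis less_eq_real_def)
  then show ?thesis by blast
qed

definition flow where
  "flow u = (SOME \<phi>. \<phi> 0 = x \<and> (\<forall>t\<in>{0..1}. \<phi> t \<in> U \<and>
    (\<phi> has_vector_derivative M (\<phi> t) u) (at t within {0..1})))"

lemma flow:
  assumes u: "norm u \<le> \<epsilon>"
  shows flow_0: "flow u 0 = x"
    and flow_in: "t \<in> {0..1} \<Longrightarrow> flow u t \<in> U"
    and flow_deriv: "t \<in> {0..1} \<Longrightarrow> (flow u has_vector_derivative M (flow u t) u) (at t within {0..1})"
  using someI_ex[OF exists_flow[OF u]] unfolding flow_def[symmetric] by auto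

definition E where "E u = flow u 1"

lemma flow_speed: "norm u \<le> \<epsilon> \<Longrightarrow> t \<in> {0..1} \<Longrightarrow> norm (M (flow u t) u) \<le> L * norm u"
  using M_up flow_in by blast

lemma flow_dist:
  assumes "norm u \<le> \<epsilon>" "s \<in> {0..1}" "t \<in> {0..1}"
  shows "norm (flow u s - flow u t) \<le> L * norm u * \<bar>s - t\<bar>"
  by (rule norm_diff_le_derivative_bound) (use assms flow_deriv flow_speed in auto)

lemma flow_dist0:
  assumes "norm u \<le> \<epsilon>" "t \<in> {0..1}"
  shows "norm (flow u t - x) \<le> L * norm u"
proof -
  have "norm (flow u t - x) \<le> L * norm u * \<bar>t\<bar>" using flow_dist[OF assms, of 0] flow_0[OF assms(1)] by simp
  also have "\<dots> \<le> L * norm u * 1" using assms L1 by (intro mult_left_mono) auto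
  finally show ?thesis by simp
qed

lemma flow_diff_deriv:
  assumes "norm u \<le> \<epsilon>" "norm v \<le> \<epsilon>" "t \<in> {0..1}"
  shows "((\<lambda>t. flow v t - flow u t) has_vector_derivative M (flow v t) v - M (flow u t) u) (at t within {0..1})"
  using assms flow_deriv by (intro has_vector_derivative_diff) auto

lemma flow_diff:
  assumes u: "norm u \<le> \<epsilon>" "norm v \<le> \<epsilon>" and t: "t \<in> {0..1}"
  shows "norm (flow v t - flow u t) \<le> 2 * L * norm (v - u)"
proof -
  have "norm (flow v t - flow u t) \<le> 2 * (L * norm (v - u))"
  proof (rule small_gronwall[OF flow_diff_deriv[OF u] _ _ t])
    fix t :: real assume t: "t \<in> {0..1}"
    have "M (flow v t) v - M (flow u t) u = (M (flow v t) v - M (flow u t) v) + M (flow u t) (v - u)"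
      by (simp add: M_diff)
    then have "norm (M (flow v t) v - M (flow u t) u) \<le> norm (M (flow v t) v - M (flow u t) v) + norm (M (flow u t) (v - u))"
      using norm_triangle_ineq by metis
    also have "\<dots> \<le> norm (flow v t - flow u t) / 2 + L * norm (v - u)"
      using u t by (intro add_mono M_lip_eps M_up flow_in)
    finally show "norm (M (flow v t) v - M (flow u t) u) \<le> norm (flow v t - flow u t) / 2 + L * norm (v - u)" .
  qed (use flow_0 u in auto)
  then show ?thesis by simp
qed

lemma E_lipschitz: "norm u \<le> \<epsilon> \<Longrightarrow> norm v \<le> \<epsilon> \<Longrightarrow> norm (E v - E u) \<le> 2 * L * norm (v - u)"
  unfolding E_def by (rule flow_diff) auto

text \<open>Comparison with the frame frozen at \<open>x\<close>. Of the factor 3 in the derivative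
  bound, two units come from the distance between the two flows and one from the distance of the
  flow of \<open>u\<close> to \<open>x\<close>.\<close>

lemma E_almost_linear:
  assumes u: "norm u \<le> \<epsilon>" and v: "norm v \<le> \<epsilon>"
  shows "norm (E v - E u - M x (v - u)) \<le> norm (v - u) / (2 * L)"
proof -
  define g where "g = (\<lambda>t. flow v t - flow u t - t *\<^sub>R M x (v - u))"
  have g: "(g has_vector_derivative M (flow v t) v - M (flow u t) u - M x (v - u)) (at t within {0..1})"
    if "t \<in> {0..1}" for t
    unfolding g_def by (rule derivative_eq_intros flow_diff_deriv u v that refl | simp)+
  have "norm (M (flow v t) v - M (flow u t) u - M x (v - u)) \<le> 3 * P * L\<^sup>2 * \<epsilon> * norm (v - u)"
    if t: "t \<in> {0..1}" for t
  proof -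
    have xin: "x \<in> U" using rho by simp
    have "norm (M (flow v t) v - M (flow u t) v) \<le> P * L * norm v * norm (flow v t - flow u t)"
      using u v t by (intro M_lip flow_in)
    also have "\<dots> \<le> P * L * \<epsilon> * (2 * L * norm (v - u))"
      using u v t P1 L1 eps_pos by (intro mult_mono flow_diff mult_nonneg_nonneg) auto
    finally have 1: "norm (M (flow v t) v - M (flow u t) v) \<le> P * L * \<epsilon> * (2 * L * norm (v - u))" .
    have "norm (M (flow u t) (v - u) - M x (v - u)) \<le> P * L * norm (v - u) * norm (flow u t - x)"
      using u v t xin by (intro M_lip flow_in)
    also have "\<dots> \<le> P * L * norm (v - u) * (L * \<epsilon>)"
      using flow_dist0[OF u t] u L1 P1 by (intro mult_left_mono) (auto intro: order_trans mult_left_mono)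
    finally have 2: "norm (M (flow u t) (v - u) - M x (v - u)) \<le> P * L * norm (v - u) * (L * \<epsilon>)" .
    have "M (flow v t) v - M (flow u t) u - M x (v - u) =
        (M (flow v t) v - M (flow u t) v) + (M (flow u t) (v - u) - M x (v - u))"
      by (simp add: M_diff)
    then have "norm (M (flow v t) v - M (flow u t) u - M x (v - u)) \<le>
        norm (M (flow v t) v - M (flow u t) v) + norm (M (flow u t) (v - u) - M x (v - u))"
      using norm_triangle_ineq by metis
    with 1 2 show ?thesis by (simp add: power2_eq_square mult_ac)
  qed
  then have "norm (g 1 - g 0) \<le> 3 * P * L\<^sup>2 * \<epsilon> * norm (v - u) * \<bar>1 - 0\<bar>"
    by (intro norm_diff_le_derivative_bound[OF g]) auto
  then have "norm (E v - E u - M x (v - u)) \<le> 3 * P * L\<^sup>2 * \<epsilon> * norm (v - u)"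
    using flow_0 u v by (simp add: g_def E_def)
  also have "\<dots> \<le> 1 / (2 * L) * norm (v - u)" using eps_L3 by (intro mult_right_mono) auto
  finally show ?thesis by simp
qed

lemma E_expanding:
  assumes u: "norm u \<le> \<epsilon>" and v: "norm v \<le> \<epsilon>"
  shows "norm (v - u) \<le> 2 * L * norm (E v - E u)"
proof -
  have "norm (v - u) \<le> L * norm (M x (v - u))" using rho by (intro M_low) auto
  also have "norm (M x (v - u)) \<le> norm (E v - E u) + norm (E v - E u - M x (v - u))"
    using norm_triangle_ineq4[of "E v - E u" "E v - E u - M x (v - u)"] by simp
  also have "L * (norm (E v - E u) + norm (E v - E u - M x (v - u))) \<le> L * (norm (E v - E u) + norm (v - u) / (2 * L))"
    using E_almost_linear[OF u v] L1 by (intro mult_left_mono) auto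
  also have "\<dots> = L * norm (E v - E u) + norm (v - u) / 2" using L1 by (simp add: field_simps)
  finally show ?thesis using L1 by simp
qed

lemma E_0: "E 0 = x"
proof -
  have "norm (0::real^'p) \<le> \<epsilon>" using eps_pos by simp
  from flow_dist0[OF this, of 1] show ?thesis by (simp add: E_def)
qed

text \<open>Newton iteration with the frame frozen at \<open>x\<close>: by
  \<open>E_almost_linear\<close> the map \<open>T\<close> contracts by 1/2, and \<open>y\<close> is
  so close to \<open>x\<close> that \<open>T 0\<close> lies in half of the ball.\<close>

lemma E_surj:
  assumes y: "norm (y - x) \<le> \<epsilon> / (2 * L)"
  obtains u where "norm u \<le> \<epsilon>" "E u = y"
proof -
  define T where "T = (\<lambda>u. u - N x (E u - y))"
  have x: "x \<in> U" using rho by simp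
  have Nd: "N x (a - b) = N x a - N x b" for a b using linear_diff[OF N_linear[OF x]] .
  have Teq: "T v - T u = - N x (E v - E u - M x (v - u))" for u v
    unfolding T_def Nd M_diff[symmetric] N_M[OF x] by simp
  have Tc: "norm (T v - T u) \<le> norm (v - u) / 2" if "norm u \<le> \<epsilon>" "norm v \<le> \<epsilon>" for u v
  proof -
    have "norm (T v - T u) \<le> L * norm (E v - E u - M x (v - u))"
      unfolding Teq using N_bd[OF x] by simp
    also have "\<dots> \<le> L * (norm (v - u) / (2 * L))"
      using E_almost_linear[OF that] L1 by (intro mult_left_mono) auto
    finally show ?thesis using L1 by simp
  qed
  have "\<exists>!u. u \<in> cball 0 \<epsilon> \<and> T u = u"
  proof (rule Banach_fix[of _ "1/2"])
    show "complete (cball 0 \<epsilon> :: (real^'p) set)" by (simp add: complete_eq_closed)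
    show "cball 0 \<epsilon> \<noteq> ({} :: (real^'p) set)" using eps_pos by simp
    show "T ` cball 0 \<epsilon> \<subseteq> cball 0 \<epsilon>"
    proof clarsimp
      fix u :: "real^'p" assume u: "norm u \<le> \<epsilon>"
      have "norm (T 0) \<le> L * norm (x - y)" unfolding T_def E_0 using N_bd[OF x] by simp
      also have "\<dots> \<le> L * (\<epsilon> / (2 * L))" using y L1 by (intro mult_left_mono) (auto simp: norm_minus_commute)
      finally have "norm (T 0) \<le> \<epsilon> / 2" using L1 by simp
      moreover have "norm (T u - T 0) \<le> norm u / 2" using Tc[of 0 u] u eps_pos by simp
      ultimately show "norm (T u) \<le> \<epsilon>" using u norm_triangle_sub[of "T u" "T 0"] by simp
    qed
    show "dist (T u) (T v) \<le> 1 / 2 * dist u v" if "u \<in> cball 0 \<epsilon>" "v \<in> cball 0 \<epsilon>" for u v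
      using Tc[of v u] that by (simp add: dist_norm)
  qed auto
  then obtain u where u: "norm u \<le> \<epsilon>" "T u = u" by auto
  from u(2) have "N x (E u - y) = 0" by (simp add: T_def)
  then have "E u - y = 0" using M_N[OF x, of "E u - y"] linear_0[OF frame_comb_linear] by metis
  with u(1) show ?thesis using that by simp
qed

text \<open>The description ranges over all integral curves in \<Omega>, while the estimates hold
  only in the ball. A first-exit argument confines each such curve to the ball; then Gronwall with
  zero error gives uniqueness.\<close>

lemma field_exp_eq_E:
  assumes u: "norm u \<le> \<epsilon>"
  shows "field_exp \<Omega> (\<lambda>y. M y u) x = E u"
  unfolding field_exp_def
proof (rule the_equality)
  show "\<exists>\<phi>. integral_curve \<Omega> (\<lambda>y. M y u) x \<phi> \<and> E u = \<phi> 1"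
    using flow[OF u] sub unfolding integral_curve_def E_def by (intro exI[of _ "flow u"]) auto
  fix y assume "\<exists>\<phi>. integral_curve \<Omega> (\<lambda>y. M y u) x \<phi> \<and> y = \<phi> 1"
  then obtain \<psi> where \<psi>0: "\<psi> 0 = x" and y: "y = \<psi> 1"
    and \<psi>: "\<And>t. t \<in> {0..1} \<Longrightarrow> (\<psi> has_vector_derivative M (\<psi> t) u) (at t within {0..1})"
    unfolding integral_curve_def by blast
  have cont: "continuous_on {0..1} \<psi>"
    using \<psi> by (meson continuous_on_eq_continuous_within has_vector_derivative_continuous)
  have stay: "norm (\<psi> t - x) < \<rho>" if "0 \<le> t" "t \<le> 1" for t
  proof (rule continuous_first_exit[of "{()}" "\<lambda>_ t. norm (\<psi> t - x)" "\<lambda>_. \<rho>" t "()"])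
    show "continuous_on {0..1} (\<lambda>t. norm (\<psi> t - x))" for i :: unit by (intro continuous_intros cont)
    fix T assume T: "0 \<le> T" "T \<le> 1" and b: "\<And>t i. 0 \<le> t \<Longrightarrow> t < T \<Longrightarrow> i \<in> {()} \<Longrightarrow> norm (\<psi> t - x) < \<rho>"
    have "norm (\<psi> T - \<psi> 0) \<le> L * \<epsilon> * T"
    proof (cases "T = 0")
      case False
      have "norm (\<psi> T - \<psi> 0) \<le> L * \<epsilon> * T - L * \<epsilon> * 0"
      proof (rule differentiable_bound_general[of 0 T \<psi> "\<lambda>t. L * \<epsilon> * t" "\<lambda>t. M (\<psi> t) u" "\<lambda>t. L * \<epsilon>"])
        show "continuous_on {0..T} \<psi>" using cont T by (auto intro: continuous_on_subset)
        fix t assume t: "0 < t" "t < T"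
        have "at t within {0..1} = at t" using t T by (simp add: at_within_Icc_at)
        then show "(\<psi> has_vector_derivative M (\<psi> t) u) (at t)" using \<psi>[of t] t T by simp
        have "\<psi> t \<in> U" using b[of t] t by (simp add: dist_norm norm_minus_commute)
        then have "norm (M (\<psi> t) u) \<le> L * norm u" by (rule M_up)
        also have "\<dots> \<le> L * \<epsilon>" using u L1 by (intro mult_left_mono) auto
        finally show "norm (M (\<psi> t) u) \<le> L * \<epsilon>" .
      qed (use False T in \<open>auto intro!: continuous_intros derivative_eq_intros\<close>)
      then show ?thesis by simp
    qed simp
    also have "\<dots> \<le> L * \<epsilon> * 1" using T L1 eps_pos by (intro mult_left_mono) auto
    also have "\<dots> < \<rho>" using eps_rho rho by simp
    finally show "\<forall>i\<in>{()}. norm (\<psi> T - x) < \<rho>" using \<psi>0 by simp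
  qed (use that in auto)
  have "norm (\<psi> 1 - flow u 1) \<le> 2 * 0"
  proof (rule small_gronwall[where D = "\<lambda>t. \<psi> t - flow u t" and D' = "\<lambda>t. M (\<psi> t) u - M (flow u t) u"])
    fix t :: real assume t: "t \<in> {0..1}"
    show "((\<lambda>t. \<psi> t - flow u t) has_vector_derivative M (\<psi> t) u - M (flow u t) u) (at t within {0..1})"
      using \<psi> flow_deriv[OF u] t by (intro has_vector_derivative_diff)
    have "\<psi> t \<in> U" using stay[of t] t by (simp add: dist_norm norm_minus_commute)
    then show "norm (M (\<psi> t) u - M (flow u t) u) \<le> norm (\<psi> t - flow u t) / 2 + 0"
      using M_lip_eps flow_in[OF u t] u by simp
  qed (use \<psi>0 flow_0[OF u] in auto)
  then show "y = E u" by (simp add: y E_def)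
qed

end

section \<open>The difference of two flows in the moving frame, and the scaled norm\<close>

context frame_ball
begin

text \<open>The resolvent identity: inverses differ by inverse times difference times
  inverse.\<close>

lemma N_lip:
  assumes y: "y \<in> U" and z: "z \<in> U"
  shows "norm (N y v - N z v) \<le> P * L ^ 3 * norm v * norm (y - z)"
proof -
  have "N y v - N z v = N y (M z (N z v) - M y (N z v))"
    using linear_diff[OF N_linear[OF y]] M_N[OF z] N_M[OF y] by metis
  then have "norm (N y v - N z v) \<le> L * norm (M z (N z v) - M y (N z v))"
    using N_bd[OF y] by simp
  also have "\<dots> \<le> L * (P * L * norm (N z v) * norm (z - y))"
    using M_lip[OF z y] L1 by (intro mult_left_mono) auto
  also have "\<dots> \<le> L * (P * L * (L * norm v) * norm (z - y))"
    using N_bd[OF z, of v] L1 P1 by (intro mult_left_mono mult_right_mono) auto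
  finally show ?thesis by (simp add: power3_eq_cube mult_ac norm_minus_commute)
qed

text \<open>Since \<open>g\<close> vanishes at \<open>t\<close>, only the continuity of the inverse frame is needed.\<close>

lemma N_comp_deriv:
  assumes t: "t \<in> S" and \<gamma>: "\<And>s. s \<in> S \<Longrightarrow> \<gamma> s \<in> U" and cont: "continuous (at t within S) \<gamma>"
    and g: "(g has_vector_derivative g') (at t within S)" and g0: "g t = 0"
  shows "((\<lambda>s. N (\<gamma> s) (g s)) has_vector_derivative N (\<gamma> t) g') (at t within S)"
  unfolding has_vector_derivative_def has_derivative_within_alt
proof (intro conjI allI impI)
  show "bounded_linear (\<lambda>h. h *\<^sub>R N (\<gamma> t) g')" by (rule bounded_linear_scaleR_left)
  fix e :: real assume e: "e > 0"
  define C where "C = P * L ^ 3 * norm g' + 1"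
  have C: "C > 0" using P1 L1 by (auto simp: C_def intro!: add_nonneg_pos)
  have "e / (2 * L) > 0" using e L1 by simp
  then obtain d1 where d1: "d1 > 0"
    "\<And>s. s \<in> S \<Longrightarrow> norm (s - t) < d1 \<Longrightarrow> norm (g s - g t - (s - t) *\<^sub>R g') \<le> e / (2 * L) * norm (s - t)"
    using g unfolding has_vector_derivative_def has_derivative_within_alt by meson
  have "e / (2 * C) > 0" using e C by simp
  then obtain d2 where d2: "d2 > 0" "\<And>s. s \<in> S \<Longrightarrow> norm (s - t) < d2 \<Longrightarrow> norm (\<gamma> s - \<gamma> t) < e / (2 * C)"
    using cont unfolding continuous_within_eps_delta dist_norm by meson
  show "\<exists>d>0. \<forall>s\<in>S. norm (s - t) < d \<longrightarrow>
      norm (N (\<gamma> s) (g s) - N (\<gamma> t) (g t) - (s - t) *\<^sub>R N (\<gamma> t) g') \<le> e * norm (s - t)"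
  proof (intro exI[of _ "min d1 d2"] conjI ballI impI)
    fix s assume s: "s \<in> S" "norm (s - t) < min d1 d2"
    note lin = N_linear[OF \<gamma>[OF s(1)]]
    have N0: "N (\<gamma> t) (g t) = 0" unfolding g0 by (rule linear_0[OF N_linear[OF \<gamma>[OF t]]])
    have "N (\<gamma> s) (g s) - N (\<gamma> t) (g t) - (s - t) *\<^sub>R N (\<gamma> t) g' =
        N (\<gamma> s) (g s - g t - (s - t) *\<^sub>R g') + (s - t) *\<^sub>R (N (\<gamma> s) g' - N (\<gamma> t) g')"
      using N0 by (simp add: g0 linear_diff[OF lin] linear_cmul[OF lin] linear_0[OF lin] scaleR_diff_right)
    also have "norm \<dots> \<le> norm (N (\<gamma> s) (g s - g t - (s - t) *\<^sub>R g')) + norm ((s - t) *\<^sub>R (N (\<gamma> s) g' - N (\<gamma> t) g'))"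
      by (rule norm_triangle_ineq)
    also have "\<dots> \<le> L * (e / (2 * L) * norm (s - t)) + norm (s - t) * (C * (e / (2 * C)))"
    proof (rule add_mono)
      show "norm (N (\<gamma> s) (g s - g t - (s - t) *\<^sub>R g')) \<le> L * (e / (2 * L) * norm (s - t))"
        using N_bd[OF \<gamma>[OF s(1)]] d1(2)[OF s(1)] s(2) L1 by (meson mult_left_mono order_trans zero_le_one min_less_iff_conj)
      have "norm (N (\<gamma> s) g' - N (\<gamma> t) g') \<le> P * L ^ 3 * norm g' * norm (\<gamma> s - \<gamma> t)"
        using s t by (intro N_lip \<gamma>)
      also have "\<dots> \<le> C * (e / (2 * C))"
        using d2(2)[OF s(1)] s(2) P1 L1 by (intro mult_mono) (auto simp: C_def)
      finally show "norm ((s - t) *\<^sub>R (N (\<gamma> s) g' - N (\<gamma> t) g')) \<le> norm (s - t) * (C * (e / (2 * C)))"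
        by (simp add: mult_left_mono)
    qed
    also have "\<dots> = e * norm (s - t)" using L1 C by (simp add: field_simps)
    finally show "norm (N (\<gamma> s) (g s) - N (\<gamma> t) (g t) - (s - t) *\<^sub>R N (\<gamma> t) g') \<le> e * norm (s - t)" .
  qed (use d1 d2 in auto)
qed

text \<open>The bound collects two Jacobian terms of size \<open>L * L\<close> and the factor
  \<open>L\<close> of the inverse frame.\<close>

lemma bracket_coeffs:
  assumes y: "y \<in> U"
  obtains c where "\<And>i j. DY j y (Y i y) - DY i y (Y j y) = M y (c i j)"
    "\<And>i j k. w i + w j < w k \<Longrightarrow> c i j $ k = 0" "\<And>i j. norm (c i j) \<le> 2 * L ^ 3"
proof -
  obtain c where c: "\<And>i j. DY j y (Y i y) - DY i y (Y j y) = M y (c i j)"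
    "\<And>i j k. w i + w j < w k \<Longrightarrow> c i j $ k = 0"
  proof
    let ?P = "\<lambda>i j c. DY j y (Y i y) - DY i y (Y j y) = M y c \<and> (\<forall>k. w i + w j < w k \<longrightarrow> c $ k = 0)"
    have P: "?P i j (SOME c. ?P i j c)" for i j by (rule someI_ex[OF bracket[OF y]])
    show "DY j y (Y i y) - DY i y (Y j y) = M y (SOME c. ?P i j c)" for i j using P[of j i] by blast
    show "(SOME c. ?P i j c) $ k = 0" if "w i + w j < w k" for i j k using P[of j i] that by blast
  qed
  have "norm (c i j) \<le> 2 * L ^ 3" for i j
  proof -
    have LL: "norm (DY j y (Y i y)) \<le> L * L" for i j
      using DY_bd[OF y, of j "Y i y"] Y_bd[OF y, of i] L1 by (meson mult_left_mono order_trans zero_le_one)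
    have "norm (c i j) \<le> L * norm (M y (c i j))" by (rule M_low[OF y])
    also have "norm (M y (c i j)) \<le> L * L + L * L"
      unfolding c(1)[symmetric] by (rule order_trans[OF norm_triangle_ineq4 add_mono[OF LL LL]])
    finally show ?thesis using L1 by (simp add: power3_eq_cube)
  qed
  with c show ?thesis using that by blast
qed

text \<open>The outer \<open>L\<close> is the inverse frame. Inside are the second-order Taylor
  error along \<open>v\<close> and the product of \<open>v - u\<close> with the difference of the
  flows, which is at most \<open>2 * L * norm (v - u)\<close>.\<close>

definition K0 where "K0 = L * (P * \<epsilon> * (L * (2 * L)\<^sup>2) + P * (L * (2 * L)))"

lemma K0_nonneg: "0 \<le> K0"
  using L1 P1 eps_pos by (simp add: K0_def)

text \<open>The linearised equation. Differentiating the difference of the flows gives the Jacobians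
  of the fields in direction \<open>D\<close>, weighted by \<open>u\<close>; the motion of the frame
  gives the Jacobians in direction \<open>M y u\<close>, weighted by \<open>V t\<close>. Together
  they are the brackets with coefficients \<open>u $ j * V t $ k\<close>, and everything else is
  quadratic in \<open>v - u\<close>.\<close>

lemma flow_coord_deriv:
  assumes u: "norm u \<le> \<epsilon>" and v: "norm v \<le> \<epsilon>" and t: "t \<in> {0..1}"
  defines "V \<equiv> \<lambda>s. N (flow u s) (flow v s - flow u s)"
  obtains c q where
    "(V has_vector_derivative (v - u) + (\<Sum>j\<in>UNIV. \<Sum>k\<in>UNIV. (u $ j * V t $ k) *\<^sub>R c k j) + q) (at t within {0..1})"
    "\<And>i j k. w i + w j < w k \<Longrightarrow> c i j $ k = 0" "\<And>i j. norm (c i j) \<le> 2 * L ^ 3"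
    "norm q \<le> K0 * (norm (v - u))\<^sup>2"
proof -
  define y where "y = flow u t"
  define D where "D = flow v t - y"
  define h where "h = v - u"
  have y: "y \<in> U" and yD: "y + D \<in> U"
    using flow_in[OF u t] flow_in[OF v t] by (auto simp: y_def D_def)
  have VD: "M y (V t) = D" unfolding V_def y_def[symmetric] D_def by (rule M_N[OF y])
  have Dle: "norm D \<le> 2 * L * norm h" unfolding D_def y_def h_def by (rule flow_diff[OF u v t])
  obtain c where c: "\<And>i j. DY j y (Y i y) - DY i y (Y j y) = M y (c i j)"
    "\<And>i j k. w i + w j < w k \<Longrightarrow> c i j $ k = 0" "\<And>i j. norm (c i j) \<le> 2 * L ^ 3"
    using bracket_coeffs[OF y] by blast
  have linDY: "linear (DY k y)" for k using der[OF y] has_derivative_linear by blast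
  \<comment> \<open>The first sum is the Taylor remainder; the second is the cost of replacing
    \<open>v\<close> by \<open>u\<close> in the first-order term.\<close>
  define rem where "rem = (\<Sum>j\<in>UNIV. v $ j *\<^sub>R (Y j (y + D) - Y j y - DY j y D)) + (\<Sum>j\<in>UNIV. h $ j *\<^sub>R DY j y D)"
  \<comment> \<open>With the coordinates frozen at time \<open>t\<close>, \<open>n\<close> vanishes
    at \<open>t\<close> and \<open>V s = V t + N (flow u s) (n s)\<close>. The derivative of
    \<open>V\<close> at \<open>t\<close> is then found without differentiating the inverse
    frame.\<close>
  define n where "n = (\<lambda>s. (flow v s - flow u s) - M (flow u s) (V t))"
  define n' where "n' = (M (y + D) v - M y u) - (\<Sum>k\<in>UNIV. V t $ k *\<^sub>R DY k y (M y u))"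
  have Yflow: "((\<lambda>s. Y k (flow u s)) has_vector_derivative DY k y (M y u)) (at t within {0..1})" for k
  proof -
    have "(Y k has_derivative DY k y) (at (flow u t) within flow u ` {0..1})"
      using der[OF y] by (auto simp: y_def intro: has_derivative_at_withinI)
    from vector_derivative_diff_chain_within[OF flow_deriv[OF u t] this]
    show ?thesis by (simp add: o_def y_def)
  qed
  have n: "(n has_vector_derivative n') (at t within {0..1})"
    unfolding n_def n'_def frame_comb_def[of Y "flow u _" "V t"]
  proof (intro has_vector_derivative_diff has_vector_derivative_sum)
    show "(flow v has_vector_derivative M (y + D) v) (at t within {0..1})"
      using flow_deriv[OF v t] by (simp add: D_def)
    show "(flow u has_vector_derivative M y u) (at t within {0..1})"
      using flow_deriv[OF u t] by (simp add: y_def)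
    show "((\<lambda>s. V t $ k *\<^sub>R Y k (flow u s)) has_vector_derivative V t $ k *\<^sub>R DY k y (M y u)) (at t within {0..1})" for k
      using Yflow[of k] by (auto intro!: derivative_eq_intros)
  qed
  have n0: "n t = 0" using VD by (simp add: n_def y_def D_def)
  have "((\<lambda>s. N (flow u s) (n s)) has_vector_derivative N (flow u t) n') (at t within {0..1})"
    using flow_in[OF u] flow_deriv[OF u t] t n n0
    by (intro N_comp_deriv) (auto intro: has_vector_derivative_continuous)
  then have VN: "((\<lambda>s. V t + N (flow u s) (n s)) has_vector_derivative N y n') (at t within {0..1})"
    by (auto simp: y_def intro!: derivative_eq_intros)
  have V': "(V has_vector_derivative N y n') (at t within {0..1})"
  proof (rule has_vector_derivative_transform[OF t _ VN])
    fix s :: real assume "s \<in> {0..1}"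
    note in_ball = flow_in[OF u this]
    show "V s = V t + N (flow u s) (n s)"
      unfolding n_def V_def linear_diff[OF N_linear[OF in_ball]] N_M[OF in_ball] by simp
  qed
  have DYD: "DY j y D = (\<Sum>k\<in>UNIV. V t $ k *\<^sub>R DY j y (Y k y))" for j
    unfolding VD[symmetric] frame_comb_def by (simp add: linear_sum[OF linDY] linear_cmul[OF linDY])
  have DYu: "DY k y (M y u) = (\<Sum>j\<in>UNIV. u $ j *\<^sub>R DY k y (Y j y))" for k
    unfolding frame_comb_def by (simp add: linear_sum[OF linDY] linear_cmul[OF linDY])
  define Q where "Q = (\<Sum>j\<in>UNIV. \<Sum>k\<in>UNIV. (u $ j * V t $ k) *\<^sub>R c k j)"
  have "M y Q = (\<Sum>j\<in>UNIV. \<Sum>k\<in>UNIV. (u $ j * V t $ k) *\<^sub>R (DY j y (Y k y) - DY k y (Y j y)))"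
    unfolding Q_def by (simp add: linear_sum[OF frame_comb_linear] linear_cmul[OF frame_comb_linear] c(1))
  also have "\<dots> = (\<Sum>j\<in>UNIV. u $ j *\<^sub>R DY j y D) - (\<Sum>k\<in>UNIV. V t $ k *\<^sub>R DY k y (M y u))"
  proof -
    have 1: "(\<Sum>j\<in>UNIV. u $ j *\<^sub>R DY j y D) = (\<Sum>j\<in>UNIV. \<Sum>k\<in>UNIV. (u $ j * V t $ k) *\<^sub>R DY j y (Y k y))"
      unfolding DYD scaleR_sum_right by simp
    have 2: "(\<Sum>k\<in>UNIV. V t $ k *\<^sub>R DY k y (M y u)) = (\<Sum>j\<in>UNIV. \<Sum>k\<in>UNIV. (u $ j * V t $ k) *\<^sub>R DY k y (Y j y))"
      unfolding DYu scaleR_sum_right by (subst sum.swap) (simp add: mult.commute)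
    show ?thesis unfolding 1 2 by (simp add: scaleR_diff_right sum_subtractf)
  qed
  finally have MQ: "M y Q = (\<Sum>j\<in>UNIV. u $ j *\<^sub>R DY j y D) - (\<Sum>k\<in>UNIV. V t $ k *\<^sub>R DY k y (M y u))" .
  have "M (y + D) v - M y u = M y h + (\<Sum>j\<in>UNIV. u $ j *\<^sub>R DY j y D) + rem"
    unfolding rem_def frame_comb_def h_def
    by (simp add: scaleR_diff_right scaleR_diff_left sum_subtractf sum.distrib algebra_simps)
  then have "n' = M y (h + Q) + rem"
    unfolding n'_def linear_add[OF frame_comb_linear] MQ by simp
  then have Nn': "N y n' = h + Q + N y rem"
    by (simp only: N_M[OF y] linear_add[OF N_linear[OF y]])
  have "norm rem \<le> P * norm v * (L * (norm D)\<^sup>2) + P * norm h * (L * norm D)"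
    unfolding rem_def
  proof (rule order_trans[OF norm_triangle_ineq add_mono])
    show "norm (\<Sum>j\<in>UNIV. v $ j *\<^sub>R (Y j (y + D) - Y j y - DY j y D)) \<le> P * norm v * (L * (norm D)\<^sup>2)"
      using taylor[OF y yD] L1 by (intro weighted_sum_le) auto
    show "norm (\<Sum>j\<in>UNIV. h $ j *\<^sub>R DY j y D) \<le> P * norm h * (L * norm D)"
      using DY_bd[OF y] L1 by (intro weighted_sum_le) auto
  qed
  also have "\<dots> \<le> P * \<epsilon> * (L * (2 * L * norm h)\<^sup>2) + P * norm h * (L * (2 * L * norm h))"
    using Dle v P1 L1 eps_pos by (intro add_mono mult_mono power_mono) auto
  also have "\<dots> = (P * \<epsilon> * (L * (2 * L)\<^sup>2) + P * (L * (2 * L))) * (norm h)\<^sup>2"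
    by (simp add: power2_eq_square algebra_simps)
  finally have "norm rem \<le> (P * \<epsilon> * (L * (2 * L)\<^sup>2) + P * (L * (2 * L))) * (norm h)\<^sup>2" .
  then have "L * norm rem \<le> K0 * (norm h)\<^sup>2"
    unfolding K0_def mult.assoc[of L] using L1 by (intro mult_left_mono) auto
  then have "norm (N y rem) \<le> K0 * (norm h)\<^sup>2"
    using N_bd[OF y, of rem] by simp
  then show ?thesis
    using that[of c "N y rem"] V' c(2,3) unfolding Nn' Q_def h_def by blast
qed

text \<open>The inverse of the anisotropic dilation: it maps the box of radius \<delta> to the unit
  cube.\<close>

definition sc :: "real \<Rightarrow> real^'p \<Rightarrow> real^'p" where
  "sc \<delta> v = (\<chi> k. v $ k / \<delta> ^ w k)"

lemma sc_linear: "linear (sc \<delta>)"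
  by (rule linearI) (simp_all add: sc_def vec_eq_iff add_divide_distrib)

lemma norm_sc_le: "0 < \<delta> \<Longrightarrow> norm (sc \<delta> v) \<le> (\<Sum>k\<in>UNIV. 1 / \<delta> ^ w k) * norm v"
proof -
  assume "0 < \<delta>"
  have "norm (sc \<delta> v) \<le> (\<Sum>k\<in>UNIV. \<bar>sc \<delta> v $ k\<bar>)" by (rule norm_le_l1_cart)
  also have "\<dots> \<le> (\<Sum>k\<in>UNIV. 1 / \<delta> ^ w k * norm v)"
    using \<open>0 < \<delta>\<close> component_le_norm_cart[of v] by (intro sum_mono) (auto simp: sc_def divide_right_mono)
  finally show ?thesis by (simp add: sum_distrib_right)
qed

lemma component_le_sc: "0 < \<delta> \<Longrightarrow> \<bar>v $ k\<bar> \<le> \<delta> ^ w k * norm (sc \<delta> v)"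
  using component_le_norm_cart[of "sc \<delta> v" k] by (simp add: sc_def field_simps)

lemma norm_sc_le_bound:
  assumes "0 < \<delta>" "\<And>k. \<bar>v $ k\<bar> \<le> b * \<delta> ^ w k"
  shows "norm (sc \<delta> v) \<le> P * b"
  using assms by (intro norm_le_components) (auto simp: sc_def field_simps)

text \<open>The second bound pays for the two sums over indices, the passage from components to the
  norm (one factor \<open>P\<close> each) and the coefficient size \<open>2 * L ^ 3\<close>; what
  remains is 1/8.\<close>

definition \<eta> :: real where "\<eta> = min (\<epsilon> / P) (1 / (16 * P ^ 3 * L ^ 3))"

lemma eta_pos: "0 < \<eta>"
  using eps_pos P1 L1 by (auto simp: \<eta>_def intro!: mult_pos_pos)

lemma eta_le_1: "\<eta> \<le> 1"
proof -
  have "1 * 1 * 1 \<le> 16 * P ^ 3 * L ^ 3" using P1 L1 by (intro mult_mono one_le_power) auto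
  then have "1 / (16 * P ^ 3 * L ^ 3) \<le> 1 / 1" using P1 L1 by (intro divide_left_mono) (auto intro!: mult_pos_pos)
  then show ?thesis by (simp add: \<eta>_def)
qed

lemma eta_small: "P * (P * (P * (2 * L ^ 3 * \<eta>))) \<le> 1 / 8"
proof -
  have "P * (P * (P * (2 * L ^ 3 * \<eta>))) \<le> P * (P * (P * (2 * L ^ 3 * (1 / (16 * P ^ 3 * L ^ 3)))))"
    using P1 L1 by (intro mult_left_mono) (auto simp: \<eta>_def)
  also have "\<dots> = 1 / 8" using P1 L1 by (simp add: field_simps power3_eq_cube)
  finally show ?thesis .
qed

text \<open>The source of uniformity in \<delta>. Components with \<open>w l > w k + w j\<close>
  vanish by the filtration; in the others the product of the two scales, \<delta>^(w k + w j), is at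
  most \<delta>^(w l) because \<delta> \<le> 1.\<close>

lemma sc_bracket_term:
  assumes \<delta>: "0 < \<delta>" "\<delta> \<le> 1" and uj: "\<bar>a\<bar> \<le> \<eta> * \<delta> ^ w j"
    and c0: "\<And>l. w k + w j < w l \<Longrightarrow> c $ l = 0" and c: "norm c \<le> 2 * L ^ 3"
  shows "norm (sc \<delta> ((a * V $ k) *\<^sub>R c)) \<le> P * (2 * L ^ 3 * \<eta>) * norm (sc \<delta> V)"
proof -
  have "\<bar>((a * V $ k) *\<^sub>R c) $ l\<bar> \<le> 2 * L ^ 3 * \<eta> * norm (sc \<delta> V) * \<delta> ^ w l" for l
  proof (cases "w k + w j < w l")
    case True
    then show ?thesis using c0 \<delta> L1 eta_pos by simp
  next
    case False
    have "\<bar>((a * V $ k) *\<^sub>R c) $ l\<bar> = \<bar>a\<bar> * \<bar>V $ k\<bar> * \<bar>c $ l\<bar>" by (simp add: abs_mult)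
    also have "\<dots> \<le> (\<eta> * \<delta> ^ w j) * (\<delta> ^ w k * norm (sc \<delta> V)) * (2 * L ^ 3)"
      using uj component_le_sc[OF \<delta>(1), of V k] order_trans[OF component_le_norm_cart c] \<delta> eta_pos
      by (intro mult_mono) auto
    also have "\<dots> = (2 * L ^ 3 * \<eta> * norm (sc \<delta> V)) * \<delta> ^ (w k + w j)" by (simp add: power_add mult_ac)
    also have "\<dots> \<le> (2 * L ^ 3 * \<eta> * norm (sc \<delta> V)) * \<delta> ^ w l"
      using False \<delta> L1 eta_pos by (intro mult_left_mono power_decreasing) auto
    finally show ?thesis .
  qed
  then have "norm (sc \<delta> ((a * V $ k) *\<^sub>R c)) \<le> P * (2 * L ^ 3 * \<eta> * norm (sc \<delta> V))"
    using \<delta> by (intro norm_sc_le_bound)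
  then show ?thesis by (simp add: mult.assoc)
qed

text \<open>Gronwall for the scaled coordinates after removal of their drift
  \<open>t *\<^sub>R h\<close>. The factor of the last term depends on \<delta>, but it multiplies a
  square and disappears in difference quotients. The scaled bound is imposed on \<open>u\<close>
  alone, since \<open>v\<close> will be any nearby point of the lift.\<close>

lemma E_scaled_expanding:
  assumes \<delta>: "0 < \<delta>" "\<delta> \<le> 1" and u: "norm u \<le> \<epsilon>" and v: "norm v \<le> \<epsilon>"
    and us: "\<And>j. \<bar>u $ j\<bar> \<le> \<eta> * \<delta> ^ w j"
  shows "norm (sc \<delta> (v - u)) \<le> 2 * norm (sc \<delta> (N (E u) (E v - E u)))
    + 4 * ((\<Sum>k\<in>UNIV. 1 / \<delta> ^ w k) * K0) * (norm (v - u))\<^sup>2"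
proof -
  define h where "h = v - u"
  define V where "V = (\<lambda>s. N (flow u s) (flow v s - flow u s))"
  define H where "H = norm (sc \<delta> h)"
  define C where "C = (\<Sum>k\<in>UNIV. 1 / \<delta> ^ w k)"
  have "C \<ge> 0" using \<delta> by (simp add: C_def sum_nonneg)
  define s where "s = (\<lambda>t. sc \<delta> (V t - t *\<^sub>R h))"
  have "\<exists>s'. (s has_vector_derivative s') (at t within {0..1}) \<and>
      norm s' \<le> norm (s t) / 2 + (H / 8 + C * K0 * (norm h)\<^sup>2)" if t: "t \<in> {0..1}" for t
  proof -
    obtain c q where V': "(V has_vector_derivative h + (\<Sum>j\<in>UNIV. \<Sum>k\<in>UNIV. (u $ j * V t $ k) *\<^sub>R c k j) + q) (at t within {0..1})"
      and c: "\<And>i j k. w i + w j < w k \<Longrightarrow> c i j $ k = 0" "\<And>i j. norm (c i j) \<le> 2 * L ^ 3"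
      and q: "norm q \<le> K0 * (norm h)\<^sup>2"
      using flow_coord_deriv[OF u v t] unfolding V_def h_def by blast
    define Q where "Q = (\<Sum>j\<in>UNIV. \<Sum>k\<in>UNIV. (u $ j * V t $ k) *\<^sub>R c k j)"
    have "((\<lambda>t. V t - t *\<^sub>R h) has_vector_derivative Q + q) (at t within {0..1})"
      using V' unfolding Q_def[symmetric] by (auto intro!: derivative_eq_intros)
    then have s': "(s has_vector_derivative sc \<delta> (Q + q)) (at t within {0..1})"
      unfolding s_def using sc_linear by (rule linear_conv_bounded_linear[THEN iffD1, THEN bounded_linear.has_vector_derivative, rotated])
    have scV: "norm (sc \<delta> (V t)) \<le> norm (s t) + H"
    proof -
      have "sc \<delta> (V t) = s t + t *\<^sub>R sc \<delta> h"
        unfolding s_def linear_diff[OF sc_linear] linear_cmul[OF sc_linear] by simp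
      then have "norm (sc \<delta> (V t)) \<le> norm (s t) + norm (t *\<^sub>R sc \<delta> h)" using norm_triangle_ineq by metis
      also have "norm (t *\<^sub>R sc \<delta> h) \<le> H" using t by (simp add: H_def mult_left_le_one_le)
      finally show ?thesis by simp
    qed
    have "norm (sc \<delta> Q) \<le> (\<Sum>j\<in>(UNIV::'p set). \<Sum>k\<in>(UNIV::'p set). P * (2 * L ^ 3 * \<eta>) * norm (sc \<delta> (V t)))"
      unfolding Q_def linear_sum[OF sc_linear]
      by (intro order_trans[OF norm_sum] sum_mono sc_bracket_term \<delta> c) (rule us)
    also have "\<dots> = (P * (P * (P * (2 * L ^ 3 * \<eta>)))) * norm (sc \<delta> (V t))" by (simp add: P_def)
    also have "\<dots> \<le> 1 / 8 * (norm (s t) + H)"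
      using scV eta_small by (intro mult_mono) auto
    finally have 1: "norm (sc \<delta> Q) \<le> norm (s t) / 8 + H / 8" by simp
    have "norm (sc \<delta> q) \<le> C * norm q" unfolding C_def by (rule norm_sc_le[OF \<delta>(1)])
    also have "\<dots> \<le> C * (K0 * (norm h)\<^sup>2)" using q \<open>C \<ge> 0\<close> by (rule mult_left_mono)
    finally have 2: "norm (sc \<delta> q) \<le> C * K0 * (norm h)\<^sup>2" by simp
    have "norm (sc \<delta> (Q + q)) \<le> norm (sc \<delta> Q) + norm (sc \<delta> q)"
      unfolding linear_add[OF sc_linear] by (rule norm_triangle_ineq)
    with 1 2 have "norm (sc \<delta> (Q + q)) \<le> norm (s t) / 2 + (H / 8 + C * K0 * (norm h)\<^sup>2)"
      using norm_ge_zero[of "s t"] by linarith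
    with s' show ?thesis by blast
  qed
  then obtain s' where s': "\<And>t. t \<in> {0..1} \<Longrightarrow> (s has_vector_derivative s' t) (at t within {0..1})"
    "\<And>t. t \<in> {0..1} \<Longrightarrow> norm (s' t) \<le> norm (s t) / 2 + (H / 8 + C * K0 * (norm h)\<^sup>2)"
    by metis
  have "s 0 = 0"
    using flow_0 u v linear_0[OF N_linear[of x]] linear_0[OF sc_linear] rho by (simp add: s_def V_def)
  from small_gronwall[OF s'(1) this s'(2), of 1]
  have s1: "norm (s 1) \<le> H / 4 + 2 * (C * K0 * (norm h)\<^sup>2)" by simp
  have "sc \<delta> h = sc \<delta> (V 1) - s 1" by (simp add: s_def linear_diff[OF sc_linear])
  then have "H \<le> norm (sc \<delta> (V 1)) + norm (s 1)" unfolding H_def using norm_triangle_ineq4 by metis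
  \<comment> \<open>The quarter of \<open>H\<close> is absorbed on the left; the resulting factors
    4/3 and 8/3 are rounded up to 2 and 4.\<close>
  with s1 have "3 / 4 * H \<le> norm (sc \<delta> (V 1)) + 2 * (C * K0 * (norm h)\<^sup>2)" by simp
  moreover have "0 \<le> C * K0 * (norm h)\<^sup>2" using \<open>C \<ge> 0\<close> K0_nonneg by simp
  ultimately have "H \<le> 2 * norm (sc \<delta> (V 1)) + 4 * (C * K0 * (norm h)\<^sup>2)"
    using norm_ge_zero[of "sc \<delta> (V 1)"] by linarith
  then show ?thesis by (simp add: H_def C_def V_def E_def h_def mult.assoc)
qed

end

subsection \<open>Lifting controlled curves to exponential coordinates\<close>

definition frame_curve ::
    "(real^'p) set \<Rightarrow> ('p \<Rightarrow> real^'p \<Rightarrow> real^'p) \<Rightarrow> ('p \<Rightarrow> real) \<Rightarrow> (real \<Rightarrow> real^'p) \<Rightarrow> bool" where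
  "frame_curve \<Omega> Y b \<phi> \<longleftrightarrow> absolutely_continuous_on_interval 0 1 \<phi> \<and> \<phi> ` {0..1} \<subseteq> \<Omega> \<and>
    (\<exists>a N. negligible N \<and> (\<forall>t\<in>{0..1} - N.
      (\<phi> has_vector_derivative frame_comb Y (\<phi> t) (a t)) (at t within {0..1}) \<and> (\<forall>k. \<bar>a t $ k\<bar> \<le> b k)))"

context frame_ball
begin

text \<open>The first bound keeps controlled curves where \<open>E\<close> is onto; the second keeps
  the scaled speed \<open>2 * (P * \<kappa>)\<close> of the lift below \<eta>.\<close>

definition \<kappa> :: real where "\<kappa> = min (\<epsilon> / (4 * P * L\<^sup>2)) (\<eta> / (4 * P))"

lemma kappa_pos: "0 < \<kappa>"
  using eps_pos eta_pos P1 L1 by (auto simp: \<kappa>_def)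

lemma kappa_eps: "L * (P * \<kappa>) \<le> \<epsilon> / (4 * L)"
proof -
  have "L * (P * \<kappa>) \<le> L * (P * (\<epsilon> / (4 * P * L\<^sup>2)))"
    using P1 L1 by (intro mult_left_mono) (auto simp: \<kappa>_def)
  also have "\<dots> = \<epsilon> / (4 * L)" using P1 L1 by (simp add: field_simps power2_eq_square)
  finally show ?thesis .
qed

lemma kappa_eta: "2 * (P * \<kappa>) \<le> \<eta> / 2"
proof -
  have "2 * (P * \<kappa>) \<le> 2 * (P * (\<eta> / (4 * P)))"
    using P1 by (intro mult_left_mono) (auto simp: \<kappa>_def)
  then show ?thesis using P1 by simp
qed

lemma kappa_le_1: "\<kappa> \<le> 1"
proof -
  have "\<kappa> \<le> 2 * (P * \<kappa>)" using P1 kappa_pos by (simp add: mult_le_cancel_right1)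
  then show ?thesis using kappa_eta eta_le_1 by simp
qed

lemma eps_rho4: "\<epsilon> / (2 * L) \<le> \<rho> / 4"
proof -
  have "\<epsilon> / (2 * L) \<le> \<epsilon> / (2 * 1)" using L1 eps_pos by (intro divide_left_mono) auto
  also have "\<dots> \<le> (L * \<epsilon>) / 2" using L1 eps_pos by simp
  finally have "\<epsilon> / (2 * L) \<le> (L * \<epsilon>) / 2" .
  then show ?thesis using eps_rho by simp
qed

text \<open>While the curve is in the ball its speed is at most \<open>L * (P * \<kappa>)\<close>,
  which is at most half of the radius to be protected, and the time is at most 1.\<close>

lemma frame_curve_stays:
  assumes \<phi>: "frame_curve \<Omega> Y b \<phi>" and \<phi>0: "\<phi> 0 = x" and b: "\<And>k. b k \<le> \<kappa>" and t: "t \<in> {0..1}"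
  shows "norm (\<phi> t - x) < \<epsilon> / (2 * L)"
proof -
  obtain a Z where ac: "absolutely_continuous_on_interval 0 1 \<phi>" and Z: "negligible Z"
    and d: "\<And>t. t \<in> {0..1} - Z \<Longrightarrow> (\<phi> has_vector_derivative M (\<phi> t) (a t)) (at t within {0..1})"
    and a: "\<And>t k. t \<in> {0..1} - Z \<Longrightarrow> \<bar>a t $ k\<bar> \<le> b k"
    using \<phi> unfolding frame_curve_def by blast
  note cont = absolutely_continuous_imp_continuous[OF ac]
  have na: "norm (a t) \<le> P * \<kappa>" if "t \<in> {0..1} - Z" for t
    using order_trans[OF a[OF that] b] by (rule norm_le_components)
  show ?thesis
  proof (rule continuous_first_exit[of "{()}" "\<lambda>_ t. norm (\<phi> t - x)" "\<lambda>_. \<epsilon> / (2 * L)" t "()"])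
    show "continuous_on {0..1} (\<lambda>t. norm (\<phi> t - x))" for i :: unit by (intro continuous_intros cont)
    fix T assume T: "0 \<le> T" "T \<le> 1"
      and st: "\<And>t i. 0 \<le> t \<Longrightarrow> t < T \<Longrightarrow> i \<in> {()} \<Longrightarrow> norm (\<phi> t - x) < \<epsilon> / (2 * L)"
    have "norm (\<phi> T - \<phi> 0) \<le> \<epsilon> / (4 * L) * (T - 0)"
    \<comment> \<open>The running assumption covers only times before \<open>T\<close>, so
      \<open>T\<close> itself joins the exceptional set.\<close>
    proof (rule absolutely_continuous_norm_diff_le[OF ac, where N = "insert T Z"])
      fix t e :: real assume t: "t \<in> {0..T} - insert T Z" and "e > 0"
      then have t': "t \<in> {0..1} - Z" and "norm (\<phi> t - x) < \<epsilon> / (2 * L)" using st T by auto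
      then have in_ball: "\<phi> t \<in> U" using eps_rho4 rho by (simp add: dist_norm norm_minus_commute)
      have "norm (M (\<phi> t) (a t)) \<le> L * (P * \<kappa>)"
        using L1 by (intro order_trans[OF M_up[OF in_ball]] mult_left_mono na[OF t']) auto
      then have "norm (M (\<phi> t) (a t)) \<le> \<epsilon> / (4 * L)" using kappa_eps by simp
      from has_vector_derivative_imp_increment_le[OF d[OF t'] this \<open>e > 0\<close>]
      show "\<exists>d>0. \<forall>s\<in>{0..T}. \<bar>s - t\<bar> < d \<longrightarrow> norm (\<phi> s - \<phi> t) \<le> (\<epsilon> / (4 * L) + e) * \<bar>s - t\<bar>"
        using T by fastforce
    qed (use T Z eps_pos L1 in auto)
    also have "\<dots> \<le> \<epsilon> / (4 * L) * 1" using T eps_pos L1 by (intro mult_left_mono) auto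
    also have "\<dots> < \<epsilon> / (2 * L)" using eps_pos L1 by (simp add: field_simps)
    finally show "\<forall>i\<in>{()}. norm (\<phi> T - x) < \<epsilon> / (2 * L)" using \<phi>0 by simp
  qed (use t in auto)
qed

text \<open>Lift the curve through \<open>E\<close>. As long as the scaled norm of the lift is below
  \<eta>, its local speed is at most \<open>2 * (P * \<kappa>) \<le> \<eta> / 2\<close>, so it never
  reaches \<eta>. Since \<eta> \<le> 1, the end point lies in the box of radius \<delta>.\<close>

lemma frame_curve_end:
  assumes \<phi>: "frame_curve \<Omega> Y b \<phi>" and \<phi>0: "\<phi> 0 = x" and \<delta>: "0 < \<delta>" "\<delta> \<le> 1"
    and b: "\<And>k. b k \<le> \<kappa> * \<delta> ^ w k"
  obtains u where "norm u \<le> \<epsilon>" "E u = \<phi> 1" "\<And>k. \<bar>u $ k\<bar> < \<delta> ^ w k"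
proof -
  obtain a Z where ac: "absolutely_continuous_on_interval 0 1 \<phi>" and Z: "negligible Z"
    and d: "\<And>t. t \<in> {0..1} - Z \<Longrightarrow> (\<phi> has_vector_derivative M (\<phi> t) (a t)) (at t within {0..1})"
    and a: "\<And>t k. t \<in> {0..1} - Z \<Longrightarrow> \<bar>a t $ k\<bar> \<le> b k"
    using \<phi> unfolding frame_curve_def by blast
  have "b k \<le> \<kappa>" for k
    using order_trans[OF b[of k] mult_left_mono[OF power_le_one[of \<delta> "w k"], of \<kappa>]] \<delta> kappa_pos by simp
  note stay = frame_curve_stays[OF \<phi> \<phi>0 this]
  \<comment> \<open>The lift is chosen separately at each time; \<open>E_expanding\<close> makes it
    unique, and Lipschitz with respect to the curve, hence absolutely continuous.\<close>
  have "\<exists>u. norm u \<le> \<epsilon> \<and> E u = \<phi> t" if "t \<in> {0..1}" for t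
    using E_surj[of "\<phi> t"] stay[OF that] by (metis less_imp_le)
  then obtain u where u: "\<And>t. t \<in> {0..1} \<Longrightarrow> norm (u t) \<le> \<epsilon>" "\<And>t. t \<in> {0..1} \<Longrightarrow> E (u t) = \<phi> t"
    by metis
  have u_lip: "norm (u s - u t) \<le> 2 * L * norm (\<phi> s - \<phi> t)" if "s \<in> {0..1}" "t \<in> {0..1}" for s t
    using E_expanding[of "u t" "u s"] u that by simp
  have u0: "u 0 = 0"
    using E_expanding[of 0 "u 0"] u[of 0] \<phi>0 E_0 eps_pos by simp
  define c where "c = (\<Sum>k\<in>UNIV. 1 / \<delta> ^ w k)"
  have "0 \<le> c" using \<delta> by (simp add: c_def sum_nonneg)
  define f where "f = (\<lambda>t. sc \<delta> (u t))"
  have f_diff: "norm (f s - f t) = norm (sc \<delta> (u s - u t))" for s t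
    by (simp add: f_def linear_diff[OF sc_linear])
  have f_ac: "absolutely_continuous_on_interval 0 1 f"
  proof (rule absolutely_continuous_dominated[OF ac, of "c * (2 * L)" 0])
    fix s t :: real assume st: "s \<in> {0..1}" "t \<in> {0..1}"
    have "norm (f s - f t) \<le> c * norm (u s - u t)" unfolding f_diff c_def by (rule norm_sc_le[OF \<delta>(1)])
    also have "\<dots> \<le> c * (2 * L * norm (\<phi> s - \<phi> t))" using u_lip[OF st] \<open>0 \<le> c\<close> by (rule mult_left_mono)
    finally show "dist (f s) (f t) \<le> c * (2 * L) * dist (\<phi> s) (\<phi> t) + 0 * \<bar>s - t\<bar>" by (simp add: dist_norm mult.assoc)
  qed (use \<open>0 \<le> c\<close> L1 in auto)
  note f_cont = absolutely_continuous_imp_continuous[OF f_ac]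
  have f0: "f 0 = 0" using u0 linear_0[OF sc_linear] by (simp add: f_def)
  \<comment> \<open>The difference quotient of the lift replaces its derivative. Of the excess
    \<open>e\<close>, one half covers the differentiation error of the curve and the other half the
    quadratic term of \<open>E_scaled_expanding\<close>.\<close>
  have increment: "\<exists>d>0. \<forall>s\<in>{0..1}. \<bar>s - t\<bar> < d \<longrightarrow> norm (f s - f t) \<le> (2 * (P * \<kappa>) + e) * \<bar>s - t\<bar>"
    if t: "t \<in> {0..1} - Z" and ft: "norm (f t) < \<eta>" and "e > 0" for t e
  proof -
    have t01: "t \<in> {0..1}" using t by simp
    have us: "\<bar>u t $ j\<bar> \<le> \<eta> * \<delta> ^ w j" for j
    proof -
      have "\<delta> ^ w j * norm (sc \<delta> (u t)) \<le> \<delta> ^ w j * \<eta>"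
        using ft \<delta> by (intro mult_left_mono) (auto simp: f_def)
      then show ?thesis using component_le_sc[OF \<delta>(1), of "u t" j] by (simp add: mult.commute)
    qed
    have Et: "E (u t) \<in> U" using flow_in[OF u(1)[OF t01], of 1] by (simp add: E_def)
    define m where "m = norm (M (\<phi> t) (a t)) + 1"
    have "m > 0" by (simp add: m_def add_nonneg_pos)
    obtain d1 where d1: "d1 > 0" "\<And>s. s \<in> {0..1} \<Longrightarrow> \<bar>s - t\<bar> < d1 \<Longrightarrow> norm (\<phi> s - \<phi> t) \<le> m * \<bar>s - t\<bar>"
      using has_vector_derivative_imp_increment_le[OF d[OF t] order_refl, of 1] by (auto simp: m_def)
    have "0 < e / (2 * (2 * c * L + 1))" using \<open>e > 0\<close> \<open>0 \<le> c\<close> L1 by (intro divide_pos_pos) (auto intro!: add_nonneg_pos)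
    then obtain d2 where d2: "d2 > 0" "\<And>s. s \<in> {0..1} \<Longrightarrow> norm (s - t) < d2 \<Longrightarrow>
        norm (\<phi> s - \<phi> t - (s - t) *\<^sub>R M (\<phi> t) (a t)) \<le> e / (2 * (2 * c * L + 1)) * norm (s - t)"
      using d[OF t] unfolding has_vector_derivative_def has_derivative_within_alt by meson
    define K where "K = 4 * (c * K0) * (2 * L * m)\<^sup>2"
    have "K \<ge> 0" using \<open>0 \<le> c\<close> K0_nonneg by (simp add: K_def)
    \<comment> \<open>Within this distance of \<open>t\<close> the quadratic term is at most
      \<open>e / 2 * \<bar>s - t\<bar>\<close>.\<close>
    define d3 where "d3 = e / (2 * (K + 1))"
    have "d3 > 0" using \<open>e > 0\<close> \<open>K \<ge> 0\<close> by (simp add: d3_def)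
    have "norm (f s - f t) \<le> (2 * (P * \<kappa>) + e) * \<bar>s - t\<bar>" if s: "s \<in> {0..1}" and sd: "\<bar>s - t\<bar> < min d1 (min d2 d3)" for s
    proof -
      define r where "r = \<phi> s - \<phi> t - (s - t) *\<^sub>R M (\<phi> t) (a t)"
      have r: "norm r \<le> e / (2 * (2 * c * L + 1)) * \<bar>s - t\<bar>" using d2(2)[OF s] sd by (simp add: r_def)
      \<comment> \<open>In frame coordinates the main part of the increment is exactly the control,
        whose scaled norm is at most \<open>P * \<kappa>\<close>.\<close>
      have "N (E (u t)) (E (u s) - E (u t)) = N (\<phi> t) ((s - t) *\<^sub>R M (\<phi> t) (a t) + r)"
        using u s t01 by (simp add: r_def)
      also have "\<dots> = (s - t) *\<^sub>R a t + N (\<phi> t) r"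
        using Et u(2)[OF t01] by (simp add: linear_add[OF N_linear] linear_cmul[OF N_linear] N_M)
      finally have "sc \<delta> (N (E (u t)) (E (u s) - E (u t))) = (s - t) *\<^sub>R sc \<delta> (a t) + sc \<delta> (N (\<phi> t) r)"
        by (simp add: linear_add[OF sc_linear] linear_cmul[OF sc_linear])
      then have "norm (sc \<delta> (N (E (u t)) (E (u s) - E (u t)))) \<le> \<bar>s - t\<bar> * norm (sc \<delta> (a t)) + norm (sc \<delta> (N (\<phi> t) r))"
        using norm_triangle_ineq[of "(s - t) *\<^sub>R sc \<delta> (a t)"] by simp
      also have "\<dots> \<le> \<bar>s - t\<bar> * (P * \<kappa>) + c * (L * norm r)"
      proof (intro add_mono mult_left_mono)
        show "norm (sc \<delta> (a t)) \<le> P * \<kappa>"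
          using order_trans[OF a[OF t] b] by (intro norm_sc_le_bound[OF \<delta>(1)])
        have "norm (sc \<delta> (N (\<phi> t) r)) \<le> c * norm (N (\<phi> t) r)" unfolding c_def by (rule norm_sc_le[OF \<delta>(1)])
        also have "\<dots> \<le> c * (L * norm r)"
          using N_bd[of "\<phi> t" r] Et u(2)[OF t01] \<open>0 \<le> c\<close> by (intro mult_left_mono) auto
        finally show "norm (sc \<delta> (N (\<phi> t) r)) \<le> c * (L * norm r)" .
      qed auto
      finally have 1: "norm (sc \<delta> (N (E (u t)) (E (u s) - E (u t)))) \<le> \<bar>s - t\<bar> * (P * \<kappa>) + c * (L * norm r)" .
      have "2 * (c * (L * norm r)) = (2 * c * L) * norm r" by simp
      also have "\<dots> \<le> (2 * c * L + 1) * (e / (2 * (2 * c * L + 1)) * \<bar>s - t\<bar>)"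
        using r \<open>0 \<le> c\<close> L1 by (intro mult_mono) auto
      also have "\<dots> = e / 2 * \<bar>s - t\<bar>"
      proof -
        have "0 < 2 * c * L + 1" using \<open>0 \<le> c\<close> L1 by (intro add_nonneg_pos) auto
        then show ?thesis by (simp add: divide_simps)
      qed
      finally have 2: "2 * (c * (L * norm r)) \<le> e / 2 * \<bar>s - t\<bar>" .
      have "norm (u s - u t) \<le> 2 * L * (m * \<bar>s - t\<bar>)"
        using L1 sd by (intro order_trans[OF u_lip[OF s t01]] mult_left_mono d1(2)[OF s]) auto
      then have "(norm (u s - u t))\<^sup>2 \<le> (2 * L * (m * \<bar>s - t\<bar>))\<^sup>2" by (rule power_mono) simp
      then have "4 * (c * K0) * (norm (u s - u t))\<^sup>2 \<le> 4 * (c * K0) * (2 * L * (m * \<bar>s - t\<bar>))\<^sup>2"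
        using \<open>0 \<le> c\<close> K0_nonneg by (intro mult_left_mono) auto
      also have "\<dots> = K * \<bar>s - t\<bar> * \<bar>s - t\<bar>"
        unfolding K_def power2_eq_square by (simp only: mult_ac)
      also have "\<dots> \<le> (K + 1) * d3 * \<bar>s - t\<bar>"
        using sd \<open>K \<ge> 0\<close> \<open>d3 > 0\<close> by (intro mult_right_mono mult_mono) auto
      also have "(K + 1) * d3 = e / 2" using \<open>K \<ge> 0\<close> by (simp add: d3_def field_simps)
      finally have 3: "4 * (c * K0) * (norm (u s - u t))\<^sup>2 \<le> e / 2 * \<bar>s - t\<bar>" .
      have "norm (f s - f t) \<le> 2 * norm (sc \<delta> (N (E (u t)) (E (u s) - E (u t)))) + 4 * (c * K0) * (norm (u s - u t))\<^sup>2"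
        unfolding f_diff c_def by (rule E_scaled_expanding[OF \<delta> u(1)[OF t01] u(1)[OF s] us])
      with 1 2 3 show ?thesis by (simp add: algebra_simps)
    qed
    with d1 d2 \<open>d3 > 0\<close> show ?thesis by (intro exI[of _ "min d1 (min d2 d3)"]) auto
  qed
  have "norm (f 1) < \<eta>"
  proof (rule continuous_first_exit[of "{()}" "\<lambda>_ t. norm (f t)" "\<lambda>_. \<eta>" 1 "()"])
    show "continuous_on {0..1} (\<lambda>t. norm (f t))" for i :: unit by (intro continuous_intros f_cont)
    fix T assume T: "0 \<le> T" "T \<le> 1"
      and st: "\<And>t i. 0 \<le> t \<Longrightarrow> t < T \<Longrightarrow> i \<in> {()} \<Longrightarrow> norm (f t) < \<eta>"
    have "norm (f T - f 0) \<le> 2 * (P * \<kappa>) * (T - 0)"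
    proof (rule absolutely_continuous_norm_diff_le[OF f_ac, where N = "insert T Z"])
      fix t e :: real assume t: "t \<in> {0..T} - insert T Z" and "e > 0"
      then have "t \<in> {0..1} - Z" "norm (f t) < \<eta>" using st T by auto
      from increment[OF this \<open>e > 0\<close>]
      show "\<exists>d>0. \<forall>s\<in>{0..T}. \<bar>s - t\<bar> < d \<longrightarrow> norm (f s - f t) \<le> (2 * (P * \<kappa>) + e) * \<bar>s - t\<bar>"
        using T by fastforce
    qed (use T Z kappa_pos P1 in auto)
    also have "\<dots> \<le> 2 * (P * \<kappa>) * 1" using T kappa_pos P1 by (intro mult_left_mono) auto
    also have "\<dots> < \<eta>" using kappa_eta eta_pos by simp
    finally show "\<forall>i\<in>{()}. norm (f T) < \<eta>" using f0 by simp
  qed auto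
  then have f1: "norm (sc \<delta> (u 1)) < 1" using eta_le_1 by (simp add: f_def)
  have "\<bar>u 1 $ k\<bar> < \<delta> ^ w k" for k
    using le_less_trans[OF component_le_sc[OF \<delta>(1), of "u 1" k]] mult_strict_left_mono[OF f1, of "\<delta> ^ w k"] \<delta> by simp
  then show ?thesis using that u(1)[of 1] u(2)[of 1] by simp
qed

end

subsection \<open>Boxes and reachable sets\<close>

definition weighted_box :: "('p::finite \<Rightarrow> nat) \<Rightarrow> real \<Rightarrow> (real^'p) set" where
  "weighted_box w R = {u. \<forall>k. \<bar>u $ k\<bar> < R ^ w k}"

lemma weighted_box_eq_box: "weighted_box w R = box (\<chi> k. - (R ^ w k)) (\<chi> k. R ^ w k)"
  by (auto simp: weighted_box_def mem_box_cart abs_less_iff minus_less_iff)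

lemma open_weighted_box: "open (weighted_box w R)"
  unfolding weighted_box_eq_box by (rule open_box)

lemma bounded_weighted_box: "bounded (weighted_box w R)"
  unfolding weighted_box_eq_box by (rule bounded_box)

lemma measure_weighted_box:
  assumes "0 < R"
  shows "measure lebesgue (weighted_box w R :: (real^'p::finite) set) = 2 ^ CARD('p) * R ^ (\<Sum>k\<in>UNIV. w k)"
proof -
  let ?l = "(\<chi> k. - (R ^ w k)) :: real^'p" and ?u = "(\<chi> k. R ^ w k) :: real^'p"
  have le: "- (R ^ w k) \<le> R ^ w k" for k using assms zero_less_power[of R "w k"] by linarith
  then have ne: "cbox ?l ?u \<noteq> {}" by (simp add: interval_ne_empty_cart)
  have "measure lebesgue (box ?l ?u) = measure lborel (cbox ?l ?u)"
    by (simp add: measure_lborel_box_eq measure_lborel_cbox_eq)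
  also have "\<dots> = (\<Prod>k\<in>UNIV. 2 * R ^ w k)" using content_cbox_cart[OF ne] by simp
  also have "\<dots> = 2 ^ CARD('p) * R ^ (\<Sum>k\<in>UNIV. w k)" by (simp add: prod.distrib power_sum)
  finally show ?thesis by (simp add: weighted_box_eq_box)
qed

definition frame_box where
  "frame_box \<Omega> Y w x R = {field_exp \<Omega> (\<lambda>y. frame_comb Y y u) x | u. u \<in> weighted_box w R}"

text \<open>The metric ball without the infimum: a distance is below \<open>R\<close> exactly if
  some admissible \<open>d < R\<close> exists.\<close>

definition frame_reach where
  "frame_reach \<Omega> Y w x R = {\<phi> 1 | \<phi>. \<phi> 0 = x \<and> (\<exists>d>0. d < R \<and> frame_curve \<Omega> Y (\<lambda>k. d ^ w k) \<phi>)}"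

context frame_ball
begin

abbreviation reach where "reach \<equiv> frame_reach \<Omega> Y w x"

abbreviation fbox where "fbox \<equiv> frame_box \<Omega> Y w x"

abbreviation wbox where "wbox \<equiv> weighted_box w"

text \<open>Chosen so that even the enlarged radius \<open>R / \<kappa>\<close> is at most
  \<open>\<epsilon> / P\<close>, which puts the enlarged box inside the ball on which
  \<open>E\<close> is controlled.\<close>

definition R0 :: real where "R0 = \<kappa> * \<epsilon> / P"

lemma R0_pos: "0 < R0"
  using kappa_pos eps_pos P1 by (simp add: R0_def)

lemma eps_le_1: "\<epsilon> \<le> 1"
proof -
  have "1 * 1 * 1 \<le> 6 * P * L ^ 3" using P1 L1 by (intro mult_mono one_le_power) auto
  then have "1 / (6 * P * L ^ 3) \<le> 1 / 1" using P1 L1 by (intro divide_left_mono) (auto intro!: mult_pos_pos)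
  then show ?thesis by (simp add: \<epsilon>_def)
qed

lemma R0_kappa:
  assumes "R \<le> R0"
  shows "R / \<kappa> \<le> 1" "P * (R / \<kappa>) \<le> \<epsilon>"
proof -
  have "R / \<kappa> \<le> \<epsilon> / P"
    using assms kappa_pos P1 by (simp add: R0_def field_simps)
  then show "P * (R / \<kappa>) \<le> \<epsilon>" using P1 by (simp add: field_simps)
  have "\<epsilon> / P \<le> 1" using eps_le_1 P1 by simp
  then show "R / \<kappa> \<le> 1" using \<open>R / \<kappa> \<le> \<epsilon> / P\<close> by simp
qed

lemma R0_le:
  assumes "0 < R" "R \<le> R0"
  shows "R \<le> \<kappa>" "R \<le> 1" "P * R \<le> \<epsilon>"
proof -
  show "R \<le> \<kappa>" using R0_kappa(1)[OF assms(2)] kappa_pos by simp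
  then show "R \<le> 1" using kappa_le_1 by simp
  have "R \<le> R / \<kappa>" using assms(1) kappa_pos kappa_le_1 by (simp add: field_simps)
  then have "P * R \<le> P * (R / \<kappa>)" using P1 by (intro mult_left_mono) auto
  then show "P * R \<le> \<epsilon>" using R0_kappa(2)[OF assms(2)] by simp
qed

lemma norm_weighted_box_le:
  assumes "u \<in> wbox R" "0 < R" "R \<le> 1"
  shows "norm u \<le> P * R"
proof (rule norm_le_components)
  fix k
  have "R ^ w k \<le> R ^ 1" using assms w1 by (intro power_decreasing) auto
  moreover have "\<bar>u $ k\<bar> < R ^ w k" using assms(1) by (simp add: weighted_box_def)
  ultimately show "\<bar>u $ k\<bar> \<le> R" by simp
qed

lemma weighted_box_in_cball:
  assumes "0 < R" "R \<le> 1" "P * R \<le> \<epsilon>" "u \<in> wbox R"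
  shows "norm u \<le> \<epsilon>"
  using norm_weighted_box_le[OF assms(4,1,2)] assms(3) by simp

lemma frame_box_eq:
  assumes "0 < R" "R \<le> 1" "P * R \<le> \<epsilon>"
  shows "fbox R = E ` wbox R"
  unfolding frame_box_def using field_exp_eq_E weighted_box_in_cball[OF assms] by (auto simp: image_def) metis+

lemma frame_curve_flow:
  assumes u: "norm u \<le> \<epsilon>" and b: "\<And>k. \<bar>u $ k\<bar> \<le> b k"
  shows "frame_curve \<Omega> Y b (flow u)"
  unfolding frame_curve_def
proof (intro conjI exI[of _ "\<lambda>_. u"] exI[of _ "{}"])
  show "absolutely_continuous_on_interval 0 1 (flow u)"
    using flow_dist[OF u] L1 by (intro lipschitz_absolutely_continuous[of "L * norm u"]) (auto simp: dist_norm)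
  show "flow u ` {0..1} \<subseteq> \<Omega>" using flow_in[OF u] sub by blast
qed (use flow_deriv[OF u] b in auto)

lemma frame_box_subset_reach:
  assumes R: "0 < R" "R \<le> R0"
  shows "fbox R \<subseteq> reach R"
proof
  fix y assume "y \<in> fbox R"
  then obtain u where u: "u \<in> wbox R" "y = E u"
    using frame_box_eq[OF R(1) R0_le(2,3)[OF R]] by auto
  \<comment> \<open>The box is given by finitely many strict inequalities, so a radius
    \<open>d < R\<close> already suffices; \<open>R / 2\<close> is included to make it
    positive.\<close>
  define d where "d = Max (insert (R / 2) (range (\<lambda>k. root (w k) \<bar>u $ k\<bar>)))"
  have wpos: "0 < w k" for k using w1[of k] by linarith
  have "root (w k) \<bar>u $ k\<bar> < R" for k
  proof -
    have "root (w k) \<bar>u $ k\<bar> < root (w k) (R ^ w k)"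
      using u(1) wpos by (intro real_root_less_mono) (auto simp: weighted_box_def)
    then show ?thesis using R wpos by (simp add: real_root_power_cancel)
  qed
  then have "d < R" unfolding d_def using R by (subst Max_less_iff) auto
  have "R / 2 \<le> d" unfolding d_def by (rule Max_ge) auto
  then have "d > 0" using R by simp
  have "\<bar>u $ k\<bar> \<le> d ^ w k" for k
  proof -
    have "root (w k) \<bar>u $ k\<bar> \<le> d" unfolding d_def by (rule Max_ge) auto
    then have "(root (w k) \<bar>u $ k\<bar>) ^ w k \<le> d ^ w k" using wpos by (intro power_mono) auto
    then show ?thesis using wpos by simp
  qed
  moreover have "norm u \<le> \<epsilon>" using weighted_box_in_cball[OF R(1) R0_le(2,3)[OF R] u(1)] .
  ultimately have "frame_curve \<Omega> Y (\<lambda>k. d ^ w k) (flow u)" "flow u 0 = x" "flow u 1 = y"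
    using frame_curve_flow flow_0 u by (auto simp: E_def)
  then show "y \<in> reach R"
    using \<open>d > 0\<close> \<open>d < R\<close> unfolding frame_reach_def by blast
qed

text \<open>With \<delta> = R/\<kappa>, the bound \<open>R ^ w k\<close> equals
  \<open>\<kappa> ^ w k * \<delta> ^ w k\<close>, and \<open>\<kappa> ^ w k \<le> \<kappa>\<close>
  because \<kappa> \<le> 1 and weights are at least 1. The curve is thus slow in the sense of
  \<open>frame_curve_end\<close>.\<close>

lemma frame_reach_subset_image:
  assumes R: "0 < R" "R \<le> R0"
  shows "reach R \<subseteq> E ` wbox (R / \<kappa>)"
proof
  fix y assume "y \<in> reach R"
  then obtain \<phi> d where \<phi>: "y = \<phi> 1" "\<phi> 0 = x" "0 < d" "d < R" "frame_curve \<Omega> Y (\<lambda>k. d ^ w k) \<phi>"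
    unfolding frame_reach_def by blast
  have \<delta>: "0 < R / \<kappa>" using R kappa_pos by simp
  have "d ^ w k \<le> \<kappa> * (R / \<kappa>) ^ w k" for k
  proof -
    have "d ^ w k \<le> R ^ w k" using \<phi> by (intro power_mono) auto
    also have "\<dots> = \<kappa> ^ w k * (R / \<kappa>) ^ w k" using kappa_pos by (simp add: power_divide)
    also have "\<dots> \<le> \<kappa> ^ 1 * (R / \<kappa>) ^ w k"
      using kappa_pos kappa_le_1 w1 \<delta> by (intro mult_right_mono power_decreasing) auto
    finally show ?thesis by simp
  qed
  then obtain u where "E u = \<phi> 1" "\<And>k. \<bar>u $ k\<bar> < (R / \<kappa>) ^ w k"
    using frame_curve_end[OF \<phi>(5,2) \<delta> R0_kappa(1)[OF R(2)]] by blast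
  then have "u \<in> wbox (R / \<kappa>)" by (simp add: weighted_box_def)
  then show "y \<in> E ` wbox (R / \<kappa>)" unfolding \<phi>(1) \<open>E u = \<phi> 1\<close>[symmetric] by (rule imageI)
qed

lemma frame_reach_subset_box:
  assumes R: "0 < R" "R \<le> R0"
  shows "reach R \<subseteq> fbox (R / \<kappa>)"
  using frame_reach_subset_image[OF R] frame_box_eq[OF _ R0_kappa[OF R(2)]] R kappa_pos by simp

text \<open>Add the drift \<open>t *\<^sub>R z\<close> towards the new end point and correct the
  control through the inverse frame. The correction is at most a constant times
  \<open>norm z\<close> and fits into the gap between \<open>b\<close> and \<open>b'\<close>. This
  yields open, hence measurable, reachable sets.\<close>

lemma frame_curve_perturb:
  assumes \<phi>: "frame_curve \<Omega> Y b \<phi>" and \<phi>0: "\<phi> 0 = x" and b: "\<And>k. b k \<le> \<kappa>" and b': "\<And>k. b k < b' k"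
  shows "\<exists>e>0. \<forall>y. norm (y - \<phi> 1) < e \<longrightarrow> (\<exists>\<psi>. frame_curve \<Omega> Y b' \<psi> \<and> \<psi> 0 = x \<and> \<psi> 1 = y)"
proof -
  obtain a Z where ac: "absolutely_continuous_on_interval 0 1 \<phi>" and Z: "negligible Z"
    and d: "\<And>t. t \<in> {0..1} - Z \<Longrightarrow> (\<phi> has_vector_derivative M (\<phi> t) (a t)) (at t within {0..1})"
    and a: "\<And>t k. t \<in> {0..1} - Z \<Longrightarrow> \<bar>a t $ k\<bar> \<le> b k"
    using \<phi> unfolding frame_curve_def by blast
  have na: "norm (a t) \<le> P * \<kappa>" if "t \<in> {0..1} - Z" for t
    using order_trans[OF a[OF that] b] by (rule norm_le_components)
  \<comment> \<open>\<open>C * norm z\<close> bounds the correction of the control: \<open>L\<close>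
    for the inverse frame, the product for the change of frame between the curves, 1 for the drift
    itself.\<close>
  define C where "C = L * (P * L * (P * \<kappa>) + 1)"
  have "C > 0" using L1 P1 kappa_pos by (auto simp: C_def intro!: mult_pos_pos add_nonneg_pos)
  define m where "m = Min (range (\<lambda>k. b' k - b k))"
  have "m > 0" unfolding m_def using b' by (subst Min_gr_iff) auto
  have m: "m \<le> b' k - b k" for k unfolding m_def by (rule Min_le) auto
  define e where "e = min (\<rho> / 4) (m / C)"
  have "e > 0" using rho \<open>m > 0\<close> \<open>C > 0\<close> by (simp add: e_def)
  have "\<exists>\<psi>. frame_curve \<Omega> Y b' \<psi> \<and> \<psi> 0 = x \<and> \<psi> 1 = y" if y: "norm (y - \<phi> 1) < e" for y
  proof -
    define z where "z = y - \<phi> 1"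
    define \<psi> where "\<psi> = (\<lambda>t. \<phi> t + t *\<^sub>R z)"
    have \<psi>\<phi>: "norm (\<psi> t - \<phi> t) \<le> norm z" if "t \<in> {0..1}" for t
      using that by (simp add: \<psi>_def mult_left_le_one_le)
    have \<phi>_in: "\<phi> t \<in> U" and \<psi>_in: "\<psi> t \<in> U" if "t \<in> {0..1}" for t
    proof -
      have "norm (\<phi> t - x) \<le> \<rho> / 4" using frame_curve_stays[OF \<phi> \<phi>0 b that] eps_rho4 by simp
      moreover have "norm (\<psi> t - \<phi> t) \<le> \<rho> / 4" using \<psi>\<phi>[OF that] y by (simp add: e_def z_def)
      moreover have "norm (\<psi> t - x) \<le> norm (\<psi> t - \<phi> t) + norm (\<phi> t - x)"
        using norm_triangle_ineq[of "\<psi> t - \<phi> t" "\<phi> t - x"] by simp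
      ultimately show "\<phi> t \<in> U" "\<psi> t \<in> U"
        using rho by (simp_all add: dist_norm norm_minus_commute)
    qed
    define c where "c = (\<lambda>t. a t + N (\<psi> t) (M (\<phi> t) (a t) - M (\<psi> t) (a t) + z))"
    have "frame_curve \<Omega> Y b' \<psi>"
      unfolding frame_curve_def
    proof (intro conjI exI[of _ c] exI[of _ Z] ballI allI)
      show "absolutely_continuous_on_interval 0 1 \<psi>"
      proof (rule absolutely_continuous_dominated[OF ac, of 1 "norm z"])
        fix s t :: real
        have "\<psi> s - \<psi> t = (\<phi> s - \<phi> t) + (s - t) *\<^sub>R z" by (simp add: \<psi>_def scaleR_diff_left)
        then show "dist (\<psi> s) (\<psi> t) \<le> 1 * dist (\<phi> s) (\<phi> t) + norm z * \<bar>s - t\<bar>"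
          using norm_triangle_ineq[of "\<phi> s - \<phi> t" "(s - t) *\<^sub>R z"] by (simp add: dist_norm mult.commute)
      qed auto
      show "\<psi> ` {0..1} \<subseteq> \<Omega>" using \<psi>_in sub by blast
      fix t assume t: "t \<in> {0..1} - Z"
      then have t01: "t \<in> {0..1}" by simp
      have "M (\<psi> t) (c t) = M (\<phi> t) (a t) + z"
        unfolding c_def linear_add[OF frame_comb_linear] M_N[OF \<psi>_in[OF t01]] by simp
      then show "(\<psi> has_vector_derivative M (\<psi> t) (c t)) (at t within {0..1})"
        using d[OF t] unfolding \<psi>_def by (auto intro!: derivative_eq_intros)
      fix k
      have "norm (M (\<phi> t) (a t) - M (\<psi> t) (a t) + z) \<le> P * L * norm (a t) * norm (\<phi> t - \<psi> t) + norm z"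
        by (rule order_trans[OF norm_triangle_ineq add_mono[OF M_lip[OF \<phi>_in[OF t01] \<psi>_in[OF t01]] order_refl]])
      also have "\<dots> \<le> P * L * (P * \<kappa>) * norm z + norm z"
        using na[OF t] \<psi>\<phi>[OF t01] P1 L1 kappa_pos by (intro add_mono mult_mono) (auto simp: norm_minus_commute)
      finally have "L * norm (M (\<phi> t) (a t) - M (\<psi> t) (a t) + z) \<le> L * (P * L * (P * \<kappa>) * norm z + norm z)"
        using L1 by (intro mult_left_mono) auto
      also have "\<dots> = C * norm z" by (simp add: C_def algebra_simps)
      also have "\<dots> \<le> C * (m / C)" using y \<open>C > 0\<close> by (intro mult_left_mono) (auto simp: e_def z_def)
      also have "\<dots> = m" using \<open>C > 0\<close> by simp
      finally have "norm (N (\<psi> t) (M (\<phi> t) (a t) - M (\<psi> t) (a t) + z)) \<le> m"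
        using N_bd[OF \<psi>_in[OF t01]] order_trans by blast
      then have "\<bar>N (\<psi> t) (M (\<phi> t) (a t) - M (\<psi> t) (a t) + z) $ k\<bar> \<le> m"
        using component_le_norm_cart order_trans by blast
      then show "\<bar>c t $ k\<bar> \<le> b' k" using a[OF t, of k] m[of k] by (simp add: c_def)
    qed (rule Z)
    moreover have "\<psi> 0 = x" "\<psi> 1 = y" using \<phi>0 by (simp_all add: \<psi>_def z_def)
    ultimately show ?thesis by blast
  qed
  with \<open>e > 0\<close> show ?thesis by blast
qed

lemma open_frame_reach:
  assumes R: "0 < R" "R \<le> R0"
  shows "open (reach R)"
  unfolding open_dist
proof
  fix y assume "y \<in> reach R"
  then obtain \<phi> d where \<phi>: "y = \<phi> 1" "\<phi> 0 = x" "0 < d" "d < R" "frame_curve \<Omega> Y (\<lambda>k. d ^ w k) \<phi>"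
    unfolding frame_reach_def by blast
  \<comment> \<open>The room between \<open>d\<close> and \<open>R\<close> supplies the gap that the
    perturbation needs.\<close>
  obtain d' where d': "d < d'" "d' < R" using \<phi>(4) dense by blast
  have "d ^ w k \<le> \<kappa>" for k
  proof -
    have "d ^ w k \<le> d ^ 1" using \<phi>(3,4) R0_le(2)[OF R] w1 by (intro power_decreasing) auto
    then show ?thesis using \<phi>(4) R0_le(1)[OF R] by simp
  qed
  moreover have "d ^ w k < d' ^ w k" for k
    using d' \<phi>(3) w1[of k] by (intro power_strict_mono) auto
  ultimately obtain e where "e > 0"
    "\<And>y. norm (y - \<phi> 1) < e \<Longrightarrow> \<exists>\<psi>. frame_curve \<Omega> Y (\<lambda>k. d' ^ w k) \<psi> \<and> \<psi> 0 = x \<and> \<psi> 1 = y"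
    using frame_curve_perturb[OF \<phi>(5,2)] by metis
  moreover have "d' > 0" using d' \<phi>(3) by simp
  ultimately show "\<exists>e>0. \<forall>z. dist z y < e \<longrightarrow> z \<in> reach R"
    using d'(2) unfolding frame_reach_def dist_norm \<phi>(1) by blast
qed

text \<open>\<open>E\<close> and its inverse are Lipschitz with constant \<open>2 * L\<close>, and
  the measure estimate is applied to both. Invariance of domain provides the open image required for
  the inverse.\<close>

lemma measure_E_weighted_box:
  assumes R: "0 < R" "R \<le> 1" "P * R \<le> \<epsilon>"
  shows "E ` wbox R \<in> lmeasurable"
    and "measure lebesgue (E ` wbox R) \<le> (4 * L * P) ^ CARD('p) * measure lebesgue (wbox R)"
    and "measure lebesgue (wbox R) \<le> (4 * L * P) ^ CARD('p) * measure lebesgue (E ` wbox R)"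
proof -
  let ?U = "wbox R"
  have U: "norm u \<le> \<epsilon>" if "u \<in> ?U" for u using weighted_box_in_cball[OF R that] .
  have lip: "norm (E u - E v) \<le> (2 * L) * norm (u - v)" and ex: "norm (u - v) \<le> (2 * L) * norm (E u - E v)"
    if "u \<in> ?U" "v \<in> ?U" for u v
    using E_lipschitz E_expanding U that by auto
  have inj: "inj_on E ?U" using ex by (auto intro!: inj_onI) (metis norm_zero mult_zero_right norm_le_zero_iff eq_iff_diff_eq_0)
  have cont: "continuous_on ?U E"
    using lip L1 by (intro lipschitz_on_continuous_on[of "2 * L"] lipschitz_onI) (auto simp: dist_norm)
  have op: "open (E ` ?U)" using invariance_of_domain[OF cont open_weighted_box inj] .
  have "E ` ?U \<subseteq> U" using flow_in[of _ 1] U by (auto simp: E_def)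
  then have bd: "bounded (E ` ?U)" using bounded_cball bounded_subset by blast
  show "E ` ?U \<in> lmeasurable" using op bd by (simp add: lmeasurable_open)
  show "measure lebesgue (E ` ?U) \<le> (4 * L * P) ^ CARD('p) * measure lebesgue ?U"
    using measure_lipschitz_image_le[OF open_weighted_box bounded_weighted_box _ lip] L1
    by (simp add: P_def DIM_cart mult.assoc)
  have inv: "inv_into ?U E ` (E ` ?U) = ?U"
    by (rule inv_into_image_cancel[OF inj order_refl])
  have "measure lebesgue (inv_into ?U E ` (E ` ?U)) \<le> (2 * (2 * L) * real DIM(real^'p)) ^ DIM(real^'p) * measure lebesgue (E ` ?U)"
  proof (rule measure_lipschitz_image_le[OF op bd])
    fix y z assume "y \<in> E ` ?U" "z \<in> E ` ?U"
    then show "norm (inv_into ?U E y - inv_into ?U E z) \<le> 2 * L * norm (y - z)"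
      using ex inj by auto
  qed (use L1 in auto)
  then show "measure lebesgue ?U \<le> (4 * L * P) ^ CARD('p) * measure lebesgue (E ` ?U)"
    unfolding inv by (simp add: P_def DIM_cart mult.assoc)
qed

lemma measure_frame_reach:
  assumes R: "0 < R" "R \<le> R0"
  shows "1 / (4 * L * P) ^ CARD('p) * R ^ (\<Sum>k\<in>UNIV. w k) \<le> measure lebesgue (reach R)"
    and "measure lebesgue (reach R) \<le>
      (4 * L * P) ^ CARD('p) * (2 ^ CARD('p) * (1 / \<kappa>) ^ (\<Sum>k\<in>UNIV. w k)) * R ^ (\<Sum>k\<in>UNIV. w k)"
proof -
  have RK: "0 < R / \<kappa>" using R kappa_pos by simp
  note mK = measure_E_weighted_box[OF RK R0_kappa[OF R(2)]]
  note m = measure_E_weighted_box[OF R(1) R0_le(2,3)[OF R]]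
  have sub: "reach R \<subseteq> E ` wbox (R / \<kappa>)" by (rule frame_reach_subset_image[OF R])
  have "reach R \<in> sets lebesgue"
    using open_frame_reach[OF R] by (simp add: lborelD)
  then have reach: "reach R \<in> lmeasurable"
    by (rule fmeasurableI2[OF mK(1) sub])
  have pos: "0 < (4 * L * P) ^ CARD('p)" using L1 P1 by simp
  have "R ^ (\<Sum>k\<in>UNIV. w k) \<le> 2 ^ CARD('p) * R ^ (\<Sum>k\<in>UNIV. w k)" using R by simp
  also have "\<dots> \<le> (4 * L * P) ^ CARD('p) * measure lebesgue (E ` wbox R)"
    using m(3) by (simp add: measure_weighted_box[OF R(1)])
  also have "\<dots> \<le> (4 * L * P) ^ CARD('p) * measure lebesgue (reach R)"
    using pos m(1) reach frame_box_subset_reach[OF R] frame_box_eq[OF R(1) R0_le(2,3)[OF R]]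
    by (intro mult_left_mono measure_mono_fmeasurable) (auto simp: fmeasurableD)
  finally show "1 / (4 * L * P) ^ CARD('p) * R ^ (\<Sum>k\<in>UNIV. w k) \<le> measure lebesgue (reach R)"
    using pos by (simp add: field_simps)
  have "measure lebesgue (reach R) \<le> measure lebesgue (E ` wbox (R / \<kappa>))"
    using reach mK(1) sub by (intro measure_mono_fmeasurable) (auto simp: fmeasurableD)
  also have "\<dots> \<le> (4 * L * P) ^ CARD('p) * (2 ^ CARD('p) * (R / \<kappa>) ^ (\<Sum>k\<in>UNIV. w k))"
    using mK(2) by (simp add: measure_weighted_box[OF RK])
  finally show "measure lebesgue (reach R) \<le>
      (4 * L * P) ^ CARD('p) * (2 ^ CARD('p) * (1 / \<kappa>) ^ (\<Sum>k\<in>UNIV. w k)) * R ^ (\<Sum>k\<in>UNIV. w k)"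
    by (simp add: power_divide)
qed

end

subsection \<open>Uniform constants on compact sets\<close>

lemma smooth_on_imp_continuous: "smooth_on f S \<Longrightarrow> continuous_on S f"
  unfolding smooth_on_def using Ck_on.simps(1) by blast

text \<open>Each directional derivative is continuous, hence bounded on \<open>K\<close>; expansion
  in a basis gives a bound uniform in the direction.\<close>

lemma frechet_derivative_bound_compact:
  fixes f :: "'a::euclidean_space \<Rightarrow> 'b::real_normed_vector"
  assumes f: "smooth_on f S" and K: "compact K" "K \<subseteq> S"
  shows "\<exists>B\<ge>0. \<forall>y\<in>K. \<forall>v. norm (fderiv f y v) \<le> B * norm v"
proof -
  have "\<exists>b\<ge>0. \<forall>y\<in>K. norm (fderiv f y v) \<le> b" for v
  proof -
    have "continuous_on K (\<lambda>y. fderiv f y v)"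
      by (rule continuous_on_subset[OF smooth_on_imp_continuous[OF smooth_on_derivative[OF f]] K(2)])
    then have "bounded ((\<lambda>y. fderiv f y v) ` K)"
      using K compact_continuous_image compact_imp_bounded by blast
    then obtain c where "c > 0" "\<And>z. z \<in> (\<lambda>y. fderiv f y v) ` K \<Longrightarrow> norm z \<le> c" unfolding bounded_pos by blast
    then show ?thesis by (intro exI[of _ c]) auto
  qed
  then obtain b where b: "\<And>v. b v \<ge> 0" "\<And>v y. y \<in> K \<Longrightarrow> norm (fderiv f y v) \<le> b v"
    by metis
  have "norm (fderiv f y v) \<le> (\<Sum>i\<in>Basis. b i) * norm v" if y: "y \<in> K" for y v
  proof -
    have "fderiv f y v = (\<Sum>i\<in>Basis. (v \<bullet> i) *\<^sub>R fderiv f y i)"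
      using y K(2) by (intro derivative_basis_expansion[OF f]) auto
    also have "norm \<dots> \<le> (\<Sum>i\<in>Basis. norm v * b i)"
      using b(2)[OF y] by (intro order_trans[OF norm_sum] sum_mono) (auto intro!: mult_mono simp: Basis_le_norm)
    finally show ?thesis unfolding sum_distrib_left[symmetric] by (simp only: mult.commute)
  qed
  then show ?thesis using b(1) by (intro exI[of _ "\<Sum>i\<in>Basis. b i"]) (auto intro: sum_nonneg)
qed

text \<open>Compactness of \<open>K\<close> times the unit sphere gives a positive minimum;
  homogeneity in \<open>u\<close> does the rest.\<close>

lemma frame_comb_lower_bound_compact:
  fixes Y :: "'p::finite \<Rightarrow> real^'p \<Rightarrow> real^'p"
  assumes K: "compact K" and cont: "\<And>k. continuous_on K (Y k)"
    and inj: "\<And>y u. y \<in> K \<Longrightarrow> frame_comb Y y u = 0 \<Longrightarrow> u = 0"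
  shows "\<exists>B\<ge>0. \<forall>y\<in>K. \<forall>u. norm u \<le> B * norm (frame_comb Y y u)"
proof (cases "K = {}")
  case False
  let ?S = "K \<times> sphere (0::real^'p) 1"
  let ?g = "\<lambda>p. norm (frame_comb Y (fst p) (snd p))"
  have "continuous_on ?S ?g"
    unfolding frame_comb_def
    by (intro continuous_intros continuous_on_compose2[OF cont]) auto
  moreover have "compact ?S" using K by (intro compact_Times) auto
  moreover have "?S \<noteq> {}" using False by auto
  ultimately obtain p where p: "p \<in> ?S" "\<And>q. q \<in> ?S \<Longrightarrow> ?g p \<le> ?g q"
    using continuous_attains_inf[of ?S ?g] by blast
  have pos: "?g p > 0"
  proof -
    have "fst p \<in> K" "snd p \<noteq> 0" using p(1) by (auto simp: mem_Times_iff)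
    then show ?thesis using inj[of "fst p" "snd p"] by auto
  qed
  have "norm u \<le> 1 / ?g p * norm (frame_comb Y y u)" if y: "y \<in> K" for y u
  proof (cases "u = 0")
    case False
    have "?g p \<le> norm (frame_comb Y y (u /\<^sub>R norm u))"
      using p(2)[of "(y, u /\<^sub>R norm u)"] y False by simp
    also have "\<dots> = norm (frame_comb Y y u) / norm u"
      by (simp add: linear_cmul[OF frame_comb_linear] divide_inverse_commute)
    finally show ?thesis using pos False by (simp add: field_simps)
  qed simp
  then show ?thesis using pos by (intro exI[of _ "1 / ?g p"]) simp
qed auto

text \<open>All bounds are taken on one compact neighbourhood of \<open>K\<close> that contains
  every closed \<rho>-ball centred in \<open>K\<close>, and \<open>L\<close> is the sum of these
  bounds, so the same pair of constants serves all centres.\<close>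

lemma exists_frame_ball:
  fixes Y :: "'p::finite \<Rightarrow> real^'p \<Rightarrow> real^'p"
  assumes "open \<Omega>" and K: "compact K" "K \<subseteq> \<Omega>"
    and smooth: "\<And>k. smooth_on (Y k) \<Omega>"
    and inj: "\<And>y u. y \<in> \<Omega> \<Longrightarrow> frame_comb Y y u = 0 \<Longrightarrow> u = 0"
    and bracket: "\<And>i j y. y \<in> \<Omega> \<Longrightarrow>
      \<exists>c. lie_bracket (Y i) (Y j) y = frame_comb Y y c \<and> (\<forall>k. w i + w j < w k \<longrightarrow> c $ k = 0)"
    and w1: "\<And>k. 1 \<le> w k"
  shows "\<exists>\<rho> L. \<forall>x\<in>K. frame_ball \<Omega> Y w (\<lambda>k y. fderiv (Y k) y) x \<rho> L"
proof -
  let ?DY = "\<lambda>k y. fderiv (Y k) y"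
  obtain e where e: "e > 0" "(\<Union>x\<in>K. ball x e) \<subseteq> \<Omega>"
    using compact_subset_open_imp_ball_epsilon_subset[OF K(1) \<open>open \<Omega>\<close> K(2)] by blast
  define \<rho> where "\<rho> = e / 2"
  have \<rho>: "\<rho> > 0" using e by (simp add: \<rho>_def)
  define K' where "K' = {x + y | x y. x \<in> K \<and> y \<in> cball 0 \<rho>}"
  have K': "compact K'" unfolding K'_def by (intro compact_sums K compact_cball)
  have cbK: "cball x \<rho> \<subseteq> K'" if "x \<in> K" for x
  proof
    fix y assume "y \<in> cball x \<rho>"
    then have "y = x + (y - x)" "y - x \<in> cball 0 \<rho>" by (auto simp: dist_norm norm_minus_commute)
    then show "y \<in> K'" using that unfolding K'_def by blast
  qed
  have K'\<Omega>: "K' \<subseteq> \<Omega>"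
  proof
    fix z assume "z \<in> K'"
    then obtain x y where "z = x + y" "x \<in> K" "norm y \<le> \<rho>" by (auto simp: K'_def)
    then have "z \<in> ball x e" using e(1) by (simp add: dist_norm \<rho>_def)
    then show "z \<in> \<Omega>" using e(2) \<open>x \<in> K\<close> by blast
  qed
  have contK': "continuous_on K' (Y k)" for k
    by (rule continuous_on_subset[OF smooth_on_imp_continuous[OF smooth] K'\<Omega>])
  have "\<exists>b\<ge>0. \<forall>y\<in>K'. norm (Y k y) \<le> b" for k
  proof -
    have "bounded (Y k ` K')" using K' contK' compact_continuous_image compact_imp_bounded by blast
    then obtain c where "c > 0" "\<And>z. z \<in> Y k ` K' \<Longrightarrow> norm z \<le> c" unfolding bounded_pos by blast
    then show ?thesis by (intro exI[of _ c]) auto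
  qed
  then obtain b0 where b0: "\<And>k. b0 k \<ge> 0" "\<And>k y. y \<in> K' \<Longrightarrow> norm (Y k y) \<le> b0 k" by metis
  have "\<forall>k. \<exists>b. 0 \<le> b \<and> (\<forall>y\<in>K'. \<forall>v. norm (?DY k y v) \<le> b * norm v)"
    using frechet_derivative_bound_compact[OF smooth K' K'\<Omega>] by blast
  from choice[OF this] obtain b1 where b1: "\<And>k. b1 k \<ge> 0" "\<And>k y v. y \<in> K' \<Longrightarrow> norm (?DY k y v) \<le> b1 k * norm v"
    by blast
  note smooth' = smooth_on_derivative[OF smooth]
  define Q where "Q = (\<lambda>k i b. 0 \<le> b \<and> (\<forall>y\<in>K'. \<forall>v. norm (fderiv (\<lambda>y. ?DY k y i) y v) \<le> b * norm v))"
  define b2 where "b2 = (\<lambda>k i. SOME b. Q k i b)"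
  have "Q k i (b2 k i)" for k i
    using frechet_derivative_bound_compact[OF smooth' K' K'\<Omega>, of k i] unfolding b2_def Q_def by (rule someI_ex)
  then have b2: "\<And>k i. b2 k i \<ge> 0"
    "\<And>k i y v. y \<in> K' \<Longrightarrow> norm (fderiv (\<lambda>y. ?DY k y i) y v) \<le> b2 k i * norm v"
    unfolding Q_def by blast+
  obtain B where B: "B \<ge> 0" "\<And>y u. y \<in> K' \<Longrightarrow> norm u \<le> B * norm (frame_comb Y y u)"
  proof -
    have "\<exists>B\<ge>0. \<forall>y\<in>K'. \<forall>u. norm u \<le> B * norm (frame_comb Y y u)"
      by (rule frame_comb_lower_bound_compact[OF K' contK']) (use inj K'\<Omega> in blast)
    then obtain B where "0 \<le> B" "\<forall>y\<in>K'. \<forall>u. norm u \<le> B * norm (frame_comb Y y u)"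
      by (elim exE conjE)
    then show ?thesis by (intro that[of B]) auto
  qed
  define c2 where "c2 k = (\<Sum>i\<in>Basis. b2 k i)" for k
  have c2: "c2 k \<ge> 0" for k using b2 by (simp add: c2_def sum_nonneg)
  define L where "L = 1 + (\<Sum>k\<in>UNIV. b0 k) + (\<Sum>k\<in>UNIV. b1 k) + (\<Sum>k\<in>UNIV. c2 k) + B"
  have sums: "0 \<le> (\<Sum>k\<in>UNIV. b0 k)" "0 \<le> (\<Sum>k\<in>UNIV. b1 k)" "0 \<le> (\<Sum>k\<in>UNIV. c2 k)"
    using b0 b1 c2 by (auto intro: sum_nonneg)
  have mem: "b1 k \<le> (\<Sum>k\<in>UNIV. b1 k)" "c2 k \<le> (\<Sum>k\<in>UNIV. c2 k)" for k
    using b1 c2 by (auto intro!: member_le_sum)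
  have L: "1 \<le> L" "(\<Sum>k\<in>UNIV. b0 k) \<le> L" "b1 k \<le> L" "c2 k \<le> L" "B \<le> L" for k
    using sums B(1) mem(1)[of k] mem(2)[of k] unfolding L_def by linarith+
  have hasd: "(Y k has_derivative ?DY k y) (at y)" if "y \<in> K'" for k y
    by (rule smooth_on_has_derivative[OF smooth]) (use that K'\<Omega> in blast)
  have lin: "linear (?DY k y)" if "y \<in> K'" for k y
    using hasd[OF that] has_derivative_linear by blast
  have "frame_ball \<Omega> Y w ?DY x \<rho> L" if x: "x \<in> K" for x
  proof
    show "0 < \<rho>" by (rule \<rho>)
    show "1 \<le> L" by (rule L)
    show "cball x \<rho> \<subseteq> \<Omega>" using cbK[OF x] K'\<Omega> by blast
    fix y assume y: "y \<in> cball x \<rho>"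
    then have yK: "y \<in> K'" using cbK[OF x] by blast
    show "(Y k has_derivative ?DY k y) (at y)" for k by (rule hasd[OF yK])
    show "norm (frame_comb Y y u) \<le> L * norm u" for u
    proof -
      have "norm (frame_comb Y y u) \<le> (\<Sum>k\<in>UNIV. norm u * b0 k)"
        unfolding frame_comb_def using b0(2)[OF yK]
        by (intro order_trans[OF norm_sum] sum_mono) (auto intro!: mult_mono simp: component_le_norm_cart)
      also have "\<dots> = norm u * (\<Sum>k\<in>UNIV. b0 k)" by (simp add: sum_distrib_left)
      also have "\<dots> \<le> norm u * L" using L by (intro mult_left_mono) auto
      finally show ?thesis by (simp add: mult.commute)
    qed
    show "norm u \<le> L * norm (frame_comb Y y u)" for u
      using B(2)[OF yK, of u] mult_right_mono[OF L(5), of "norm (frame_comb Y y u)"] by simp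
    show "norm (?DY k y v) \<le> L * norm v" for k v
      using b1(2)[OF yK, of k v] mult_right_mono[OF L(3), of "norm v" k] by simp
    show "\<exists>c. ?DY j y (Y i y) - ?DY i y (Y j y) = frame_comb Y y c \<and> (\<forall>k. w i + w j < w k \<longrightarrow> c $ k = 0)" for i j
      using bracket[of y i j] yK K'\<Omega> unfolding lie_bracket_def by blast
    fix z k assume z: "z \<in> cball x \<rho>"
    \<comment> \<open>The derivative of \<open>f\<close> vanishes at \<open>y\<close> and grows at
      most linearly along the segment, so the mean value inequality gives a quadratic
      remainder.\<close>
    define f where "f = (\<lambda>a. Y k a - ?DY k y a)"
    have seg: "closed_segment y z \<subseteq> cball x \<rho>"
      using y z convex_cball[of x \<rho>] closed_segment_subset by blast
    have "norm (f z - f y) \<le> L * norm (z - y) * norm (z - y)"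
    proof (rule differentiable_bound[of "closed_segment y z" f "\<lambda>a h. ?DY k a h - ?DY k y h"])
      fix a assume a: "a \<in> closed_segment y z"
      then have aK: "a \<in> K'" and acb: "a \<in> cball x \<rho>" using seg cbK[OF x] by blast+
      show "(f has_derivative (\<lambda>h. ?DY k a h - ?DY k y h)) (at a within closed_segment y z)"
        unfolding f_def using has_derivative_at_withinI[OF hasd[OF aK]] lin[OF yK]
        by (intro has_derivative_diff linear_imp_has_derivative)
      have "norm (?DY k a h - ?DY k y h) \<le> L * norm (z - y) * norm h" for h
      proof -
        have di: "norm (?DY k a i - ?DY k y i) \<le> b2 k i * norm (a - y)" for i
        proof (rule differentiable_bound[OF convex_cball[of x \<rho>] _ _ acb y, of "\<lambda>y. ?DY k y i" "\<lambda>y. fderiv (\<lambda>y. ?DY k y i) y"])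
          fix c assume "c \<in> cball x \<rho>"
          then have cK: "c \<in> K'" using cbK[OF x] by blast
          show "((\<lambda>y. ?DY k y i) has_derivative fderiv (\<lambda>y. ?DY k y i) c) (at c within cball x \<rho>)"
            by (rule has_derivative_at_withinI[OF smooth_on_has_derivative[OF smooth']]) (use cK K'\<Omega> in blast)
          show "onorm (fderiv (\<lambda>y. ?DY k y i) c) \<le> b2 k i"
            using b2(2)[OF cK] by (rule onorm_le)
        qed
        have "?DY k a h - ?DY k y h = (\<Sum>i\<in>Basis. (h \<bullet> i) *\<^sub>R (?DY k a i - ?DY k y i))"
          unfolding scaleR_diff_right sum_subtractf using aK yK K'\<Omega>
          by (intro arg_cong2[where f = minus] derivative_basis_expansion[OF smooth]) auto
        also have "norm \<dots> \<le> (\<Sum>i\<in>Basis. norm h * (b2 k i * norm (a - y)))"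
          using di by (intro order_trans[OF norm_sum] sum_mono) (auto intro!: mult_mono simp: Basis_le_norm)
        also have "\<dots> = c2 k * norm (a - y) * norm h"
          by (simp add: c2_def sum_distrib_left sum_distrib_right mult_ac)
        also have "\<dots> \<le> L * norm (z - y) * norm h"
          using L(4)[of k] c2[of k] L(1) segment_bound(1)[OF a]
          by (intro mult_right_mono mult_mono) (auto simp: norm_minus_commute)
        finally show ?thesis .
      qed
      then show "onorm (\<lambda>h. ?DY k a h - ?DY k y h) \<le> L * norm (z - y)" by (rule onorm_le)
    qed auto
    then show "norm (Y k z - Y k y - ?DY k y (z - y)) \<le> L * (norm (z - y))\<^sup>2"
      by (simp add: f_def linear_diff[OF lin[OF yK]] power2_eq_square algebra_simps)
  qed (rule w1)
  then show ?thesis by blast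
qed

subsection \<open>Carnot-Caratheodory balls and boxes\<close>

text \<open>Expand the commutator in the basis at \<open>x\<close>. Freeness lifts this relation to
  the free algebra, where homogeneity isolates the part of weight \<open>weight K\<close>, and
  substitution of the fields returns it to \<open>x\<close>. Only basis elements of exactly that
  weight survive.\<close>

lemma commutator_in_lower_span:
  fixes X :: "nat \<Rightarrow> real^'p \<Rightarrow> real^'p"
  assumes "open \<Omega>" and X: "\<forall>i\<in>{0..n}. smooth_on (X i) \<Omega>"
    and free: "free_up_to_weight n r \<Omega> X" and basis: "commutator_basis n r \<Omega> X B"
    and K: "K \<in> multiindices n r" and x: "x \<in> \<Omega>"
  shows "comm_field X K x \<in> span ((\<lambda>L. comm_field X L x) ` {L \<in> B. weight L \<le> weight K})"
proof -
  interpret smooth_fields \<Omega> n X using assms(1,2) by unfold_locales auto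
  have B: "B \<subseteq> multiindices n r" and inj: "inj_on (\<lambda>I. comm_field X I x) B"
    and sp: "span ((\<lambda>I. comm_field X I x) ` B) = UNIV"
    using basis x unfolding commutator_basis_def by auto
  have finB: "finite B" using B finite_multiindices finite_subset by blast
  have "comm_field X K x \<in> span ((\<lambda>I. comm_field X I x) ` B)" using sp by simp
  then obtain u where "comm_field X K x = (\<Sum>v\<in>(\<lambda>I. comm_field X I x) ` B. u v *\<^sub>R v)"
    using finB by (subst (asm) span_finite) auto
  then have K_eq: "comm_field X K x = (\<Sum>L\<in>B. u (comm_field X L x) *\<^sub>R comm_field X L x)"
    by (simp add: sum.reindex[OF inj])
  define c where "c = (\<lambda>L. if L \<in> B then u (comm_field X L x) else 0)"
  \<comment> \<open>The basis expansion written as a vanishing combination of all commutators of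
    weight at most \<open>r\<close>; the index \<open>K\<close> may itself belong to
    \<open>B\<close>.\<close>
  define a where "a = (\<lambda>L. c L - (if L = K then 1 else 0 :: real))"
  have split: "(\<Sum>I\<in>A. a I *\<^sub>R comm_field X I x) = (\<Sum>I\<in>A \<inter> B. c I *\<^sub>R comm_field X I x) - comm_field X K x"
    if "finite A" "K \<in> A" for A
  proof -
    have "(\<Sum>I\<in>A. (if I = K then 1 else 0 :: real) *\<^sub>R comm_field X I x) = comm_field X K x"
      using that by (simp add: if_distrib[of "\<lambda>z. z *\<^sub>R _"] cong: if_cong)
    moreover have "(\<Sum>I\<in>A. c I *\<^sub>R comm_field X I x) = (\<Sum>I\<in>A \<inter> B. c I *\<^sub>R comm_field X I x)"
      using that by (intro sum.mono_neutral_right) (auto simp: c_def)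
    ultimately show ?thesis by (simp add: a_def scaleR_diff_left sum_subtractf)
  qed
  have "(\<Sum>I\<in>multiindices n r. a I *\<^sub>R comm_field X I x) = 0"
    unfolding split[OF finite_multiindices K] Int_absorb1[OF B] by (simp add: K_eq c_def)
  then have rel: "(\<Sum>I\<in>multiindices n r. a I * comm_coeff I J) = 0" for J
    using free x unfolding free_up_to_weight_def by blast
  define A where "A = {I \<in> multiindices n r. weight I = weight K}"
  have finA: "finite A" unfolding A_def using finite_multiindices by simp
  have zero: "comm_coeff I J = 0" if "I \<in> multiindices n r" "weight I \<noteq> weight J" for I J
    using comm_coeff_weight[of I J] that by (auto simp: multiindices_def)
  \<comment> \<open>For words of weight \<open>weight K\<close> the restricted and the full sum
    agree; for all other words every summand is zero.\<close>
  have "(\<Sum>I\<in>A. a I * comm_coeff I J) = 0" for J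
  proof (cases "weight J = weight K")
    case True
    have "(\<Sum>I\<in>A. a I * comm_coeff I J) = (\<Sum>I\<in>multiindices n r. a I * comm_coeff I J)"
      using zero True finite_multiindices by (intro sum.mono_neutral_left) (auto simp: A_def)
    then show ?thesis using rel by simp
  next
    case False
    then show ?thesis using zero by (intro sum.neutral) (auto simp: A_def)
  qed
  then have "(\<Sum>I\<in>A. a I *\<^sub>R comm_field X I x) = 0"
    using finA x by (intro relation_transfer) (auto simp: A_def multiindices_def)
  then have "comm_field X K x = (\<Sum>I\<in>A \<inter> B. c I *\<^sub>R comm_field X I x)"
    using split[OF finA] K by (simp add: A_def)
  also have "\<dots> \<in> span ((\<lambda>L. comm_field X L x) ` {L \<in> B. weight L \<le> weight K})"
    by (intro span_sum span_scale span_base) (auto simp: A_def)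
  finally show ?thesis .
qed

text \<open>If the combined weight is at most \<open>r\<close>, the bracket is a combination of
  commutators of that weight, each handled by \<open>commutator_in_lower_span\<close>. Otherwise the
  bound on the weight admits the entire basis.\<close>

lemma bracket_in_filtered_span:
  fixes X :: "nat \<Rightarrow> real^'p \<Rightarrow> real^'p"
  assumes "open \<Omega>" and X: "\<forall>i\<in>{0..n}. smooth_on (X i) \<Omega>"
    and free: "free_up_to_weight n r \<Omega> X" and basis: "commutator_basis n r \<Omega> X B"
    and I: "I \<in> B" and J: "J \<in> B" and x: "x \<in> \<Omega>"
  shows "lie_bracket (comm_field X I) (comm_field X J) x \<in>
    span ((\<lambda>L. comm_field X L x) ` {L \<in> B. weight L \<le> weight I + weight J})"
proof -
  interpret smooth_fields \<Omega> n X using assms(1,2) by unfold_locales auto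
  have B: "B \<subseteq> multiindices n r" and sp: "span ((\<lambda>I. comm_field X I x) ` B) = UNIV"
    using basis x unfolding commutator_basis_def by auto
  show ?thesis
  proof (cases "weight I + weight J \<le> r")
    case True
    have "(\<lambda>K. comm_field X K x) ` {K. K \<noteq> [] \<and> set K \<subseteq> {0..n} \<and> weight K = weight I + weight J} \<subseteq>
        span ((\<lambda>L. comm_field X L x) ` {L \<in> B. weight L \<le> weight I + weight J})"
    proof clarify
      fix K assume "K \<noteq> []" "set K \<subseteq> {0..n}" and wK: "weight K = weight I + weight J"
      then have "K \<in> multiindices n r" using True by (simp add: multiindices_def)
      from commutator_in_lower_span[OF assms(1-4) this x]
      show "comm_field X K x \<in> span ((\<lambda>L. comm_field X L x) ` {L \<in> B. weight L \<le> weight I + weight J})"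
        by (simp add: wK)
    qed
    from span_minimal[OF this subspace_span] show ?thesis
      using bracket_in_span[of I J x] I J B x by (auto simp: multiindices_def)
  next
    case False
    then have "{L \<in> B. weight L \<le> weight I + weight J} = B" using B by (auto simp: multiindices_def)
    then show ?thesis using sp by simp
  qed
qed

section \<open>Passing from multiindices in \<open>B\<close> to coordinate indices\<close>

lemma sum_eq_frame_comb:
  fixes \<beta> :: "'p::finite \<Rightarrow> nat list"
  assumes "bij_betw \<beta> UNIV B"
  shows "(\<Sum>I\<in>B. u I *\<^sub>R Z I y) = frame_comb (\<lambda>k. Z (\<beta> k)) y (\<chi> k. u (\<beta> k))"
  unfolding frame_comb_def using sum.reindex_bij_betw[OF assms, of "\<lambda>I. u I *\<^sub>R Z I y"] by simp

lemma cc_box_eq_frame_box: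
  fixes \<beta> :: "'p::finite \<Rightarrow> nat list"
  assumes \<beta>: "bij_betw \<beta> UNIV B"
  shows "cc_box \<Omega> B Z x R = frame_box \<Omega> (\<lambda>k. Z (\<beta> k)) (\<lambda>k. weight (\<beta> k)) x R"
proof -
  note comb = sum_eq_frame_comb[OF \<beta>, of _ Z]
  have ball: "(\<forall>I\<in>B. Q I) \<longleftrightarrow> (\<forall>k. Q (\<beta> k))" for Q
    using \<beta> by (auto simp: bij_betw_def)
  show ?thesis
  proof (intro equalityI subsetI)
    fix y assume "y \<in> cc_box \<Omega> B Z x R"
    then obtain u where u: "y = field_exp \<Omega> (\<lambda>y. \<Sum>I\<in>B. u I *\<^sub>R Z I y) x" "\<forall>I\<in>B. \<bar>u I\<bar> < R ^ weight I"
      unfolding cc_box_def by blast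
    have "(\<chi> k. u (\<beta> k)) \<in> weighted_box (\<lambda>k. weight (\<beta> k)) R"
      using u(2) unfolding ball weighted_box_def by simp
    then show "y \<in> frame_box \<Omega> (\<lambda>k. Z (\<beta> k)) (\<lambda>k. weight (\<beta> k)) x R"
      using u(1) unfolding comb frame_box_def by blast
  next
    fix y assume "y \<in> frame_box \<Omega> (\<lambda>k. Z (\<beta> k)) (\<lambda>k. weight (\<beta> k)) x R"
    then obtain v where v: "y = field_exp \<Omega> (\<lambda>y. frame_comb (\<lambda>k. Z (\<beta> k)) y v) x"
      "v \<in> weighted_box (\<lambda>k. weight (\<beta> k)) R"
      unfolding frame_box_def by blast
    define u where "u = (\<lambda>I. v $ the_inv \<beta> I)"
    have u\<beta>: "u (\<beta> k) = v $ k" for k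
      using \<beta> by (simp add: u_def bij_betw_def the_inv_f_f)
    have "\<forall>I\<in>B. \<bar>u I\<bar> < R ^ weight I"
      using v(2) unfolding ball u\<beta> weighted_box_def by simp
    moreover have "y = field_exp \<Omega> (\<lambda>y. \<Sum>I\<in>B. u I *\<^sub>R Z I y) x"
      unfolding comb u\<beta> using v(1) by simp
    ultimately show "y \<in> cc_box \<Omega> B Z x R" unfolding cc_box_def by blast
  qed
qed

lemma admissible_curves_eq_frame_curve:
  fixes \<beta> :: "'p::finite \<Rightarrow> nat list"
  assumes \<beta>: "bij_betw \<beta> UNIV B"
  shows "\<phi> \<in> admissible_curves \<Omega> B Z d \<longleftrightarrow> frame_curve \<Omega> (\<lambda>k. Z (\<beta> k)) (\<lambda>k. d ^ weight (\<beta> k)) \<phi>"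
proof -
  note comb = sum_eq_frame_comb[OF \<beta>, of _ Z]
  have ball: "(\<forall>I\<in>B. Q I) \<longleftrightarrow> (\<forall>k. Q (\<beta> k))" for Q
    using \<beta> by (auto simp: bij_betw_def)
  define D where "D = (\<lambda>a t. (\<phi> has_vector_derivative (\<Sum>I\<in>B. a I t *\<^sub>R Z I (\<phi> t))) (at t within {0..1}) \<and> (\<forall>I\<in>B. \<bar>a I t\<bar> \<le> d ^ weight I))"
  define F where "F = (\<lambda>v t. (\<phi> has_vector_derivative frame_comb (\<lambda>k. Z (\<beta> k)) (\<phi> t) v) (at t within {0..1}) \<and> (\<forall>k. \<bar>v $ k\<bar> \<le> d ^ weight (\<beta> k)))"
  have DF: "D a t \<longleftrightarrow> F (\<chi> k. a (\<beta> k) t) t" for a t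
    unfolding D_def F_def comb ball by simp
  have "(\<exists>a. AE t in lebesgue. t \<in> {0..1} \<longrightarrow> D a t) \<longleftrightarrow> (\<exists>a N. negligible N \<and> (\<forall>t\<in>{0..1} - N. F (a t) t))"
  proof
    assume "\<exists>a. AE t in lebesgue. t \<in> {0..1} \<longrightarrow> D a t"
    then obtain a N where N: "N \<in> null_sets lebesgue" "{t \<in> space lebesgue. \<not> (t \<in> {0..1} \<longrightarrow> D a t)} \<subseteq> N"
      unfolding eventually_ae_filter by blast
    have "F (\<chi> k. a (\<beta> k) t) t" if "t \<in> {0..1} - N" for t
      using N(2) that unfolding DF by auto
    moreover have "negligible N" using N(1) by (simp add: negligible_iff_null_sets)
    ultimately show "\<exists>a N. negligible N \<and> (\<forall>t\<in>{0..1} - N. F (a t) t)"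
      by (intro exI[of _ "\<lambda>t. \<chi> k. a (\<beta> k) t"] exI[of _ N]) simp
  next
    assume "\<exists>a N. negligible N \<and> (\<forall>t\<in>{0..1} - N. F (a t) t)"
    then obtain a N where N: "negligible N" and F: "\<And>t. t \<in> {0..1} - N \<Longrightarrow> F (a t) t" by blast
    define b where "b = (\<lambda>I t. a t $ the_inv \<beta> I)"
    have b\<beta>: "b (\<beta> k) t = a t $ k" for k t
      using \<beta> by (simp add: b_def bij_betw_def the_inv_f_f)
    have "D b t" if "t \<in> {0..1}" "t \<notin> N" for t
      using F[of t] that by (simp add: DF b\<beta>)
    then have "{t \<in> space lebesgue. \<not> (t \<in> {0..1} \<longrightarrow> D b t)} \<subseteq> N" by blast
    moreover have "N \<in> null_sets lebesgue" using N by (simp add: negligible_iff_null_sets)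
    ultimately have "AE t in lebesgue. t \<in> {0..1} \<longrightarrow> D b t"
      unfolding eventually_ae_filter by blast
    then show "\<exists>a. AE t in lebesgue. t \<in> {0..1} \<longrightarrow> D a t" by (intro exI[of _ b])
  qed
  then show ?thesis unfolding admissible_curves_def frame_curve_def D_def F_def by simp
qed

text \<open>An infimum is below \<open>R\<close> exactly if some element is; the end point lies in
  \<Omega> because admissible curves do.\<close>

lemma cc_ball_eq_frame_reach:
  fixes \<beta> :: "'p::finite \<Rightarrow> nat list"
  assumes \<beta>: "bij_betw \<beta> UNIV B"
  shows "cc_ball \<Omega> B Z x R = frame_reach \<Omega> (\<lambda>k. Z (\<beta> k)) (\<lambda>k. weight (\<beta> k)) x R"
proof (intro equalityI subsetI)
  fix y assume "y \<in> cc_ball \<Omega> B Z x R"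
  then have "Inf (ereal ` {\<delta>. \<delta> > 0 \<and> (\<exists>\<phi>\<in>admissible_curves \<Omega> B Z \<delta>. \<phi> 0 = x \<and> \<phi> 1 = y)}) < ereal R"
    by (simp add: cc_ball_def cc_dist_def)
  then obtain d \<phi> where "d > 0" "d < R" "\<phi> \<in> admissible_curves \<Omega> B Z d" "\<phi> 0 = x" "\<phi> 1 = y"
    unfolding Inf_less_iff by auto
  then show "y \<in> frame_reach \<Omega> (\<lambda>k. Z (\<beta> k)) (\<lambda>k. weight (\<beta> k)) x R"
    unfolding admissible_curves_eq_frame_curve[OF \<beta>] frame_reach_def by blast
next
  fix y assume "y \<in> frame_reach \<Omega> (\<lambda>k. Z (\<beta> k)) (\<lambda>k. weight (\<beta> k)) x R"
  then obtain d \<phi> where d: "d > 0" "d < R" "frame_curve \<Omega> (\<lambda>k. Z (\<beta> k)) (\<lambda>k. d ^ weight (\<beta> k)) \<phi>"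
    "\<phi> 0 = x" "\<phi> 1 = y"
    unfolding frame_reach_def by blast
  have "y \<in> \<Omega>" using d(3,5) unfolding frame_curve_def by force
  have "d \<in> {\<delta>. \<delta> > 0 \<and> (\<exists>\<phi>\<in>admissible_curves \<Omega> B Z \<delta>. \<phi> 0 = x \<and> \<phi> 1 = y)}"
    using d unfolding admissible_curves_eq_frame_curve[OF \<beta>, symmetric] by blast
  then have "cc_dist \<Omega> B Z x y < ereal R"
    unfolding cc_dist_def Inf_less_iff using d(2) by (intro bexI[of _ "ereal d"]) auto
  with \<open>y \<in> \<Omega>\<close> show "y \<in> cc_ball \<Omega> B Z x R" by (simp add: cc_ball_def)
qed

text \<open>The constants depend on \<rho>, \<open>L\<close>, the dimension and the weights, but not
  on the centre, so those obtained at one point \<open>x0\<close> serve at all others. If there is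
  no such point, the claim is vacuous.\<close>

lemma frame_ball_uniform:
  fixes Y :: "'p::finite \<Rightarrow> real^'p \<Rightarrow> real^'p"
  shows "\<exists>C R\<^sub>1 c\<^sub>1 c\<^sub>2 :: real. C > 0 \<and> R\<^sub>1 > 0 \<and> c\<^sub>1 > 0 \<and> c\<^sub>2 > 0 \<and>
    (\<forall>x. frame_ball \<Omega> Y w DY x \<rho> L \<longrightarrow> (\<forall>R. 0 < R \<and> R \<le> R\<^sub>1 \<longrightarrow>
      frame_box \<Omega> Y w x R \<subseteq> frame_reach \<Omega> Y w x R \<and>
      frame_reach \<Omega> Y w x R \<subseteq> frame_box \<Omega> Y w x (C * R) \<and>
      c\<^sub>1 * R ^ (\<Sum>k\<in>UNIV. w k) \<le> measure lebesgue (frame_reach \<Omega> Y w x R) \<and>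
      measure lebesgue (frame_reach \<Omega> Y w x R) \<le> c\<^sub>2 * R ^ (\<Sum>k\<in>UNIV. w k)))"
proof (cases "\<exists>x. frame_ball \<Omega> Y w DY x \<rho> L")
  case True
  then obtain x0 where "frame_ball \<Omega> Y w DY x0 \<rho> L" by blast
  then interpret x0: frame_ball \<Omega> Y w DY x0 \<rho> L .
  have pos: "0 < (4 * L * x0.P) ^ CARD('p)" using x0.L1 x0.P1 by simp
  show ?thesis
  proof (intro exI conjI allI impI)
    show "0 < 1 / x0.\<kappa>" using x0.kappa_pos by simp
    show "0 < x0.R0" by (rule x0.R0_pos)
    show "0 < 1 / (4 * L * x0.P) ^ CARD('p)" using pos by simp
    show "0 < (4 * L * x0.P) ^ CARD('p) * (2 ^ CARD('p) * (1 / x0.\<kappa>) ^ (\<Sum>k\<in>UNIV. w k))"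
      using pos x0.kappa_pos by (intro mult_pos_pos) auto
    fix x R assume "frame_ball \<Omega> Y w DY x \<rho> L" and R: "0 < R \<and> R \<le> x0.R0"
    then interpret frame_ball \<Omega> Y w DY x \<rho> L by simp
    have R': "0 < R" "R \<le> x0.R0" using R by auto
    show "frame_box \<Omega> Y w x R \<subseteq> frame_reach \<Omega> Y w x R" by (rule frame_box_subset_reach[OF R'])
    show "frame_reach \<Omega> Y w x R \<subseteq> frame_box \<Omega> Y w x (1 / x0.\<kappa> * R)" using frame_reach_subset_box[OF R'] by simp
    show "1 / (4 * L * x0.P) ^ CARD('p) * R ^ (\<Sum>k\<in>UNIV. w k) \<le> measure lebesgue (frame_reach \<Omega> Y w x R)"
      by (rule measure_frame_reach(1)[OF R'])
    show "measure lebesgue (frame_reach \<Omega> Y w x R) \<le>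
        (4 * L * x0.P) ^ CARD('p) * (2 ^ CARD('p) * (1 / x0.\<kappa>) ^ (\<Sum>k\<in>UNIV. w k)) * R ^ (\<Sum>k\<in>UNIV. w k)"
      by (rule measure_frame_reach(2)[OF R'])
  qed
next
  case False
  then show ?thesis by (intro exI[of _ 1]) auto
qed

theorem theorem20:
  fixes \<Omega> \<Omega>' :: "(real^'p) set"
    and X :: "nat \<Rightarrow> real^'p \<Rightarrow> real^'p"
    and n r :: nat
    and B :: "nat list set"
  assumes "open \<Omega>" and "connected \<Omega>" and "bounded \<Omega>"
    and "\<forall>i\<in>{0..n}. smooth_on (X i) \<Omega>"
    and "free_up_to_weight n r \<Omega> X"
    and "hoermander_condition n r \<Omega> X"
    and "commutator_basis n r \<Omega> X B"
    and "compact (closure \<Omega>')" and "closure \<Omega>' \<subseteq> \<Omega>"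
  shows "\<exists>C R\<^sub>0 c\<^sub>1 c\<^sub>2 c\<^sub>3 :: real. C > 0 \<and> R\<^sub>0 > 0 \<and> c\<^sub>1 > 0 \<and> c\<^sub>2 > 0 \<and> c\<^sub>3 > 0 \<and>
    (\<forall>x\<in>\<Omega>'. \<forall>R. 0 < R \<and> R \<le> R\<^sub>0 \<longrightarrow>
      (cc_box \<Omega> B (comm_field X) x R \<subseteq> cc_ball \<Omega> B (comm_field X) x R \<and>
       cc_ball \<Omega> B (comm_field X) x R \<subseteq> cc_box \<Omega> B (comm_field X) x (C * R)) \<and>
      (c\<^sub>1 * R ^ (\<Sum>I\<in>B. weight I) \<le> measure lebesgue (cc_ball \<Omega> B (comm_field X) x R) \<and>
       measure lebesgue (cc_ball \<Omega> B (comm_field X) x R) \<le> c\<^sub>2 * R ^ (\<Sum>I\<in>B. weight I)) \<and>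
      measure lebesgue (cc_ball \<Omega> B (comm_field X) x (2 * R))
        \<le> c\<^sub>3 * measure lebesgue (cc_ball \<Omega> B (comm_field X) x R))"
proof -
  have B: "B \<subseteq> multiindices n r" and card: "card B = CARD('p)"
    using assms(7) unfolding commutator_basis_def by auto
  have finB: "finite B" using B finite_multiindices finite_subset by blast
  \<comment> \<open>The basis has as many elements as there are coordinates, so its fields can be
    indexed by coordinates, and \<open>frame_comb\<close> becomes a square matrix at each
    point.\<close>
  obtain \<beta> :: "'p \<Rightarrow> nat list" where \<beta>: "bij_betw \<beta> UNIV B"
    using finite_same_card_bij[of "UNIV :: 'p set" B] finB card by auto
  define Y where "Y = (\<lambda>k. comm_field X (\<beta> k))"
  define w where "w = (\<lambda>k. weight (\<beta> k))"
  have \<beta>B: "\<beta> k \<in> B" for k using \<beta> by (auto simp: bij_betw_def)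
  interpret smooth_fields \<Omega> n X using assms(1,4) by unfold_locales auto
  have smooth: "smooth_on (Y k) \<Omega>" for k
    using smooth_comm_field[of "\<beta> k"] \<beta>B[of k] B unfolding Y_def multiindices_def by blast
  have w1: "1 \<le> w k" for k
  proof -
    have "\<beta> k \<noteq> []" using \<beta>B[of k] B by (auto simp: multiindices_def)
    then have "1 \<le> length (\<beta> k)" by (simp add: Suc_le_eq)
    then show ?thesis using length_le_weight[of "\<beta> k"] by (simp add: w_def)
  qed
  have Y_inj: "inj (\<lambda>k. Y k y)" and Y_indep: "independent (range (\<lambda>k. Y k y))" if "y \<in> \<Omega>" for y
  proof -
    have 1: "inj_on (\<lambda>I. comm_field X I y) B" "independent ((\<lambda>I. comm_field X I y) ` B)"
      using assms(7) that unfolding commutator_basis_def by auto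
    have "B = \<beta> ` UNIV" "inj \<beta>" using \<beta> by (auto simp: bij_betw_def)
    then show "inj (\<lambda>k. Y k y)" "independent (range (\<lambda>k. Y k y))"
      using 1 comp_inj_on[of \<beta> UNIV "\<lambda>I. comm_field X I y"] by (simp_all add: Y_def o_def image_image)
  qed
  have inj: "u = 0" if y: "y \<in> \<Omega>" and 0: "frame_comb Y y u = 0" for y u
  proof -
    define g where "g = (\<lambda>v. u $ the_inv (\<lambda>k. Y k y) v)"
    have g: "g (Y k y) = u $ k" for k unfolding g_def by (simp add: the_inv_f_f[OF Y_inj[OF y]])
    have "(\<Sum>v\<in>range (\<lambda>k. Y k y). g v *\<^sub>R v) = 0"
      using 0 by (simp add: sum.reindex[OF Y_inj[OF y]] g frame_comb_def)
    then have "g (Y k y) = 0" for k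
      using independentD[OF Y_indep[OF y], of "range (\<lambda>k. Y k y)" g "Y k y"] by simp
    then show "u = 0" by (simp add: g vec_eq_iff)
  qed
  have bracket: "\<exists>c. lie_bracket (Y i) (Y j) y = frame_comb Y y c \<and> (\<forall>k. w i + w j < w k \<longrightarrow> c $ k = 0)"
    if y: "y \<in> \<Omega>" for i j y
  proof -
    define T where "T = {k. w k \<le> w i + w j}"
    have "(\<lambda>L. comm_field X L y) ` {L \<in> B. weight L \<le> weight (\<beta> i) + weight (\<beta> j)} = (\<lambda>k. Y k y) ` T"
      using \<beta> by (auto simp: bij_betw_def T_def Y_def w_def)
    then have "lie_bracket (Y i) (Y j) y \<in> span ((\<lambda>k. Y k y) ` T)"
      using bracket_in_filtered_span[OF assms(1,4,5,7) \<beta>B \<beta>B y, of i j] by (simp add: Y_def)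
    then obtain g where "lie_bracket (Y i) (Y j) y = (\<Sum>v\<in>(\<lambda>k. Y k y) ` T. g v *\<^sub>R v)"
      by (subst (asm) span_finite) auto
    also have "\<dots> = (\<Sum>k\<in>T. g (Y k y) *\<^sub>R Y k y)"
      using inj_on_subset[OF Y_inj[OF y]] by (subst sum.reindex) auto
    also have "\<dots> = frame_comb Y y (\<chi> k. if k \<in> T then g (Y k y) else 0)"
      unfolding frame_comb_def by (intro sum.mono_neutral_cong_left) auto
    finally show ?thesis by (intro exI[of _ "\<chi> k. if k \<in> T then g (Y k y) else 0"]) (auto simp: T_def)
  qed
  have "\<exists>\<rho> L. \<forall>x\<in>closure \<Omega>'. frame_ball \<Omega> Y w (\<lambda>k y. fderiv (Y k) y) x \<rho> L"
    by (rule exists_frame_ball[OF assms(1,8,9)]) (rule smooth | erule (1) inj | erule bracket | rule w1)+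
  then obtain \<rho> L where fb: "\<And>x. x \<in> closure \<Omega>' \<Longrightarrow> frame_ball \<Omega> Y w (\<lambda>k y. fderiv (Y k) y) x \<rho> L"
    by blast
  define Q where "Q = (\<Sum>k\<in>UNIV. w k)"
  obtain C R\<^sub>1 c\<^sub>1 c\<^sub>2 where pos: "C > 0" "R\<^sub>1 > 0" "c\<^sub>1 > 0" "c\<^sub>2 > 0"
    and main: "\<forall>x. frame_ball \<Omega> Y w (\<lambda>k y. fderiv (Y k) y) x \<rho> L \<longrightarrow> (\<forall>R. 0 < R \<and> R \<le> R\<^sub>1 \<longrightarrow>
      frame_box \<Omega> Y w x R \<subseteq> frame_reach \<Omega> Y w x R \<and>
      frame_reach \<Omega> Y w x R \<subseteq> frame_box \<Omega> Y w x (C * R) \<and>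
      c\<^sub>1 * R ^ Q \<le> measure lebesgue (frame_reach \<Omega> Y w x R) \<and>
      measure lebesgue (frame_reach \<Omega> Y w x R) \<le> c\<^sub>2 * R ^ Q)"
    using frame_ball_uniform[of \<Omega> Y w "\<lambda>k y. fderiv (Y k) y" \<rho> L] unfolding Q_def by (elim exE conjE)
  have ball_eq: "cc_ball \<Omega> B (comm_field X) x R = frame_reach \<Omega> Y w x R" for x R
    unfolding Y_def w_def by (rule cc_ball_eq_frame_reach[OF \<beta>])
  have box_eq: "cc_box \<Omega> B (comm_field X) x R = frame_box \<Omega> Y w x R" for x R
    unfolding Y_def w_def by (rule cc_box_eq_frame_box[OF \<beta>])
  have Q_eq: "(\<Sum>I\<in>B. weight I) = Q"
    unfolding Q_def w_def by (rule sum.reindex_bij_betw[OF \<beta>, symmetric])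
  show ?thesis
    unfolding ball_eq box_eq Q_eq
  proof (intro exI conjI ballI allI impI)
    \<comment> \<open>Halving the radius leaves room for the volume estimate at
      \<open>2 * R\<close>; the doubling constant is the quotient of the upper bound at
      \<open>2 * R\<close> and the lower bound at \<open>R\<close>.\<close>
    show "C > 0" "R\<^sub>1 / 2 > 0" "c\<^sub>1 > 0" "c\<^sub>2 > 0" "c\<^sub>2 * 2 ^ Q / c\<^sub>1 > 0" using pos by auto
    fix x R assume "x \<in> \<Omega>'" and R: "0 < R \<and> R \<le> R\<^sub>1 / 2"
    then have x: "frame_ball \<Omega> Y w (\<lambda>k y. fderiv (Y k) y) x \<rho> L"
      using fb closure_subset by blast
    have "0 < R \<and> R \<le> R\<^sub>1" "0 < 2 * R \<and> 2 * R \<le> R\<^sub>1" using R by auto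
    note m = mp[OF spec[OF mp[OF spec[OF main] x]] this(1)] and m2 = mp[OF spec[OF mp[OF spec[OF main] x]] this(2)]
    show "frame_box \<Omega> Y w x R \<subseteq> frame_reach \<Omega> Y w x R"
      "frame_reach \<Omega> Y w x R \<subseteq> frame_box \<Omega> Y w x (C * R)"
      "c\<^sub>1 * R ^ Q \<le> measure lebesgue (frame_reach \<Omega> Y w x R)"
      "measure lebesgue (frame_reach \<Omega> Y w x R) \<le> c\<^sub>2 * R ^ Q"
      using m by auto
    have "measure lebesgue (frame_reach \<Omega> Y w x (2 * R)) \<le> c\<^sub>2 * 2 ^ Q / c\<^sub>1 * (c\<^sub>1 * R ^ Q)"
      using m2 pos by (simp add: power_mult_distrib)
    also have "\<dots> \<le> c\<^sub>2 * 2 ^ Q / c\<^sub>1 * measure lebesgue (frame_reach \<Omega> Y w x R)"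
      using m pos by (intro mult_left_mono) auto
    finally show "measure lebesgue (frame_reach \<Omega> Y w x (2 * R)) \<le>
        c\<^sub>2 * 2 ^ Q / c\<^sub>1 * measure lebesgue (frame_reach \<Omega> Y w x R)" .
  qed
qed

end
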